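(* Let $1\to H\to G\stackrel{p}{\to}G/H\to1$ be a short exact sequence of groups where the quotient $G/H$ is finitely generated and amenable. Let $\sigma'$ be a multiplier on $G/H$ and let $\sigma=p^*\sigma'$ be its pullback to $G$. Let $A\in M_d(\mathbb C(G,\sigma))$ be self-adjoint as an operator on $l^2(G)^d$, and let $\{X_m\}_{m\ge1}$ be a F\o{}lner exhaustion of $G/H$. Put $A^{(m)}=P_{X_m}A|_{\mathcal H_{X_m}}$ and let $$F_m(\lambda)=\tau_{X_m}\big(\chi_{(-\infty,\lambda]}(A^{(m)})\big),\qquad F(\lambda)=\tau\big(\chi_{(-\infty,\lambda]}(A)\big)$$ be the spectral density functions. Then $$\lim_{m\to\infty}F_m(\lambda)=F(\lambda)\qquad\text{for all }\lambda\in\mathbb R.$$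
   Context: Groups are discrete. A multiplier on a group $Q$ is a normalized 2-cocycle $\sigma':Q\times Q\to U(1)$: $\sigma'(b,c)\sigma'(a,bc)=\sigma'(ab,c)\sigma'(a,b)$, $\sigma'(1,g)=\sigma'(g,1)=1$. The pullback is $p^*\sigma'(g,h)=\sigma'(p(g),p(h))$. $\mathbb C(G,\sigma)$ is the twisted group algebra: finite sums $\sum a_g g$ with $(\sum a_g g)(\sum b_h h)=\sum_k\big(\sum_{gh=k}a_gb_h\sigma(g,h)\big)k$. $A\in M_d(\mathbb C(G,\sigma))$, with matrices of coefficients $A(g)\in M_d(\mathbb C)$, acts on $f\in l^2(G)^d$ by $(Af)(x)=\sum_{h\in G}A(xh^{-1})\sigma(xh^{-1},h)f(h)$. $\mathcal A=W_L^*(G,\sigma)\otimes M_d(\mathbb C)$, where $W_L^*(G,\sigma)$ is the von Neumann algebra generated by the left translations $(L^\sigma_gf)(x)=f(g^{-1}x)\sigma(g,g^{-1}x)$ on $l^2(G)$. For $B\in\mathcal A$, viewed as a $d\times d$ matrix $(B_{a,b})$ of operators on $l^2(G)$, $\tau(B)=\sum_{a=1}^d(B_{a,a}\delta_e,\delta_e)$. For a finite non-empty subset $X\subset G/H$: $\mathcal H_X=l^2(p^{-1}(X))^d\subset l^2(G)^d$ is the subspace of functions supported on $p^{-1}(X)$, $P_X$ is the orthogonal projection onto $\mathcal H_X$, and $\mathcal A_X=B(\mathcal H_X)^H$ is the commutant of the right $H$-translations on $\mathcal H_X$. Fix a right inverse $s:G/H\to G$ of $p$. For $B\in\mathcal A_X$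 with components $(B_{a,b})_{g,k}$ ($g,k\in G$, $a,b=1,\dots,d$; i.e. the matrix entries with respect to the standard orthonormal basis), $$\tau_X(B)=\frac1{\#X}\sum_{a=1}^d\sum_{x\in X}(B_{a,a})_{s(x),s(x)}.$$ The compression $P_XA|_{\mathcal H_X}$ belongs to $\mathcal A_X$. A F\o{}lner exhaustion of $G/H$ is an exhaustion of $G/H$ by finite subsets $X_1\subset X_2\subset\cdots$ with $\bigcup_mX_m=G/H$ such that for each fixed $\delta>0$, $\#\partial_\delta X_m/\#X_m\to0$ as $m\to\infty$, where $\partial_\delta X_m$ is the set of points of $(G/H)\setminus X_m$ at word-metric distance at most $\delta$ from $X_m$. $\chi_{(-\infty,\lambda]}$ is the characteristic function of $(-\infty,\lambda]$, applied by the Borel functional calculus. *)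

theory Defs
  imports "HOL-Analysis.Analysis" "HOL-Algebra.Generated_Groups"
begin

section \<open>Groups: multipliers, amenability, Foelner exhaustions\<close>

definition multiplier :: "('q, 'x) monoid_scheme \<Rightarrow> ('q \<Rightarrow> 'q \<Rightarrow> complex) \<Rightarrow> bool" where
  "multiplier Q \<sigma> \<longleftrightarrow>
     (\<forall>a\<in>carrier Q. \<forall>b\<in>carrier Q. norm (\<sigma> a b) = 1) \<and>
     (\<forall>a\<in>carrier Q. \<forall>b\<in>carrier Q. \<forall>c\<in>carrier Q.
        \<sigma> b c * \<sigma> a (b \<otimes>\<^bsub>Q\<^esub> c) = \<sigma> (a \<otimes>\<^bsub>Q\<^esub> b) c * \<sigma> a b) \<and>
     (\<forall>g\<in>carrier Q. \<sigma> \<one>\<^bsub>Q\<^esub> g = 1 \<and> \<sigma> g \<one>\<^bsub>Q\<^esub> = 1)"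

definition pullback :: "('g \<Rightarrow> 'q) \<Rightarrow> ('q \<Rightarrow> 'q \<Rightarrow> complex) \<Rightarrow> 'g \<Rightarrow> 'g \<Rightarrow> complex" where
  "pullback p \<sigma> g h = \<sigma> (p g) (p h)"

text \<open>Amenability of a discrete group: a finitely additive, left invariant probability
  measure on all subsets.\<close>

definition amenable :: "('q, 'x) monoid_scheme \<Rightarrow> bool" where
  "amenable Q \<longleftrightarrow> (\<exists>\<mu> :: 'q set \<Rightarrow> real.
     \<mu> (carrier Q) = 1 \<and>
     (\<forall>A. A \<subseteq> carrier Q \<longrightarrow> 0 \<le> \<mu> A) \<and>
     (\<forall>A B. A \<subseteq> carrier Q \<and> B \<subseteq> carrier Q \<and> A \<inter> B = {} \<longrightarrow> \<mu> (A \<union> B) = \<mu> A + \<mu> B) \<and>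
     (\<forall>A g. A \<subseteq> carrier Q \<and> g \<in> carrier Q \<longrightarrow> \<mu> (g <#\<^bsub>Q\<^esub> A) = \<mu> A))"

definition finite_generating_set :: "('q, 'x) monoid_scheme \<Rightarrow> 'q set \<Rightarrow> bool" where
  "finite_generating_set Q S \<longleftrightarrow> finite S \<and> S \<subseteq> carrier Q \<and> generate Q S = carrier Q"

definition word_length :: "('q, 'x) monoid_scheme \<Rightarrow> 'q set \<Rightarrow> 'q \<Rightarrow> nat" where
  "word_length Q S g = (LEAST n. \<exists>ws. length ws = n \<and>
      set ws \<subseteq> S \<union> (\<lambda>s. inv\<^bsub>Q\<^esub> s) ` S \<and> foldr (\<lambda>s t. s \<otimes>\<^bsub>Q\<^esub> t) ws \<one>\<^bsub>Q\<^esub> = g)"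

text \<open>The word metric is the right invariant one, i.e. two points are adjacent if they differ by
  left multiplication with a generator.  This is the choice that matches operators acting by
  left convolution: \<open>(A f) x\<close> only involves \<open>f h\<close> with \<open>x h\<inverse>\<close> in the support of \<open>A\<close>.\<close>

definition word_dist :: "('q, 'x) monoid_scheme \<Rightarrow> 'q set \<Rightarrow> 'q \<Rightarrow> 'q \<Rightarrow> nat" where
  "word_dist Q S x y = word_length Q S (x \<otimes>\<^bsub>Q\<^esub> inv\<^bsub>Q\<^esub> y)"

definition outer_boundary :: "('q, 'x) monoid_scheme \<Rightarrow> 'q set \<Rightarrow> real \<Rightarrow> 'q set \<Rightarrow> 'q set" where
  "outer_boundary Q S \<delta> X = {y \<in> carrier Q - X. \<exists>x\<in>X. real (word_dist Q S y x) \<le> \<delta>}"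

definition foelner_exhaustion ::
    "('q, 'x) monoid_scheme \<Rightarrow> 'q set \<Rightarrow> (nat \<Rightarrow> 'q set) \<Rightarrow> bool" where
  "foelner_exhaustion Q S X \<longleftrightarrow>
     (\<forall>m. finite (X m) \<and> X m \<noteq> {} \<and> X m \<subseteq> carrier Q) \<and>
     incseq X \<and> (\<Union>m. X m) = carrier Q \<and>
     (\<forall>\<delta>>0. (\<lambda>m. real (card (outer_boundary Q S \<delta> (X m))) / real (card (X m))) \<longlonglongrightarrow> 0)"

section \<open>The Hilbert spaces\<close>

text \<open>\<open>ell2 Y\<close> is \<open>l\<^sup>2(Y)\<^sup>d\<close>, where \<open>d\<close> is the cardinality of the index type, realised
  as the functions supported in \<open>Y\<close>.  Operators on \<open>ell2 Y\<close> are HOL functions of which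
  only the values on \<open>ell2 Y\<close> matter.\<close>

definition ell2 :: "'g set \<Rightarrow> ('g \<Rightarrow> complex ^ 'd) set" where
  "ell2 Y = {f. (\<forall>x. x \<notin> Y \<longrightarrow> f x = 0) \<and> (\<lambda>x. (norm (f x))\<^sup>2) summable_on UNIV}"

definition ip :: "('g \<Rightarrow> complex ^ 'd) \<Rightarrow> ('g \<Rightarrow> complex ^ 'd) \<Rightarrow> complex" where
  "ip f h = (\<Sum>\<^sub>\<infinity>x. \<Sum>a\<in>UNIV. f x $ a * cnj (h x $ a))"

definition l2norm :: "('g \<Rightarrow> complex ^ 'd) \<Rightarrow> real" where
  "l2norm f = sqrt (\<Sum>\<^sub>\<infinity>x. (norm (f x))\<^sup>2)"

definition basis_vec :: "'g \<Rightarrow> 'd \<Rightarrow> 'g \<Rightarrow> complex ^ 'd" where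
  "basis_vec g a = (\<lambda>x. if x = g then axis a 1 else 0)"

definition bounded_op ::
    "'g set \<Rightarrow> (('g \<Rightarrow> complex ^ 'd) \<Rightarrow> ('g \<Rightarrow> complex ^ 'd)) \<Rightarrow> bool" where
  "bounded_op Y B \<longleftrightarrow>
     (\<forall>f\<in>ell2 Y. B f \<in> ell2 Y) \<and>
     (\<forall>f\<in>ell2 Y. \<forall>h\<in>ell2 Y. B (\<lambda>x. f x + h x) = (\<lambda>x. B f x + B h x)) \<and>
     (\<forall>c. \<forall>f\<in>ell2 Y. B (\<lambda>x. c *s f x) = (\<lambda>x. c *s B f x)) \<and>
     (\<exists>C. \<forall>f\<in>ell2 Y. l2norm (B f) \<le> C * l2norm f)"

definition self_adjoint_op ::
    "'g set \<Rightarrow> (('g \<Rightarrow> complex ^ 'd) \<Rightarrow> ('g \<Rightarrow> complex ^ 'd)) \<Rightarrow> bool" where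
  "self_adjoint_op Y B \<longleftrightarrow> (\<forall>f\<in>ell2 Y. \<forall>h\<in>ell2 Y. ip (B f) h = ip f (B h))"

definition orth_projection ::
    "'g set \<Rightarrow> (('g \<Rightarrow> complex ^ 'd) \<Rightarrow> ('g \<Rightarrow> complex ^ 'd)) \<Rightarrow> bool" where
  "orth_projection Y B \<longleftrightarrow>
     bounded_op Y B \<and> self_adjoint_op Y B \<and> (\<forall>f\<in>ell2 Y. B (B f) = B f)"

section \<open>Borel functional calculus\<close>

text \<open>For a projection valued measure \<open>E\<close> this is the scalar measure
  \<open>S \<mapsto> \<langle>E(S) u, u\<rangle>\<close>, which is real and nonnegative.\<close>

definition scalar_measure ::
    "(real set \<Rightarrow> ('g \<Rightarrow> complex ^ 'd) \<Rightarrow> ('g \<Rightarrow> complex ^ 'd)) \<Rightarrow>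
     ('g \<Rightarrow> complex ^ 'd) \<Rightarrow> real measure" where
  "scalar_measure E u = measure_of UNIV (sets borel) (\<lambda>S. ennreal (Re (ip (E S u) u)))"

text \<open>\<open>E\<close> is the resolution of the identity of \<open>A\<close> on \<open>ell2 Y\<close>: a compactly supported
  projection valued Borel measure on the real line with \<open>A = \<integral> t dE(t)\<close>, the latter tested on
  the diagonal (which suffices by polarization).\<close>

definition spectral_resolution ::
    "'g set \<Rightarrow> (('g \<Rightarrow> complex ^ 'd) \<Rightarrow> ('g \<Rightarrow> complex ^ 'd)) \<Rightarrow>
     (real set \<Rightarrow> ('g \<Rightarrow> complex ^ 'd) \<Rightarrow> ('g \<Rightarrow> complex ^ 'd)) \<Rightarrow> bool" where
  "spectral_resolution Y A E \<longleftrightarrow>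
     (\<forall>S\<in>sets borel. orth_projection Y (E S)) \<and>
     (\<forall>u\<in>ell2 Y. E UNIV u = u) \<and>
     (\<forall>S\<in>sets borel. \<forall>T\<in>sets borel. \<forall>u\<in>ell2 Y. E (S \<inter> T) u = E S (E T u)) \<and>
     (\<forall>S :: nat \<Rightarrow> real set. range S \<subseteq> sets borel \<and> disjoint_family S \<longrightarrow>
        (\<forall>u\<in>ell2 Y. (\<lambda>n. ip (E (S n) u) u) sums ip (E (\<Union>n. S n) u) u)) \<and>
     (\<exists>M. \<forall>u\<in>ell2 Y. E {-M..M} u = u) \<and>
     (\<forall>u\<in>ell2 Y. ip (A u) u = complex_of_real (\<integral>t. t \<partial>scalar_measure E u))"

text \<open>By the spectral theorem a bounded self-adjoint \<open>A\<close> has a resolution of the identity, and its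
  values \<open>E S u\<close> for Borel \<open>S\<close> and \<open>u \<in> ell2 Y\<close> are unique; likewise the operator \<open>f(A)\<close> below is
  unique on \<open>ell2 Y\<close>.  The choice operators therefore only fix irrelevant values.\<close>

definition spectral_measure ::
    "'g set \<Rightarrow> (('g \<Rightarrow> complex ^ 'd) \<Rightarrow> ('g \<Rightarrow> complex ^ 'd)) \<Rightarrow>
     real set \<Rightarrow> ('g \<Rightarrow> complex ^ 'd) \<Rightarrow> ('g \<Rightarrow> complex ^ 'd)" where
  "spectral_measure Y A = (SOME E. spectral_resolution Y A E)"

text \<open>\<open>f(A) = \<integral> f dE\<close> for a bounded Borel function \<open>f\<close>.\<close>

definition borel_calculus ::
    "'g set \<Rightarrow> (('g \<Rightarrow> complex ^ 'd) \<Rightarrow> ('g \<Rightarrow> complex ^ 'd)) \<Rightarrow> (real \<Rightarrow> complex) \<Rightarrow>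
     ('g \<Rightarrow> complex ^ 'd) \<Rightarrow> ('g \<Rightarrow> complex ^ 'd)" where
  "borel_calculus Y A f = (SOME B. bounded_op Y B \<and>
     (\<forall>u\<in>ell2 Y. ip (B u) u = (\<integral>t. f t \<partial>scalar_measure (spectral_measure Y A) u)))"

section \<open>Twisted group algebra, compressions and traces\<close>

text \<open>Elements of \<open>M\<^sub>d(\<complex>(G,\<sigma>))\<close>, given by their matrix coefficients \<open>g \<mapsto> A(g)\<close>.  The underlying
  set does not depend on \<open>\<sigma>\<close>, which only enters the product and the action.\<close>

definition twisted_matrices :: "('g, 'x) monoid_scheme \<Rightarrow> ('g \<Rightarrow> complex ^ 'd ^ 'd) set" where
  "twisted_matrices G = {A. finite {g. A g \<noteq> 0} \<and> {g. A g \<noteq> 0} \<subseteq> carrier G}"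

definition twisted_op ::
    "('g, 'x) monoid_scheme \<Rightarrow> ('g \<Rightarrow> 'g \<Rightarrow> complex) \<Rightarrow> ('g \<Rightarrow> complex ^ 'd ^ 'd) \<Rightarrow>
     ('g \<Rightarrow> complex ^ 'd) \<Rightarrow> ('g \<Rightarrow> complex ^ 'd)" where
  "twisted_op G \<sigma> A f = (\<lambda>x. if x \<in> carrier G
     then \<Sum>\<^sub>\<infinity>h\<in>carrier G.
            A (x \<otimes>\<^bsub>G\<^esub> inv\<^bsub>G\<^esub> h) *v (\<sigma> (x \<otimes>\<^bsub>G\<^esub> inv\<^bsub>G\<^esub> h) h *s f h)
     else 0)"

definition preimage :: "('g, 'x) monoid_scheme \<Rightarrow> ('g \<Rightarrow> 'q) \<Rightarrow> 'q set \<Rightarrow> 'g set" where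
  "preimage G p X = {g \<in> carrier G. p g \<in> X}"

text \<open>The orthogonal projection onto \<open>ell2 Y\<close> cuts functions down to \<open>Y\<close>.\<close>

definition cut :: "'g set \<Rightarrow> ('g \<Rightarrow> complex ^ 'd) \<Rightarrow> ('g \<Rightarrow> complex ^ 'd)" where
  "cut Y f = (\<lambda>x. if x \<in> Y then f x else 0)"

definition compression ::
    "'g set \<Rightarrow> (('g \<Rightarrow> complex ^ 'd) \<Rightarrow> ('g \<Rightarrow> complex ^ 'd)) \<Rightarrow>
     ('g \<Rightarrow> complex ^ 'd) \<Rightarrow> ('g \<Rightarrow> complex ^ 'd)" where
  "compression Y B f = cut Y (B f)"

text \<open>The matrix entry \<open>(B\<^sub>a\<^sub>,\<^sub>b)\<^sub>g\<^sub>,\<^sub>k\<close> in the standard orthonormal basis.\<close>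

definition entry ::
    "(('g \<Rightarrow> complex ^ 'd) \<Rightarrow> ('g \<Rightarrow> complex ^ 'd)) \<Rightarrow> 'd \<Rightarrow> 'd \<Rightarrow> 'g \<Rightarrow> 'g \<Rightarrow> complex" where
  "entry B a b g k = ip (B (basis_vec k b)) (basis_vec g a)"

definition tau ::
    "('g, 'x) monoid_scheme \<Rightarrow> (('g \<Rightarrow> complex ^ 'd) \<Rightarrow> ('g \<Rightarrow> complex ^ 'd)) \<Rightarrow> complex" where
  "tau G B = (\<Sum>a\<in>UNIV. entry B a a \<one>\<^bsub>G\<^esub> \<one>\<^bsub>G\<^esub>)"

definition tau_on ::
    "('q \<Rightarrow> 'g) \<Rightarrow> 'q set \<Rightarrow> (('g \<Rightarrow> complex ^ 'd) \<Rightarrow> ('g \<Rightarrow> complex ^ 'd)) \<Rightarrow> complex" where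
  "tau_on s X B = 1 / of_nat (card X) * (\<Sum>a\<in>UNIV. \<Sum>x\<in>X. entry B a a (s x) (s x))"

text \<open>The spectral density functions \<open>F\<close> and \<open>F\<^sub>m\<close> (the latter for \<open>X = X\<^sub>m\<close>).  They are
  complex valued because the traces are; their values are real.\<close>

definition spectral_density ::
    "('g, 'x) monoid_scheme \<Rightarrow> ('g \<Rightarrow> 'g \<Rightarrow> complex) \<Rightarrow> ('g \<Rightarrow> complex ^ 'd ^ 'd) \<Rightarrow>
     real \<Rightarrow> complex" where
  "spectral_density G \<sigma> A t =
     tau G (borel_calculus (carrier G) (twisted_op G \<sigma> A) (indicator {..t}))"

definition spectral_density_on ::
    "('g, 'x) monoid_scheme \<Rightarrow> ('g \<Rightarrow> 'q) \<Rightarrow> ('q \<Rightarrow> 'g) \<Rightarrow> ('g \<Rightarrow> 'g \<Rightarrow> complex) \<Rightarrow>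
     ('g \<Rightarrow> complex ^ 'd ^ 'd) \<Rightarrow> 'q set \<Rightarrow> real \<Rightarrow> complex" where
  "spectral_density_on G p s \<sigma> A X t =
     tau_on s X (borel_calculus (preimage G p X)
       (compression (preimage G p X) (twisted_op G \<sigma> A)) (indicator {..t}))"

end

theory Submission
  imports Defs "HOL-Probability.Helly_Selection"
begin

text \<open>Write \<open>\<mu>\<^sub>m\<close> for the average, over \<open>x \<in> X\<^sub>m\<close>, of the spectral measures of \<open>A\<^sup>(\<^sup>m\<^sup>)\<close> at the basis
  vectors at \<open>s x\<close>, and \<open>\<mu>\<close> for the sum of the spectral measures of \<open>A\<close> at the basis vectors at the
  unit, so that \<open>F\<^sub>m\<close> and \<open>F\<close> are their distribution functions.  Convergence at every point,
  jumps included, comes from two facts.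

  First, \<open>\<mu>\<^sub>m \<rightarrow> \<mu>\<close> weakly.  All these measures live on one compact interval, so it is enough to
  compare moments.  The operator \<open>A\<close> commutes with twisted right translations, so its moments at a basis
  vector do not depend on the point (\<open>moments_homogeneous\<close>); and \<open>A\<close> has finite propagation, so the
  \<open>j\<close>-th moments of \<open>A\<close> and \<open>A\<^sup>(\<^sup>m\<^sup>)\<close> agree at all points of \<open>X\<^sub>m\<close> but those near the boundary
  (\<open>averaged_moment_bound\<close>), which the Foelner condition makes negligible.

  Second, the jump of \<open>F\<close> at \<open>t\<close> is at most that of \<open>F\<^sub>m\<close> plus \<open>o(1)\<close>.  An eigenfunction of \<open>A\<close>, cut down
  to the preimage of \<open>X\<^sub>m\<close>, is annihilated by \<open>A\<^sup>(\<^sup>m\<^sup>) - t\<close> outside a set \<open>D\<close> near the boundary.  So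
  the von Neumann dimension over \<open>H\<close> of the cut down eigenspace exceeds that of \<open>ker (A\<^sup>(\<^sup>m\<^sup>) - t)\<close>
  by at most that of the functions on \<open>D\<close> (\<open>kernel_trace_inequality\<close>).  Weak convergence bounds the
  limits of \<open>F\<^sub>m(t)\<close> by \<open>F(t)\<close> from above, and those of \<open>F\<^sub>m(t-)\<close> by \<open>F(t-)\<close> from below; adding
  the jumps gives \<open>F\<^sub>m(t) \<rightarrow> F(t)\<close> (\<open>distribution_functions_converge\<close>).

  The second fact is proved by traces of polynomials.  The projection onto the kernel of
  an operator \<open>N\<close> between \<open>0\<close> and \<open>1\<close> is the strong limit of \<open>(1 - N)\<^sup>n\<close>, and
  the rule \<open>tr q(B\<^sup>* B) = tr q(B B\<^sup>*)\<close>, where \<open>q(0) = 0\<close>, takes the place of the equality of row and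
  column rank.

  The Borel functional calculus is defined through a choice of a resolution of the identity, so existence
  and uniqueness of the latter have to be shown.  Both rest on moments: the numbers
  \<open>\<langle>A\<^sup>j u, u\<rangle>\<close> are the moments of a measure by Hausdorff's theorem, signed measures on a compact interval
  are determined by their moments, and the spectral projections arise from these measures by polarization
  and the representation theorem of Riesz.  This is done in real Hilbert spaces; on \<open>l\<^sup>2\<close> the complex
  structure is multiplication by \<open>\<i>\<close>, an isometry that commutes with all operators in question.\<close>

section \<open>The Hausdorff moment problem\<close>

lemma sum_binomial_Suc:
  fixes f :: "nat \<Rightarrow> real"
  shows "(\<Sum>k\<le>Suc n. real (Suc n choose k) * f k) = (\<Sum>k\<le>n. real (n choose k) * (f k + f (Suc k)))"
proof -
  have "(\<Sum>k\<le>Suc n. real (Suc n choose k) * f k)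
      = f 0 + (\<Sum>k\<le>n. real (n choose Suc k) * f (Suc k)) + (\<Sum>k\<le>n. real (n choose k) * f (Suc k))"
    by (simp add: sum.atMost_Suc_shift sum.distrib algebra_simps del: sum.atMost_Suc)
  also have "f 0 + (\<Sum>k\<le>n. real (n choose Suc k) * f (Suc k)) = (\<Sum>k\<le>Suc n. real (n choose k) * f k)"
    by (simp add: sum.atMost_Suc_shift del: sum.atMost_Suc)
  finally show ?thesis
    by (simp add: sum.distrib algebra_simps)
qed

lemma sum_binomial_absorb:
  fixes f :: "nat \<Rightarrow> real"
  shows "(\<Sum>k\<le>Suc n. real (Suc n choose k) * (real k / real (Suc n)) * f k)
    = (\<Sum>k\<le>n. real (n choose k) * f (Suc k))"
proof -
  have "real (Suc n choose Suc k) * (real (Suc k) / real (Suc n)) = real (n choose k)" for k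
  proof -
    have "real (Suc k) * real (Suc n choose Suc k) = real (Suc n) * real (n choose k)"
      by (metis Suc_times_binomial of_nat_mult)
    then show ?thesis by (simp add: field_simps)
  qed
  then show ?thesis
    by (simp add: sum.atMost_Suc_shift del: sum.atMost_Suc of_nat_Suc binomial_Suc_Suc times_divide_eq_right times_divide_eq_left)
qed

lemma bernstein_total:
  fixes m :: "nat \<Rightarrow> nat \<Rightarrow> real"
  assumes pascal: "\<And>a b. m a b = m (Suc a) b + m a (Suc b)"
  shows "(\<Sum>k\<le>n. real (n choose k) * m (i + k) (n - k)) = m i 0"
proof (induction n)
  case (Suc n)
  have "(\<Sum>k\<le>Suc n. real (Suc n choose k) * m (i + k) (Suc n - k))
      = (\<Sum>k\<le>n. real (n choose k) * (m (i + k) (Suc n - k) + m (i + Suc k) (Suc n - Suc k)))"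
    by (rule sum_binomial_Suc)
  also have "\<dots> = (\<Sum>k\<le>n. real (n choose k) * m (i + k) (n - k))"
  proof (rule sum.cong)
    fix k assume "k \<in> {..n}"
    then show "real (n choose k) * (m (i + k) (Suc n - k) + m (i + Suc k) (Suc n - Suc k))
        = real (n choose k) * m (i + k) (n - k)"
      using pascal[of "i + k" "n - k"] by (simp add: Suc_diff_le)
  qed simp
  finally show ?case using Suc by simp
qed simp

text \<open>The numbers \<open>m a b\<close> stand for \<open>\<integral> t\<^sup>a (1 - t)\<^sup>b\<close>, and the sum for the integral of \<open>t\<^sup>i\<close> times the \<open>n\<close>-th
  Bernstein polynomial of \<open>t\<^sup>j\<close>.  One factor \<open>k / n\<close> can be absorbed into the binomial coefficient.  This
  trades a power \<open>j\<close> for a power \<open>i\<close>, at the cost of replacing \<open>(k + 1) / (n + 1)\<close> by \<open>k / n\<close>, an error of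
  order \<open>1 / n\<close>.\<close>

lemma bernstein_moments:
  fixes m :: "nat \<Rightarrow> nat \<Rightarrow> real"
  assumes nonneg: "\<And>a b. 0 \<le> m a b"
    and pascal: "\<And>a b. m a b = m (Suc a) b + m a (Suc b)"
  shows "(\<lambda>n. \<Sum>k\<le>n. real (n choose k) * m (i + k) (n - k) * (real k / real n) ^ j) \<longlonglongrightarrow> m (i + j) 0"
proof (induction j arbitrary: i)
  case 0
  show ?case by (simp add: bernstein_total[of m, OF pascal])
next
  case (Suc j)
  define s where "s n = (\<Sum>k\<le>n. real (n choose k) * m (i + k) (n - k) * (real k / real n) ^ Suc j)" for n
  define r where "r n = (\<Sum>k\<le>n. real (n choose k) * m (Suc i + k) (n - k) * (real k / real n) ^ j)" for n
  have s_Suc: "s (Suc n) = (\<Sum>k\<le>n. real (n choose k) * m (Suc i + k) (n - k) * (real (Suc k) / real (Suc n)) ^ j)" for n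
    using sum_binomial_absorb[of n "\<lambda>k. m (i + k) (Suc n - k) * (real k / real (Suc n)) ^ j"]
    unfolding s_def by (simp add: mult_ac del: sum.atMost_Suc of_nat_Suc binomial_Suc_Suc times_divide_eq_right times_divide_eq_left)
  have bound: "\<bar>s (Suc n) - r n\<bar> \<le> real j * m (Suc i) 0 / real (Suc n)" for n
  proof -
    have "\<bar>s (Suc n) - r n\<bar> = \<bar>\<Sum>k\<le>n. real (n choose k) * m (Suc i + k) (n - k)
        * ((real (Suc k) / real (Suc n)) ^ j - (real k / real n) ^ j)\<bar>"
      unfolding s_Suc r_def by (simp add: sum_subtractf right_diff_distrib)
    also have "\<dots> \<le> (\<Sum>k\<le>n. real (n choose k) * m (Suc i + k) (n - k) * (real j / real (Suc n)))"
    proof (rule order_trans[OF sum_abs sum_mono])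
      fix k assume k: "k \<in> {..n}"
      have "\<bar>(real (Suc k) / real (Suc n)) ^ j - (real k / real n) ^ j\<bar>
          \<le> real j * \<bar>real (Suc k) / real (Suc n) - real k / real n\<bar>"
        using k norm_power_diff[of "real (Suc k) / real (Suc n)" "real k / real n" j]
        by (simp add: divide_le_eq)
      also have "\<bar>real (Suc k) / real (Suc n) - real k / real n\<bar> \<le> 1 / real (Suc n)"
      proof (cases "n = 0")
        case False
        then have "real (Suc k) / real (Suc n) - real k / real n = (real n - real k) / (real n * real (Suc n))"
          by (simp add: field_simps)
        then have "\<bar>real (Suc k) / real (Suc n) - real k / real n\<bar> = (real n - real k) / (real n * real (Suc n))"
          using k by simp
        also have "\<dots> \<le> real n / (real n * real (Suc n))"
          by (intro divide_right_mono) auto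
        also have "\<dots> = 1 / real (Suc n)"
          using False by simp
        finally show ?thesis .
      qed (use k in simp)
      finally have "\<bar>(real (Suc k) / real (Suc n)) ^ j - (real k / real n) ^ j\<bar> \<le> real j / real (Suc n)"
        by (simp add: mult_left_mono)
      then show "\<bar>real (n choose k) * m (Suc i + k) (n - k)
          * ((real (Suc k) / real (Suc n)) ^ j - (real k / real n) ^ j)\<bar>
          \<le> real (n choose k) * m (Suc i + k) (n - k) * (real j / real (Suc n))"
        using nonneg[of "Suc i + k" "n - k"] unfolding abs_mult by (intro mult_mono) auto
    qed
    also have "\<dots> = m (Suc i) 0 * (real j / real (Suc n))"
      by (simp only: sum_distrib_right[symmetric] bernstein_total[of m, OF pascal])
    finally show ?thesis by (simp add: mult_ac)
  qed
  have "(\<lambda>n. s (Suc n) - r n) \<longlonglongrightarrow> 0"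
  proof (rule Lim_null_comparison)
    show "\<forall>\<^sub>F n in sequentially. norm (s (Suc n) - r n) \<le> real j * m (Suc i) 0 / real (Suc n)"
      using bound by simp
    show "(\<lambda>n. real j * m (Suc i) 0 / real (Suc n)) \<longlonglongrightarrow> 0"
      by (rule LIMSEQ_Suc[OF lim_const_over_n])
  qed
  moreover have "r \<longlonglongrightarrow> m (Suc i + j) 0"
    unfolding r_def by (rule Suc)
  ultimately have "(\<lambda>n. s (Suc n)) \<longlonglongrightarrow> m (Suc i + j) 0"
    using tendsto_add[of "\<lambda>n. s (Suc n) - r n" 0 sequentially r] by simp
  then show ?case
    unfolding s_def[symmetric] by (simp add: filterlim_sequentially_Suc)
qed

definition clamp01 :: "real \<Rightarrow> real" where
  "clamp01 t = max 0 (min 1 t)"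

lemma clamp01_bounds: "0 \<le> clamp01 t" "clamp01 t \<le> 1"
  by (auto simp: clamp01_def)

lemma clamp01_eq: "t \<in> {0..1} \<Longrightarrow> clamp01 t = t"
  by (auto simp: clamp01_def)

text \<open>The Bernstein weights \<open>(n choose k) m k (n - k)\<close> at the points \<open>k / n\<close> form measures of constant mass
  whose moments converge to the prescribed ones.  Helly's selection theorem provides a weak limit.\<close>

theorem hausdorff_moment_problem:
  fixes m :: "nat \<Rightarrow> nat \<Rightarrow> real"
  assumes nonneg: "\<And>a b. 0 \<le> m a b"
    and pascal: "\<And>a b. m a b = m (Suc a) b + m a (Suc b)"
  shows "\<exists>M. finite_measure M \<and> sets M = sets borel \<and> (AE t in M. t \<in> {0..1}) \<and>
    (\<forall>j. (\<integral>t. t ^ j \<partial>M) = m j 0)"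
proof (cases "m 0 0 = 0")
  case True
  \<comment> \<open>The degenerate case: all entries are bounded by the total mass, which is zero.\<close>
  have "m a b \<le> 0" for a b
  proof (induction "a + b" arbitrary: a b)
    case 0
    then show ?case using True by simp
  next
    case (Suc n)
    show ?case
    proof (cases a)
      case 0
      with Suc have "b = Suc n" by simp
      then show ?thesis using Suc(1)[of 0 n] pascal[of 0 n] nonneg[of 1 n] 0 by simp
    next
      case (Suc a')
      then show ?thesis using Suc.hyps(1)[of a' b] Suc.hyps(2) pascal[of a' b] nonneg[of a' "Suc b"] by simp
    qed
  qed
  then have "m j 0 = 0" for j
    using nonneg[of j 0] by (simp add: order_antisym)
  then have "finite_measure (null_measure borel) \<and> sets (null_measure borel) = sets borel \<and>
      (AE t in null_measure borel. t \<in> {0..1::real}) \<and> (\<forall>j. (\<integral>t. t ^ j \<partial>null_measure borel) = m j 0)"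
    by (auto intro!: finite_measureI AE_I[where N=UNIV] simp: integral_null_measure)
  then show ?thesis by blast
next
  case False
  define c where "c = m 0 0"
  have c: "c > 0"
    using False nonneg[of 0 0] by (simp add: c_def)
  define w where "w n k = real (n choose k) * m k (n - k) / c" for n k
  have w: "w n k \<ge> 0" for n k
    using c nonneg by (simp add: w_def)
  have w_sum: "(\<Sum>k\<le>n. w n k) = 1" for n
    using bernstein_total[of m, OF pascal, of n 0] c by (simp add: w_def c_def flip: sum_divide_distrib)
  define \<mu> where "\<mu> n = distr (point_measure {..n} (\<lambda>k. ennreal (w n k))) borel (\<lambda>k. real k / real n)" for n
  have int_\<mu>: "(\<integral>t. f t \<partial>\<mu> n) = (\<Sum>k\<le>n. w n k * f (real k / real n))"
    if "f \<in> borel_measurable borel" for f :: "real \<Rightarrow> real" and n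
    unfolding \<mu>_def using that w
    by (subst integral_distr) (auto simp: measurable_def space_point_measure sets_point_measure
        lebesgue_integral_point_measure_finite)
  have dist_\<mu>: "real_distribution (\<mu> n)" for n
  proof -
    have "prob_space (point_measure {..n} (\<lambda>k. ennreal (w n k)))"
      using w w_sum by (intro prob_spaceI) (simp add: space_point_measure emeasure_point_measure_finite sum_ennreal)
    then have "prob_space (\<mu> n)"
      unfolding \<mu>_def by (rule prob_space.prob_space_distr) (auto simp: measurable_def space_point_measure sets_point_measure)
    then show ?thesis
      unfolding real_distribution_def real_distribution_axioms_def by (auto simp: \<mu>_def)
  qed
  have "tight \<mu>"
    unfolding tight_def
  proof (intro conjI allI impI)
    fix e :: real assume e: "e > 0"
    have "measure (\<mu> n) {-1<..1} = 1" for n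
    proof -
      interpret real_distribution "\<mu> n" by (rule dist_\<mu>)
      have "measure (\<mu> n) {-1<..1} = (\<integral>t. indicator {-1<..1} t \<partial>\<mu> n)"
        by simp
      also have "\<dots> = (\<Sum>k\<le>n. w n k * indicator {-1<..1} (real k / real n))"
        by (rule int_\<mu>) simp
      also have "\<dots> = (\<Sum>k\<le>n. w n k)"
      proof (rule sum.cong)
        fix k assume "k \<in> {..n}"
        then have "real k / real n \<le> 1"
          by (auto simp: divide_le_eq)
        moreover have "-1 < real k / real n"
          by (rule less_le_trans[of _ 0]) auto
        ultimately show "w n k * indicator {-1<..1} (real k / real n) = w n k"
          by (simp add: indicator_def)
      qed simp
      finally show ?thesis by (simp add: w_sum)
    qed
    then show "\<exists>a b. a < b \<and> (\<forall>n. 1 - e < measure (\<mu> n) {a<..b})"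
      using e by (intro exI[of _ "-1"] exI[of _ 1]) simp
  qed (rule dist_\<mu>)
  then obtain r M where r: "strict_mono (r :: nat \<Rightarrow> nat)" and M: "real_distribution M"
    and conv: "weak_conv_m (\<mu> \<circ> id \<circ> r) M"
    using tight_imp_convergent_subsubsequence[of \<mu> id] by (auto simp: strict_mono_def)
  interpret M: real_distribution M by (rule M)
  have lim: "(\<lambda>n. \<integral>t. f t \<partial>\<mu> (r n)) \<longlonglongrightarrow> (\<integral>t. f t \<partial>M)"
    if "\<And>t. isCont f t" "\<And>t. \<bar>f t\<bar> \<le> B" for f :: "real \<Rightarrow> real" and B
    using weak_conv_imp_integral_bdd_continuous_conv[OF _ M conv, of f B] dist_\<mu> that by (simp add: o_def)
  have in01: "real k / real n \<in> {0..1}" if "k \<le> n" for k n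
    using that by (simp add: divide_le_eq)
  have "AE t in M. t \<in> {0..1}"
  proof -
    define f where "f t = min 1 \<bar>t - clamp01 t\<bar>" for t
    have f: "isCont f t" "\<bar>f t\<bar> \<le> 1" for t
      unfolding f_def clamp01_def by (auto intro!: continuous_intros)
    have [measurable]: "f \<in> borel_measurable borel"
      using f(1) by (intro borel_measurable_continuous_onI) (simp add: continuous_at_imp_continuous_on)
    have "(\<integral>t. f t \<partial>\<mu> n) = 0" for n
      using in01 by (subst int_\<mu>) (auto intro!: sum.neutral simp: f_def clamp01_eq)
    then have "(\<integral>t. f t \<partial>M) = 0"
      using lim[of f 1] f by (simp add: LIMSEQ_const_iff)
    then have "AE t in M. f t = 0"
      using f(2) by (subst (asm) integral_nonneg_eq_0_iff_AE)
        (auto intro!: M.integrable_const_bound[where B=1] simp: f_def)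
    then show ?thesis
      by eventually_elim (auto simp: f_def clamp01_def min_def max_def split: if_splits)
  qed
  have mom: "(\<integral>t. t ^ j \<partial>M) = m j 0 / c" for j
  proof -
    define f where "f t = clamp01 t ^ j" for t
    have f: "isCont f t" "\<bar>f t\<bar> \<le> 1" for t
    proof -
      show "isCont f t"
        unfolding f_def clamp01_def by (intro continuous_intros)
      show "\<bar>f t\<bar> \<le> 1"
        using clamp01_bounds[of t] by (simp add: f_def power_le_one)
    qed
    have [measurable]: "f \<in> borel_measurable borel"
      using f(1) by (intro borel_measurable_continuous_onI) (simp add: continuous_at_imp_continuous_on)
    have "(\<integral>t. f t \<partial>\<mu> n) = (\<Sum>k\<le>n. real (n choose k) * m (0 + k) (n - k) * (real k / real n) ^ j) / c" for n
      using in01 by (subst int_\<mu>) (auto simp: f_def clamp01_eq w_def sum_divide_distrib)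
    then have "(\<lambda>n. \<integral>t. f t \<partial>\<mu> n) \<longlonglongrightarrow> m (0 + j) 0 / c"
      using tendsto_divide[OF bernstein_moments[of m, OF nonneg pascal, of 0 j] tendsto_const, of c] c by simp
    from LIMSEQ_subseq_LIMSEQ[OF this r] have "(\<lambda>n. \<integral>t. f t \<partial>\<mu> (r n)) \<longlonglongrightarrow> m j 0 / c"
      by (simp add: o_def)
    then have "(\<integral>t. f t \<partial>M) = m j 0 / c"
      using lim[of f 1] f LIMSEQ_unique by blast
    moreover have "(\<integral>t. t ^ j \<partial>M) = (\<integral>t. f t \<partial>M)"
    proof (rule integral_cong_AE)
      show "AE t in M. t ^ j = f t"
        using \<open>AE t in M. t \<in> {0..1}\<close> by eventually_elim (simp only: f_def clamp01_eq)
    qed measurable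
    ultimately show ?thesis by simp
  qed
  define N where "N = density M (\<lambda>t. ennreal c)"
  have "emeasure N (space N) = ennreal c"
    using M.emeasure_space_1 by (simp add: N_def emeasure_density)
  then have "finite_measure N"
    by (intro finite_measureI) simp
  moreover have "sets N = sets borel"
    by (simp add: N_def)
  moreover have "AE t in N. t \<in> {0..1}"
    unfolding N_def using \<open>AE t in M. t \<in> {0..1}\<close> by (subst AE_density) (auto elim: eventually_mono)
  moreover have "(\<integral>t. t ^ j \<partial>N) = m j 0" for j
    unfolding N_def using c mom[of j] by (subst integral_density) auto
  ultimately show ?thesis
    by - (rule exI[of _ N], intro conjI allI)
qed

section \<open>Signed measures on a compact interval are determined by their moments\<close>

definition bounded_measure :: "real \<Rightarrow> real measure \<Rightarrow> bool" where
  "bounded_measure b M \<longleftrightarrow> finite_measure M \<and> sets M = sets borel \<and> (AE t in M. t \<in> {-b..b})"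

text \<open>Boundedness is only required on the interval that carries the measures, so that polynomials qualify.\<close>

definition bounded_fun :: "real \<Rightarrow> (real \<Rightarrow> real) \<Rightarrow> bool" where
  "bounded_fun b f \<longleftrightarrow> f \<in> borel_measurable borel \<and> (\<exists>B. \<forall>t\<in>{-b..b}. \<bar>f t\<bar> \<le> B)"

text \<open>A list of pairs \<open>(M, g)\<close> encodes the signed measure \<open>\<Sum> g dM\<close>.  Identities between several positive
  measures are stated as the vanishing of one such functional.\<close>

definition signed_integral :: "(real measure \<times> (real \<Rightarrow> real)) list \<Rightarrow> (real \<Rightarrow> real) \<Rightarrow> real" where
  "signed_integral xs f = (\<Sum>(M, g)\<leftarrow>xs. \<integral>t. f t * g t \<partial>M)"

lemma bounded_fun_bound: "bounded_fun b f \<Longrightarrow> \<exists>B. \<forall>t\<in>{-b..b}. \<bar>f t\<bar> \<le> B"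
  by (simp add: bounded_fun_def)

lemma bounded_fun_intros:
  "bounded_fun b (\<lambda>t. c)"
  "bounded_fun b (\<lambda>t. t)"
  "S \<in> sets borel \<Longrightarrow> bounded_fun b (indicator S)"
  "bounded_fun b f \<Longrightarrow> bounded_fun b g \<Longrightarrow> bounded_fun b (\<lambda>t. f t + g t)"
  "bounded_fun b f \<Longrightarrow> bounded_fun b g \<Longrightarrow> bounded_fun b (\<lambda>t. f t - g t)"
  "bounded_fun b f \<Longrightarrow> bounded_fun b g \<Longrightarrow> bounded_fun b (\<lambda>t. f t * g t)"
proof -
  show "bounded_fun b (\<lambda>t. c)" by (auto simp: bounded_fun_def)
  show "bounded_fun b (\<lambda>t. t)" by (auto simp: bounded_fun_def intro!: exI[of _ b])
  show "S \<in> sets borel \<Longrightarrow> bounded_fun b (indicator S)"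
    by (auto simp: bounded_fun_def indicator_def intro!: exI[of _ 1])
next
  assume "bounded_fun b f" "bounded_fun b g"
  then obtain B C where m[measurable]: "f \<in> borel_measurable borel" "g \<in> borel_measurable borel"
    and B: "\<And>t. t \<in> {-b..b} \<Longrightarrow> \<bar>f t\<bar> \<le> B" and C: "\<And>t. t \<in> {-b..b} \<Longrightarrow> \<bar>g t\<bar> \<le> C"
    unfolding bounded_fun_def by metis
  have "\<bar>f t + g t\<bar> \<le> B + C" "\<bar>f t - g t\<bar> \<le> B + C" "\<bar>f t * g t\<bar> \<le> B * C" if "t \<in> {-b..b}" for t
    using B[OF that] C[OF that] mult_mono[of "\<bar>f t\<bar>" B "\<bar>g t\<bar>" C] by (auto simp: abs_mult)
  moreover have "(\<lambda>t. f t + g t) \<in> borel_measurable borel" "(\<lambda>t. f t - g t) \<in> borel_measurable borel"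
      "(\<lambda>t. f t * g t) \<in> borel_measurable borel"
    by measurable
  ultimately show "bounded_fun b (\<lambda>t. f t + g t)" "bounded_fun b (\<lambda>t. f t - g t)" "bounded_fun b (\<lambda>t. f t * g t)"
    unfolding bounded_fun_def by blast+
qed

lemma bounded_fun_power: "bounded_fun b f \<Longrightarrow> bounded_fun b (\<lambda>t. f t ^ j)"
  by (induction j) (auto intro: bounded_fun_intros)

lemma bounded_fun_monom: "bounded_fun b (\<lambda>t. t ^ j)"
  by (rule bounded_fun_power[OF bounded_fun_intros(2)])

lemma bounded_fun_sum: "finite I \<Longrightarrow> (\<And>i. i \<in> I \<Longrightarrow> bounded_fun b (f i)) \<Longrightarrow> bounded_fun b (\<lambda>t. \<Sum>i\<in>I. f i t)"
  by (induction I rule: finite_induct) (auto intro: bounded_fun_intros)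

lemma bounded_fun_continuous: "continuous_on UNIV f \<Longrightarrow> bounded_fun b f"
proof -
  assume f: "continuous_on UNIV f"
  have "compact (f ` {-b..b})"
    by (intro compact_continuous_image continuous_on_subset[OF f]) auto
  then have "bounded (f ` {-b..b})"
    by (rule compact_imp_bounded)
  then show ?thesis
    using f borel_measurable_continuous_onI[OF f] by (auto simp: bounded_fun_def bounded_iff)
qed

lemma bounded_measure_measurable:
  assumes "bounded_measure b M"
  shows "borel_measurable M = borel_measurable borel"
  using assms by (intro measurable_cong_sets) (simp_all add: bounded_measure_def)

lemma bounded_integrable:
  assumes "bounded_measure b M" "bounded_fun b f"
  shows "integrable M f"
proof -
  interpret finite_measure M using assms by (simp add: bounded_measure_def)
  obtain B where "\<forall>t\<in>{-b..b}. \<bar>f t\<bar> \<le> B"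
    using bounded_fun_bound[OF assms(2)] by blast
  then have B: "\<And>t. t \<in> {-b..b} \<Longrightarrow> \<bar>f t\<bar> \<le> B"
    by blast
  have "AE t in M. t \<in> {-b..b}"
    using assms(1) by (simp add: bounded_measure_def)
  then have "AE t in M. norm (f t) \<le> B"
    by eventually_elim (simp only: B real_norm_def)
  moreover have "f \<in> borel_measurable M"
    using assms(2) by (simp add: bounded_measure_measurable[OF assms(1)] bounded_fun_def)
  ultimately show ?thesis
    by (rule integrable_const_bound)
qed

lemma signed_integral_linear:
  assumes "\<forall>(M, g)\<in>set xs. bounded_measure b M \<and> bounded_fun b g" and "bounded_fun b f" "bounded_fun b h"
  shows "signed_integral xs (\<lambda>t. f t + h t) = signed_integral xs f + signed_integral xs h"
    and "signed_integral xs (\<lambda>t. c * f t) = c * signed_integral xs f"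
proof -
  show "signed_integral xs (\<lambda>t. f t + h t) = signed_integral xs f + signed_integral xs h"
    using assms(1)
  proof (induction xs)
    case (Cons x xs)
    obtain M g where x: "x = (M, g)" by (cases x)
    then have "bounded_measure b M" "bounded_fun b g" using Cons.prems by auto
    then have "(\<integral>t. (f t + h t) * g t \<partial>M) = (\<integral>t. f t * g t \<partial>M) + (\<integral>t. h t * g t \<partial>M)"
      using assms by (simp add: ring_distribs bounded_integrable bounded_fun_intros)
    then show ?case using Cons x by (simp add: signed_integral_def)
  qed (simp add: signed_integral_def)
  show "signed_integral xs (\<lambda>t. c * f t) = c * signed_integral xs f"
    unfolding signed_integral_def
    by (induction xs) (auto simp: mult.assoc distrib_left)
qed

lemma signed_integral_sum:
  assumes "\<forall>(M, g)\<in>set xs. bounded_measure b M \<and> bounded_fun b g" "finite I" "\<And>i. i \<in> I \<Longrightarrow> bounded_fun b (f i)"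
  shows "signed_integral xs (\<lambda>t. \<Sum>i\<in>I. f i t) = (\<Sum>i\<in>I. signed_integral xs (f i))"
  using assms(2,3)
proof (induction I rule: finite_induct)
  case empty
  show ?case by (induction xs) (auto simp: signed_integral_def)
next
  case (insert i I)
  then show ?case
    using signed_integral_linear(1)[OF assms(1), of "f i" "\<lambda>t. \<Sum>i\<in>I. f i t"] bounded_fun_sum[of I b f] by auto
qed

lemma signed_integral_limit:
  assumes xs: "\<forall>(M, g)\<in>set xs. bounded_measure b M \<and> bounded_fun b g"
    and meas: "\<And>n. f n \<in> borel_measurable borel" "f' \<in> borel_measurable borel"
    and bound: "\<And>n t. t \<in> {-b..b} \<Longrightarrow> \<bar>f n t\<bar> \<le> B"
    and lim: "\<And>t. t \<in> {-b..b} \<Longrightarrow> (\<lambda>n. f n t) \<longlonglongrightarrow> f' t"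
  shows "(\<lambda>n. signed_integral xs (f n)) \<longlonglongrightarrow> signed_integral xs f'"
  using xs
proof (induction xs)
  case (Cons x xs)
  obtain M g where x: "x = (M, g)" by (cases x)
  then have M: "bounded_measure b M" and g: "bounded_fun b g" using Cons.prems by auto
  then interpret finite_measure M by (simp add: bounded_measure_def)
  obtain C where "\<forall>t\<in>{-b..b}. \<bar>g t\<bar> \<le> C"
    using bounded_fun_bound[OF g] by blast
  then have C: "\<And>t. t \<in> {-b..b} \<Longrightarrow> \<bar>g t\<bar> \<le> C"
    by blast
  have [measurable]: "g \<in> borel_measurable M" "f' \<in> borel_measurable M" "f n \<in> borel_measurable M" for n
    using g meas by (simp_all add: bounded_measure_measurable[OF M] bounded_fun_def)
  have AE: "AE t in M. t \<in> {-b..b}" using M by (simp add: bounded_measure_def)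
  have "(\<lambda>n. \<integral>t. f n t * g t \<partial>M) \<longlonglongrightarrow> (\<integral>t. f' t * g t \<partial>M)"
  proof (rule integral_dominated_convergence[where w="\<lambda>t. B * C"])
    show "AE t in M. (\<lambda>n. f n t * g t) \<longlonglongrightarrow> f' t * g t"
      using AE by eventually_elim (auto intro!: tendsto_mult lim)
    show "AE t in M. norm (f n t * g t) \<le> B * C" for n
      using AE
    proof eventually_elim
      case (elim t)
      show ?case
        using mult_mono[OF bound[OF elim, of n] C[OF elim]] bound[OF elim, of n] by (simp add: abs_mult)
    qed
  qed auto
  then show ?case using Cons x by (auto simp: signed_integral_def intro: tendsto_add)
qed (simp add: signed_integral_def)

text \<open>A bounded function is the pointwise limit of dominated simple functions.\<close>

lemma signed_integral_determined_by_sets: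
  assumes xs: "\<forall>(M, g)\<in>set xs. bounded_measure b M \<and> bounded_fun b g"
    and zero: "\<And>S. S \<in> sets borel \<Longrightarrow> signed_integral xs (indicator S) = 0"
    and f: "bounded_fun b f"
  shows "signed_integral xs f = 0"
proof -
  obtain F where F: "\<And>i. simple_function borel (F i)" "\<And>t. (\<lambda>i. F i t) \<longlonglongrightarrow> f t"
      "\<And>i t. dist (F i t) 0 \<le> 2 * dist (f t) 0"
    using borel_measurable_implies_sequence_metric[of f borel 0] f by (auto simp: bounded_fun_def)
  obtain B where "\<forall>t\<in>{-b..b}. \<bar>f t\<bar> \<le> B"
    using bounded_fun_bound[OF f] by blast
  then have B: "\<And>t. t \<in> {-b..b} \<Longrightarrow> \<bar>f t\<bar> \<le> B"
    by blast
  have "signed_integral xs (F i) = 0" for i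
  proof -
    have fin: "finite (range (F i))" and meas: "F i -` {y} \<in> sets borel" for y
      using F(1)[of i] simple_functionD(2)[OF F(1), of i "{y}"] by (auto simp: simple_function_def)
    have "F i t = (\<Sum>y\<in>range (F i). y * indicator (F i -` {y}) t)" for t
    proof -
      have "(\<Sum>y\<in>range (F i). y * indicator (F i -` {y}) t) = (\<Sum>y\<in>range (F i). if y = F i t then y else 0)"
        by (intro sum.cong) (auto simp: indicator_def)
      also have "\<dots> = F i t" using fin by (simp add: sum.delta)
      finally show ?thesis by simp
    qed
    then have "F i = (\<lambda>t. \<Sum>y\<in>range (F i). y * indicator (F i -` {y}) t)"
      by (rule ext)
    then have "signed_integral xs (F i) = signed_integral xs (\<lambda>t. \<Sum>y\<in>range (F i). y * indicator (F i -` {y}) t)"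
      by (rule arg_cong)
    also have "\<dots> = (\<Sum>y\<in>range (F i). signed_integral xs (\<lambda>t. y * indicator (F i -` {y}) t))"
      using fin meas by (intro signed_integral_sum[OF xs] bounded_fun_intros(6)[OF bounded_fun_intros(1) bounded_fun_intros(3)]) auto
    also have "\<dots> = 0"
      using signed_integral_linear(2)[OF xs bounded_fun_intros(3) bounded_fun_intros(3)] meas zero by (intro sum.neutral) auto
    finally show ?thesis .
  qed
  moreover have "(\<lambda>i. signed_integral xs (F i)) \<longlonglongrightarrow> signed_integral xs f"
  proof (rule signed_integral_limit[OF xs, where B="2 * B"])
    show "\<bar>F n t\<bar> \<le> 2 * B" if "t \<in> {-b..b}" for n t
      using F(3)[of n t] B[OF that] by simp
  qed (use F f in \<open>auto simp: bounded_fun_def borel_measurable_simple_function\<close>)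
  ultimately show ?thesis
      by (simp add: LIMSEQ_const_iff)
qed

lemma signed_integral_continuous:
  assumes xs: "\<forall>(M, g)\<in>set xs. bounded_measure b M \<and> bounded_fun b g"
    and zero: "\<And>j. signed_integral xs (\<lambda>t. t ^ j) = 0"
    and f: "continuous_on UNIV f"
  shows "signed_integral xs f = 0"
proof -
  have "\<exists>g. real_polynomial_function g \<and> (\<forall>t\<in>{-b..b}. \<bar>f t - g t\<bar> < 1 / real (Suc n))" for n
    using Stone_Weierstrass_real_polynomial_function[of "{-b..b}" f "1 / real (Suc n)"]
      continuous_on_subset[OF f] by (metis compact_Icc of_nat_0_less_iff subset_UNIV zero_less_Suc zero_less_divide_1_iff)
  then obtain p where p: "\<And>n. real_polynomial_function (p n)"
      "\<And>n t. t \<in> {-b..b} \<Longrightarrow> \<bar>f t - p n t\<bar> < 1 / real (Suc n)"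
    by metis
  have "signed_integral xs (p n) = 0" for n
  proof -
    obtain a N where pn: "p n = (\<lambda>t. \<Sum>i\<le>N. a i * t ^ i)"
      using p(1) real_polynomial_function_iff_sum by blast
    have "signed_integral xs (p n) = (\<Sum>i\<le>N. signed_integral xs (\<lambda>t. a i * t ^ i))"
      unfolding pn by (intro signed_integral_sum[OF xs]) (auto intro: bounded_fun_intros bounded_fun_monom)
    also have "\<dots> = 0"
      using signed_integral_linear(2)[OF xs bounded_fun_monom bounded_fun_monom] zero by (intro sum.neutral) auto
    finally show ?thesis .
  qed
  moreover have "(\<lambda>n. signed_integral xs (p n)) \<longlonglongrightarrow> signed_integral xs f"
  proof -
    obtain B where "\<forall>t\<in>{-b..b}. \<bar>f t\<bar> \<le> B"
      using bounded_fun_bound[OF bounded_fun_continuous[OF f]] by blast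
    then have B: "\<And>t. t \<in> {-b..b} \<Longrightarrow> \<bar>f t\<bar> \<le> B"
      by blast
    have inv0: "(\<lambda>n. 1 / real (Suc n)) \<longlonglongrightarrow> 0"
      by (rule LIMSEQ_Suc[OF lim_const_over_n])
    show ?thesis
    proof (rule signed_integral_limit[OF xs, where B="B + 1"])
      show "\<bar>p n t\<bar> \<le> B + 1" if "t \<in> {-b..b}" for n t
      proof -
        have "1 / real (Suc n) \<le> 1" by simp
        then show ?thesis using p(2)[OF that, of n] B[OF that] by linarith
      qed
      show "(\<lambda>n. p n t) \<longlonglongrightarrow> f t" if "t \<in> {-b..b}" for t
      proof -
        have "(\<lambda>n. p n t - f t) \<longlonglongrightarrow> 0"
          using p(2)[OF that] by (intro Lim_null_comparison[OF _ inv0]) (auto simp: abs_minus_commute less_imp_le)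
        then show ?thesis by (simp add: LIM_zero_iff)
      qed
      show "p n \<in> borel_measurable borel" for n
        using p(1)[of n] by (intro borel_measurable_continuous_onI continuous_on_polymonial_function)
          (simp add: real_polynomial_function_eq)
    qed (use f in \<open>auto intro: borel_measurable_continuous_onI\<close>)
  qed
  ultimately show ?thesis
      by (simp add: LIMSEQ_const_iff)
qed

text \<open>The piecewise linear function that is \<open>1\<close> up to \<open>t\<close> and falls to \<open>0\<close> with slope \<open>-n\<close>.\<close>

definition ramp :: "nat \<Rightarrow> real \<Rightarrow> real \<Rightarrow> real" where
  "ramp n t x = max 0 (min 1 (1 - real n * (x - t)))"

lemma ramp_bounds: "0 \<le> ramp n t x" "ramp n t x \<le> 1"
  by (auto simp: ramp_def)

lemma continuous_on_ramp: "continuous_on A (ramp n t)"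
  unfolding ramp_def by (intro continuous_intros)

lemma ramp_tendsto_indicator: "(\<lambda>n. ramp n t x) \<longlonglongrightarrow> indicator {..t} x"
proof (cases "x \<le> t")
  case True
  then have "ramp n t x = 1" for n
    by (auto simp: ramp_def min_def max_def mult_le_0_iff)
  then show ?thesis using True by simp
next
  case False
  obtain N where N: "1 < real N * (x - t)"
    using False ex_less_of_nat_mult[of "x - t" 1] by auto
  have "ramp n t x = 0" if "n \<ge> N" for n
  proof -
    have "real N * (x - t) \<le> real n * (x - t)"
      using that False by (intro mult_right_mono) auto
    then show ?thesis using N by (simp add: ramp_def)
  qed
  then have "(\<lambda>n. ramp n t x) \<longlonglongrightarrow> 0"
    by (intro tendsto_eventually) (auto simp: eventually_sequentially)
  then show ?thesis using False by simp
qed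

text \<open>By Weierstrass approximation the functional vanishes on continuous functions, hence on the half-lines
  \<open>{..t}\<close>, which generate the Borel sets and are closed under intersection.\<close>

theorem signed_integral_determined_by_moments:
  assumes xs: "\<forall>(M, g)\<in>set xs. bounded_measure b M \<and> bounded_fun b g"
    and zero: "\<And>j. signed_integral xs (\<lambda>t. t ^ j) = 0"
    and f: "bounded_fun b f"
  shows "signed_integral xs f = 0"
proof (rule signed_integral_determined_by_sets[OF xs _ f])
  have int: "signed_integral xs (\<lambda>t. 1) = 0"
    using zero[of 0] by simp
  have atMost: "signed_integral xs (indicator {..t}) = 0" for t
  proof -
    have "signed_integral xs (ramp n t) = 0" for n
      by (rule signed_integral_continuous[OF xs zero continuous_on_ramp])
    moreover have "(\<lambda>n. signed_integral xs (ramp n t)) \<longlonglongrightarrow> signed_integral xs (indicator {..t})"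
    proof (rule signed_integral_limit[OF xs, where B=1])
      show "\<bar>ramp n t x\<bar> \<le> 1" for n x
        using ramp_bounds[of n t x] by simp
    qed (auto intro: ramp_tendsto_indicator borel_measurable_continuous_onI continuous_on_ramp)
    ultimately show ?thesis
      by (simp add: LIMSEQ_const_iff)
  qed
  fix S :: "real set" assume "S \<in> sets borel"
  then have S: "S \<in> sigma_sets UNIV (range atMost)"
    by (simp add: borel_eq_atMost)
  have "Int_stable (range (atMost :: real \<Rightarrow> real set))"
    by (auto simp: Int_stable_def)
  moreover have "range (atMost :: real \<Rightarrow> real set) \<subseteq> Pow UNIV"
    by simp
  ultimately show "signed_integral xs (indicator S) = 0"
    using S
  proof (induction rule: sigma_sets_induct_disjoint)
    case (basic A)
    then show ?case using atMost by auto
  next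
    case empty
    show ?case by (induction xs) (auto simp: signed_integral_def)
  next
    case (compl A)
    then have A: "A \<in> sets borel" by (simp add: borel_eq_atMost)
    have "signed_integral xs (\<lambda>t. 1) = signed_integral xs (\<lambda>t. indicator A t + indicator (UNIV - A) t)"
      by (intro arg_cong[where f="signed_integral xs"]) (auto simp: indicator_def)
    also have "\<dots> = signed_integral xs (indicator A) + signed_integral xs (indicator (UNIV - A))"
      using A by (intro signed_integral_linear[OF xs]) (auto intro!: bounded_fun_intros)
    finally show ?case using int compl by simp
  next
    case (union A)
    then have A: "A i \<in> sets borel" for i by (auto simp: borel_eq_atMost)
    have "(\<lambda>n. signed_integral xs (\<lambda>t. \<Sum>i<n. indicator (A i) t)) \<longlonglongrightarrow> signed_integral xs (indicator (\<Union>i. A i))"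
    proof (rule signed_integral_limit[OF xs, where B=1])
      have eq: "(\<Sum>i<n. indicator (A i) t) = (indicator (\<Union>i<n. A i) t :: real)" for n t
        using union by (subst indicator_UN_disjoint) (auto simp: disjoint_family_on_def)
      show "\<bar>\<Sum>i<n. indicator (A i) t\<bar> \<le> (1::real)" for n t
        unfolding eq by (simp add: indicator_def)
      show "(\<lambda>n. \<Sum>i<n. indicator (A i) t) \<longlonglongrightarrow> (indicator (\<Union>i. A i) t :: real)" for t
        unfolding eq by (rule LIMSEQ_indicator_UN)
    qed (use A in auto)
    moreover have "signed_integral xs (\<lambda>t. \<Sum>i<n. indicator (A i) t) = 0" for n
      using A union by (subst signed_integral_sum[OF xs]) (auto intro: bounded_fun_intros)
    ultimately show ?case
      by (simp add: LIMSEQ_const_iff)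
  qed
qed

section \<open>Self-adjoint operators on a real Hilbert space\<close>

text \<open>The representing vector is the minimizer of \<open>v \<bullet> v - 2 \<phi>(v)\<close>.\<close>

theorem riesz_representation:
  fixes \<phi> :: "'a::{real_inner, complete_space} \<Rightarrow> real"
  assumes "bounded_linear \<phi>"
  shows "\<exists>w. \<forall>v. \<phi> v = w \<bullet> v"
proof -
  interpret bounded_linear \<phi> by (rule assms)
  define J where "J v = v \<bullet> v - 2 * \<phi> v" for v
  obtain K where K: "\<And>v. norm (\<phi> v) \<le> norm v * K"
    using bounded by blast
  have below: "- K\<^sup>2 \<le> J v" for v
  proof -
    have "0 \<le> (norm v - K)\<^sup>2" by simp
    then show ?thesis
      using K[of v] by (simp add: J_def power2_diff power2_norm_eq_inner)
  qed
  define d where "d = Inf (range J)"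
  have bdd: "bdd_below (range J)"
    using below by (intro bdd_belowI[of _ "- K\<^sup>2"]) auto
  have d: "d \<le> J v" for v
    unfolding d_def using bdd by (rule cInf_lower[rotated]) simp
  have "\<exists>v. J v < d + 1 / real (Suc n)" for n
  proof -
    have "Inf (range J) < d + 1 / real (Suc n)"
      by (simp add: d_def)
    then show ?thesis
      by (subst (asm) cInf_less_iff) (use bdd in auto)
  qed
  then obtain x where x: "\<And>n. J (x n) < d + 1 / real (Suc n)"
    by metis
  \<comment> \<open>The parallelogram law: the linear part of \<open>J\<close> cancels, so minimizing sequences are Cauchy.\<close>
  have par: "(norm (u - v))\<^sup>2 = 2 * J u + 2 * J v - 4 * J ((1/2) *\<^sub>R (u + v))" for u v
    by (simp add: J_def power2_norm_eq_inner inner_add inner_diff scale add inner_commute field_simps)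
  have "Cauchy x"
  proof (rule metric_CauchyI)
    fix e :: real assume e: "e > 0"
    obtain N where N: "4 / e\<^sup>2 < real N"
      using reals_Archimedean2 by blast
    show "\<exists>M. \<forall>m\<ge>M. \<forall>n\<ge>M. dist (x m) (x n) < e"
    proof (intro exI allI impI)
      fix m n assume mn: "m \<ge> N" "n \<ge> N"
      have inv: "1 / real (Suc k) < e\<^sup>2 / 4" if "k \<ge> N" for k
      proof -
        have "4 / e\<^sup>2 < real (Suc k)"
          using N that by linarith
        then show ?thesis using e by (simp add: field_simps)
      qed
      have "(norm (x m - x n))\<^sup>2 < e\<^sup>2"
        using par[of "x m" "x n"] x[of m] x[of n] d[of "(1/2) *\<^sub>R (x m + x n)"] inv[OF mn(1)] inv[OF mn(2)]
        by linarith
      then show "dist (x m) (x n) < e"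
        using e by (simp add: dist_norm power2_less_imp_less)
    qed
  qed
  then obtain w where w: "x \<longlonglongrightarrow> w"
    using Cauchy_convergent convergent_def by blast
  have "(\<lambda>n. J (x n)) \<longlonglongrightarrow> J w"
    unfolding J_def by (intro tendsto_intros w tendsto)
  moreover have "(\<lambda>n. d + 1 / real (Suc n)) \<longlonglongrightarrow> d + 0"
    by (intro tendsto_add tendsto_const LIMSEQ_Suc[OF lim_const_over_n])
  ultimately have "J w \<le> d + 0"
    by (rule LIMSEQ_le) (use x less_imp_le in blast)
  then have min: "J w \<le> J v" for v
    using d[of v] by simp
  have "\<phi> v = w \<bullet> v" for v
  proof (rule ccontr)
    assume "\<phi> v \<noteq> w \<bullet> v"
    define c where "c = \<phi> v - w \<bullet> v"
    have c: "c \<noteq> 0" using \<open>\<phi> v \<noteq> w \<bullet> v\<close> by (simp add: c_def)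
    then have "v \<noteq> 0" by (auto simp: c_def zero)
    then have v: "v \<bullet> v > 0" by simp
    \<comment> \<open>The minimum of the quadratic polynomial \<open>t \<mapsto> J (w + t v)\<close>.\<close>
    define t where "t = c / (v \<bullet> v)"
    have "J (w + t *\<^sub>R v) = J w - 2 * t * c + t * t * (v \<bullet> v)"
      by (simp add: J_def c_def inner_add scale add inner_commute algebra_simps)
    also have "\<dots> = J w - c * c / (v \<bullet> v)"
      using v by (simp add: t_def field_simps)
    also have "\<dots> < J w"
      using c v by (simp add: power2_eq_square[symmetric])
    finally show False
      using min[of "w + t *\<^sub>R v"] by simp
  qed
  then show ?thesis by blast
qed

lemma eq_by_inner:
  fixes x y :: "'a::real_inner"
  assumes "\<And>v. x \<bullet> v = y \<bullet> v"
  shows "x = y"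
  using assms by (metis inner_diff_left inner_eq_zero_iff right_minus_eq)

definition symmetric_op :: "('a::real_inner \<Rightarrow> 'a) \<Rightarrow> bool" where
  "symmetric_op A \<longleftrightarrow> linear A \<and> (\<forall>u v. A u \<bullet> v = u \<bullet> A v)"

lemma symmetric_opD: "symmetric_op A \<Longrightarrow> A u \<bullet> v = u \<bullet> A v"
  by (simp add: symmetric_op_def)

lemma symmetric_op_linear: "symmetric_op A \<Longrightarrow> linear A"
  by (simp add: symmetric_op_def)

lemma symmetric_op_id: "symmetric_op (\<lambda>u. u)"
  by (simp add: symmetric_op_def linear_id[unfolded id_def])

lemma symmetric_op_diff: "symmetric_op A \<Longrightarrow> symmetric_op B \<Longrightarrow> symmetric_op (\<lambda>u. A u - B u)"
  by (simp add: symmetric_op_def linear_compose_sub inner_diff)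

lemma symmetric_op_add: "symmetric_op A \<Longrightarrow> symmetric_op B \<Longrightarrow> symmetric_op (\<lambda>u. A u + B u)"
  by (simp add: symmetric_op_def linear_compose_add inner_add)

lemma symmetric_op_scale: "symmetric_op A \<Longrightarrow> symmetric_op (\<lambda>u. c *\<^sub>R A u)"
  by (simp add: symmetric_op_def linear_compose_scale_right)

lemma symmetric_op_conjugate: "symmetric_op A \<Longrightarrow> symmetric_op B \<Longrightarrow> symmetric_op (\<lambda>u. A (B (A u)))"
  unfolding symmetric_op_def by (auto intro: linear_compose[unfolded o_def])

lemma linear_funpow: "linear A \<Longrightarrow> linear (A ^^ n)" for A :: "'a::real_vector \<Rightarrow> 'a"
  by (induction n) (auto intro: linear_compose simp: linear_id)

lemma symmetric_op_funpow: "symmetric_op A \<Longrightarrow> symmetric_op (A ^^ n)"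
proof (induction n)
  case (Suc n)
  then have "(A ^^ Suc n) u \<bullet> v = u \<bullet> (A ^^ Suc n) v" for u v
    by (simp add: symmetric_op_def funpow_swap1)
  then show ?case
    using linear_funpow[OF symmetric_op_linear[OF Suc.prems], of "Suc n"] unfolding symmetric_op_def by blast
qed (simp add: symmetric_op_id id_def)

lemma funpow_commute_apply: "(\<And>u. B (A u) = A (B u)) \<Longrightarrow> B ((A ^^ n) u) = (A ^^ n) (B u)"
  by (induction n) auto

definition between_0_1 :: "('a::real_inner \<Rightarrow> 'a) \<Rightarrow> bool" where
  "between_0_1 T \<longleftrightarrow> symmetric_op T \<and> (\<forall>u. 0 \<le> T u \<bullet> u \<and> T u \<bullet> u \<le> u \<bullet> u)"

lemma between_0_1_complement: "between_0_1 T \<Longrightarrow> between_0_1 (\<lambda>u. u - T u)"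
  by (simp add: between_0_1_def symmetric_op_diff symmetric_op_id inner_diff)

text \<open>Pairs of equal factors can be moved to the other side of the inner product, so only exponents up to \<open>1\<close>
  matter.  For \<open>T (1 - T)\<close> one inserts \<open>1 = T + (1 - T)\<close>, which gives the sum of
  \<open>T (1 - T) T\<close> and \<open>(1 - T) T (1 - T)\<close>.\<close>

lemma bernstein_positive:
  assumes "between_0_1 T"
  defines "R \<equiv> \<lambda>u. u - T u"
  shows "0 \<le> (T ^^ a) ((R ^^ b) u) \<bullet> u"
proof (induction "a + b" arbitrary: a b u rule: less_induct)
  case less
  have symT: "symmetric_op T" and symR: "symmetric_op R"
    using assms between_0_1_complement[OF assms(1)] by (auto simp: between_0_1_def)
  interpret T: linear T using symT by (rule symmetric_op_linear)
  have TR: "T (R v) = R (T v)" for v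
    by (simp add: R_def T.diff)
  have R_pow: "(R ^^ n) (T v) = T ((R ^^ n) v)" for n v
    by (rule funpow_commute_apply[symmetric]) (rule TR)
  have pos: "0 \<le> T v \<bullet> v" "0 \<le> R v \<bullet> v" for v
    using assms(1) between_0_1_complement[OF assms(1)] by (auto simp: between_0_1_def R_def)
  consider a' where "a = Suc (Suc a')" | b' where "b = Suc (Suc b')" | "a \<le> 1" "b \<le> 1"
    by (metis One_nat_def Suc_le_mono le0 not0_implies_Suc)
  then show ?case
  proof cases
    case 1
    have "(T ^^ a) ((R ^^ b) u) \<bullet> u = T ((T ^^ a') (T ((R ^^ b) u))) \<bullet> u"
      using 1 by (simp add: funpow_swap1)
    also have "\<dots> = (T ^^ a') ((R ^^ b) (T u)) \<bullet> T u"
      by (simp add: symmetric_opD[OF symT] R_pow)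
    finally show ?thesis using less[of a' b "T u"] 1 by simp
  next
    case 2
    have R_T: "R ((T ^^ a) v) = (T ^^ a) (R v)" for v
      by (rule funpow_commute_apply) (simp add: TR)
    have "(T ^^ a) ((R ^^ b) u) \<bullet> u = (T ^^ a) (R ((R ^^ b') (R u))) \<bullet> u"
      using 2 by (simp add: funpow_swap1)
    also have "\<dots> = (T ^^ a) ((R ^^ b') (R u)) \<bullet> R u"
      by (simp add: R_T[symmetric] symmetric_opD[OF symR])
    finally show ?thesis using less[of a b' "R u"] 2 by simp
  next
    case 3
    have "0 \<le> T (R u) \<bullet> u"
    proof -
      have "T (R u) \<bullet> u = T (R (T u)) \<bullet> u + T (R (R u)) \<bullet> u"
      proof -
        have "u = T u + R u" by (simp add: R_def)
        then have "T (R u) = T (R (T u + R u))" by simp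
        also have "\<dots> = T (R (T u)) + T (R (R u))"
          by (simp add: R_def T.diff T.add algebra_simps)
        finally show ?thesis by (simp add: inner_add)
      qed
      also have "T (R (T u)) \<bullet> u = R (T u) \<bullet> T u" by (rule symmetric_opD[OF symT])
      also have "T (R (R u)) \<bullet> u = T (R u) \<bullet> R u"
        by (simp add: TR symmetric_opD[OF symR])
      finally show ?thesis using pos by (metis add_nonneg_nonneg)
    qed
    moreover have "a = 0 \<or> a = 1" "b = 0 \<or> b = 1" using 3 by auto
    ultimately show ?thesis using pos by auto
  qed
qed

lemma bernstein_pascal:
  assumes "linear T"
  defines "R \<equiv> \<lambda>u. u - T u"
  shows "(T ^^ a) ((R ^^ b) u) = (T ^^ Suc a) ((R ^^ b) u) + (T ^^ a) ((R ^^ Suc b) u)"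
proof -
  interpret T: linear "T ^^ a" by (rule linear_funpow[OF assms(1)])
  show ?thesis
    by (simp add: R_def T.diff funpow_swap1)
qed

text \<open>The spectral measure of \<open>A\<close> at \<open>u\<close> is characterized by its moments, which does not presuppose a
  functional calculus.\<close>

definition is_spectral_measure :: "('a::real_inner \<Rightarrow> 'a) \<Rightarrow> real \<Rightarrow> 'a \<Rightarrow> real measure \<Rightarrow> bool" where
  "is_spectral_measure A b u M \<longleftrightarrow> bounded_measure b M \<and> (\<forall>j. (\<integral>t. t ^ j \<partial>M) = (A ^^ j) u \<bullet> u)"

text \<open>The operator \<open>T = (A + b) / 2b\<close> lies between \<open>0\<close> and \<open>1\<close>, so the numbers \<open>\<langle>T\<^sup>a (1 - T)\<^sup>c u, u\<rangle>\<close> are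
  nonnegative and Hausdorff's theorem applies to them.  The affine map \<open>s \<mapsto> 2 b s - b\<close> carries the
  resulting measure from \<open>[0, 1]\<close> to \<open>[-b, b]\<close>.\<close>

lemma spectral_measure_exists:
  assumes sym: "symmetric_op A" and b: "b > 0" and bound: "\<And>u. \<bar>A u \<bullet> u\<bar> \<le> b * (u \<bullet> u)"
  shows "\<exists>M. is_spectral_measure A b u M"
proof -
  define T where "T v = (1 / (2 * b)) *\<^sub>R (A v + b *\<^sub>R v)" for v
  define R where "R = (\<lambda>v. v - T v)"
  have "symmetric_op T"
    unfolding T_def using sym by (intro symmetric_op_scale symmetric_op_add symmetric_op_id)
  moreover have "0 \<le> T v \<bullet> v" "T v \<bullet> v \<le> v \<bullet> v" for v
    using bound[of v] b by (auto simp: T_def inner_add abs_le_iff field_simps)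
  ultimately have T: "between_0_1 T"
    by (simp add: between_0_1_def)
  interpret T: linear T using T by (simp add: between_0_1_def symmetric_op_def)
  interpret A: linear A using sym by (rule symmetric_op_linear)
  obtain M where M: "finite_measure M" "sets M = sets borel" "AE s in M. s \<in> {0..1}"
    and mom: "\<And>j. (\<integral>s. s ^ j \<partial>M) = (T ^^ j) ((R ^^ 0) u) \<bullet> u"
  proof -
    have "\<exists>M. finite_measure M \<and> sets M = sets borel \<and> (AE s in M. s \<in> {0..1::real}) \<and>
        (\<forall>j. (\<integral>s. s ^ j \<partial>M) = (T ^^ j) ((R ^^ 0) u) \<bullet> u)"
    proof (rule hausdorff_moment_problem)
      show "0 \<le> (T ^^ a) ((R ^^ c) u) \<bullet> u" for a c
        unfolding R_def by (rule bernstein_positive[OF T])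
      show "(T ^^ a) ((R ^^ c) u) \<bullet> u = (T ^^ Suc a) ((R ^^ c) u) \<bullet> u + (T ^^ a) ((R ^^ Suc c) u) \<bullet> u" for a c
        using bernstein_pascal[OF T.linear_axioms, of a c u] unfolding R_def by (metis inner_add_left)
    qed
    then show ?thesis using that by blast
  qed
  define N where "N = distr M borel (\<lambda>s. 2 * b * s - b)"
  have meas: "borel_measurable M = borel_measurable borel"
    using M(2) by (rule measurable_cong_sets) simp
  have meas_aff: "(\<lambda>s. 2 * b * s - b) \<in> borel_measurable M"
    unfolding meas by measurable
  have int_M: "integrable M f" if f: "continuous_on UNIV f" for f :: "real \<Rightarrow> real"
  proof -
    have "AE t in M. t \<in> {-1..1}"
      using M(3) by eventually_elim auto
    then have "bounded_measure 1 M"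
      using M by (simp add: bounded_measure_def)
    then show ?thesis
      using bounded_fun_continuous[OF f] by (rule bounded_integrable)
  qed
  \<comment> \<open>The extra power of \<open>s\<close> absorbs the factor \<open>T\<close> that \<open>A = 2 b T - b\<close> contributes in each step.\<close>
  have "(\<integral>s. (2 * b * s - b) ^ j * s ^ i \<partial>M) = (A ^^ j) ((T ^^ i) u) \<bullet> u" for i j
  proof (induction j arbitrary: i)
    case 0
    then show ?case using mom[of i] by simp
  next
    case (Suc j)
    interpret Aj: linear "A ^^ j" by (rule linear_funpow[OF A.linear_axioms])
    have "(\<integral>s. (2 * b * s - b) ^ Suc j * s ^ i \<partial>M)
        = (\<integral>s. 2 * b * ((2 * b * s - b) ^ j * s ^ Suc i) - b * ((2 * b * s - b) ^ j * s ^ i) \<partial>M)"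
      by (intro Bochner_Integration.integral_cong) (auto simp: algebra_simps)
    also have "\<dots> = 2 * b * ((A ^^ j) ((T ^^ Suc i) u) \<bullet> u) - b * ((A ^^ j) ((T ^^ i) u) \<bullet> u)"
      unfolding Suc[symmetric] by (subst Bochner_Integration.integral_diff) (auto intro!: int_M continuous_intros)
    also have "\<dots> = (A ^^ j) ((2 * b) *\<^sub>R T ((T ^^ i) u) - b *\<^sub>R (T ^^ i) u) \<bullet> u"
      by (simp add: Aj.diff Aj.scale inner_diff)
    also have "(2 * b) *\<^sub>R T ((T ^^ i) u) - b *\<^sub>R (T ^^ i) u = A ((T ^^ i) u)"
      using b by (simp add: T_def scaleR_right_distrib)
    finally show ?case by (simp add: funpow_swap1)
  qed
  from this[of _ 0] have "(\<integral>t. t ^ j \<partial>N) = (A ^^ j) u \<bullet> u" for j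
    unfolding N_def by (subst integral_distr[OF meas_aff]) auto
  moreover have "finite_measure N"
    unfolding N_def using M(1) meas_aff by (rule finite_measure.finite_measure_distr)
  moreover have "sets N = sets borel"
    by (simp add: N_def)
  moreover have "AE t in N. t \<in> {-b..b}"
  proof -
    have "AE s in M. 2 * b * s - b \<in> {-b..b}"
      using M(3) by eventually_elim (use b in \<open>auto simp: mult_le_cancel_left1\<close>)
    then show ?thesis
      unfolding N_def by (subst AE_distr_iff[OF meas_aff]) auto
  qed
  ultimately have "is_spectral_measure A b u N"
    by (simp add: is_spectral_measure_def bounded_measure_def)
  then show ?thesis by blast
qed

lemma spectral_measure_unique:
  assumes "is_spectral_measure A b u M" "is_spectral_measure A b u N" "bounded_fun b f"
  shows "(\<integral>t. f t \<partial>M) = (\<integral>t. f t \<partial>N)"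
proof -
  have "signed_integral [(M, \<lambda>t. 1), (N, \<lambda>t. -1)] f = 0"
    by (rule signed_integral_determined_by_moments[OF _ _ assms(3)])
       (use assms in \<open>auto simp: is_spectral_measure_def bounded_fun_intros signed_integral_def\<close>)
  then show ?thesis by (simp add: signed_integral_def)
qed

lemma is_spectral_measure_mono:
  assumes "is_spectral_measure A b u M" "b \<le> c"
  shows "is_spectral_measure A c u M"
proof -
  have "AE t in M. t \<in> {-b..b}"
    using assms(1) by (simp add: is_spectral_measure_def bounded_measure_def)
  then have "AE t in M. t \<in> {-c..c}"
    by eventually_elim (use assms(2) in auto)
  then show ?thesis
    using assms(1) by (simp add: is_spectral_measure_def bounded_measure_def)
qed

section \<open>Projections onto kernels\<close>

text \<open>For \<open>N\<close> between \<open>0\<close> and \<open>1\<close> this is the orthogonal projection onto the kernel of \<open>N\<close>.  Being a limit of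
  polynomials in \<open>N\<close>, it inherits whatever commutes with \<open>N\<close>, and its trace is a limit of traces of
  polynomials.\<close>

definition kernel_projection :: "('a::real_inner \<Rightarrow> 'a) \<Rightarrow> 'a \<Rightarrow> 'a" where
  "kernel_projection N u = lim (\<lambda>n. ((\<lambda>v. v - N v) ^^ n) u)"

text \<open>With \<open>R = 1 - N\<close>, the sequence \<open>a\<^sub>n = \<langle>R\<^sup>n u, u\<rangle>\<close> is nonnegative and decreasing, and the squared distance
  of \<open>R\<^sup>m u\<close> and \<open>R\<^sup>n u\<close> is \<open>a\<^sub>2\<^sub>m - 2 a\<^sub>m\<^sub>+\<^sub>n + a\<^sub>2\<^sub>n\<close>.\<close>

lemma kernel_projection_limit:
  fixes N :: "'a::{real_inner, complete_space} \<Rightarrow> 'a"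
  assumes "between_0_1 N"
  shows "(\<lambda>n. ((\<lambda>v. v - N v) ^^ n) u) \<longlonglongrightarrow> kernel_projection N u"
proof -
  define R where "R = (\<lambda>v. v - N v)"
  have symR: "symmetric_op R"
    using between_0_1_complement[OF assms] by (simp add: between_0_1_def R_def)
  define a where "a n = (R ^^ n) u \<bullet> u" for n
  have inner_R: "(R ^^ m) u \<bullet> (R ^^ n) u = a (m + n)" for m n
    using symmetric_opD[OF symmetric_op_funpow[OF symR], of n "(R ^^ m) u" u]
    by (simp add: a_def funpow_add add.commute[of m n])
  have "a (Suc n) \<le> a n" for n
    using bernstein_positive[OF assms, of 1 n u] by (simp add: a_def R_def inner_diff)
  then have "decseq a"
    by (rule decseq_SucI)
  moreover have "0 \<le> a n" for n
    using bernstein_positive[OF assms, of 0 n u] by (simp add: a_def R_def)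
  ultimately obtain L where L: "a \<longlonglongrightarrow> L"
    using decseq_convergent[of a 0] by blast
  have "Cauchy (\<lambda>n. (R ^^ n) u)"
  proof (rule metric_CauchyI)
    fix e :: real assume e: "e > 0"
    obtain K where K: "\<And>n. n \<ge> K \<Longrightarrow> \<bar>a n - L\<bar> < e\<^sup>2 / 4"
      using LIMSEQ_D[OF L, of "e\<^sup>2 / 4"] e by auto
    show "\<exists>M. \<forall>m\<ge>M. \<forall>n\<ge>M. dist ((R ^^ m) u) ((R ^^ n) u) < e"
    proof (intro exI allI impI)
      fix m n assume mn: "m \<ge> K" "n \<ge> K"
      have "(norm ((R ^^ m) u - (R ^^ n) u))\<^sup>2 = a (m + m) - 2 * a (m + n) + a (n + n)"
        by (simp add: power2_norm_eq_inner inner_diff inner_R add.commute)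
      also have "\<dots> < e\<^sup>2"
      proof -
        have "\<bar>a (m + m) - L\<bar> < e\<^sup>2 / 4" "\<bar>a (m + n) - L\<bar> < e\<^sup>2 / 4" "\<bar>a (n + n) - L\<bar> < e\<^sup>2 / 4"
          using mn by (intro K, simp)+
        then show ?thesis by linarith
      qed
      finally show "dist ((R ^^ m) u) ((R ^^ n) u) < e"
        using e by (simp add: dist_norm power2_less_imp_less)
    qed
  qed
  then have "convergent (\<lambda>n. (R ^^ n) u)"
    by (rule Cauchy_convergent)
  then show ?thesis
    by (simp add: kernel_projection_def R_def convergent_LIMSEQ_iff)
qed

lemma kernel_projection_of_kernel:
  assumes "N u = 0"
  shows "kernel_projection N u = u"
proof -
  have "((\<lambda>v. v - N v) ^^ n) u = u" for n
    using assms by (induction n) auto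
  then show ?thesis by (simp add: kernel_projection_def)
qed

lemma kernel_projection_symmetric:
  fixes N :: "'a::{real_inner, complete_space} \<Rightarrow> 'a"
  assumes "between_0_1 N"
  shows "symmetric_op (kernel_projection N)"
proof -
  define R where "R = (\<lambda>v. v - N v)"
  have symR: "symmetric_op (R ^^ n)" for n
    using between_0_1_complement[OF assms] by (intro symmetric_op_funpow) (simp add: between_0_1_def R_def)
  note lim = kernel_projection_limit[OF assms, folded R_def]
  show ?thesis
    unfolding symmetric_op_def
  proof (intro conjI allI linearI)
    show "kernel_projection N (u + v) = kernel_projection N u + kernel_projection N v" for u v
      using LIMSEQ_unique[OF lim[of "u + v"]] tendsto_add[OF lim[of u] lim[of v]]
      by (simp add: linear_add[OF symmetric_op_linear[OF symR]])
    show "kernel_projection N (c *\<^sub>R u) = c *\<^sub>R kernel_projection N u" for c u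
      using LIMSEQ_unique[OF lim[of "c *\<^sub>R u"]] tendsto_scaleR[OF tendsto_const lim[of u], of c]
      by (simp add: linear_scale[OF symmetric_op_linear[OF symR]])
    show "kernel_projection N u \<bullet> v = u \<bullet> kernel_projection N v" for u v
      using LIMSEQ_unique[OF tendsto_inner[OF lim[of u] tendsto_const[of v]]]
        tendsto_inner[OF tendsto_const[of u] lim[of v]]
      by (simp add: symmetric_opD[OF symR])
  qed
qed

lemma kernel_projection_commute:
  fixes N :: "'a::{real_inner, complete_space} \<Rightarrow> 'a"
  assumes "between_0_1 N" "bounded_linear U" "\<And>u. U (N u) = N (U u)"
  shows "U (kernel_projection N u) = kernel_projection N (U u)"
proof -
  interpret U: bounded_linear U by (rule assms(2))
  have "U (((\<lambda>v. v - N v) ^^ n) u) = ((\<lambda>v. v - N v) ^^ n) (U u)" for n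
    by (rule funpow_commute_apply) (simp add: U.diff assms(3))
  then show ?thesis
    using LIMSEQ_unique[OF U.tendsto[OF kernel_projection_limit[OF assms(1), of u]]]
      kernel_projection_limit[OF assms(1), of "U u"] by simp
qed

lemma kernel_projection_in_kernel:
  fixes N :: "'a::{real_inner, complete_space} \<Rightarrow> 'a"
  assumes "between_0_1 N"
  shows "N (kernel_projection N u) = 0"
proof -
  define R where "R = (\<lambda>v. v - N v)"
  note lim = kernel_projection_limit[OF assms, folded R_def, of u]
  have symN: "symmetric_op N" using assms by (simp add: between_0_1_def)
  have "N (kernel_projection N u) \<bullet> v = 0" for v
  proof -
    have "(\<lambda>n. N ((R ^^ n) u) \<bullet> v) \<longlonglongrightarrow> kernel_projection N u \<bullet> N v"
      using tendsto_inner[OF lim tendsto_const] by (simp add: symmetric_opD[OF symN])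
    moreover have "(\<lambda>n. N ((R ^^ n) u) \<bullet> v) \<longlonglongrightarrow> 0"
      using tendsto_inner[OF tendsto_diff[OF lim LIMSEQ_Suc[OF lim]] tendsto_const[of v]] by (simp add: R_def)
    ultimately have "kernel_projection N u \<bullet> N v = 0"
      by (rule LIMSEQ_unique)
    then show ?thesis by (simp add: symmetric_opD[OF symN])
  qed
  then show ?thesis by (metis inner_eq_zero_iff)
qed

lemma kernel_projection_norm:
  fixes N :: "'a::{real_inner, complete_space} \<Rightarrow> 'a"
  assumes "between_0_1 N"
  shows "kernel_projection N u \<bullet> u = (norm (kernel_projection N u))\<^sup>2"
  using symmetric_opD[OF kernel_projection_symmetric[OF assms], of "kernel_projection N u" u]
    kernel_projection_of_kernel[of N, OF kernel_projection_in_kernel[OF assms], of u]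
  by (simp add: power2_norm_eq_inner)

lemma kernel_projection_le:
  fixes N :: "'a::{real_inner, complete_space} \<Rightarrow> 'a"
  assumes "between_0_1 N"
  shows "norm (kernel_projection N u) \<le> norm u"
proof -
  have "(norm (kernel_projection N u))\<^sup>2 \<le> norm (kernel_projection N u) * norm u"
    using kernel_projection_norm[OF assms, of u] norm_cauchy_schwarz[of "kernel_projection N u" u] by simp
  then show ?thesis
    by (cases "kernel_projection N u = 0") (auto simp: power2_eq_square)
qed

section \<open>The spectral theorem\<close>

text \<open>The value of \<open>\<langle>f(A) u, v\<rangle>\<close> by polarization, where \<open>\<mu> w\<close> is the spectral measure at \<open>w\<close>.\<close>

definition polar_integral :: "('a::real_vector \<Rightarrow> real measure) \<Rightarrow> 'a \<Rightarrow> 'a \<Rightarrow> (real \<Rightarrow> real) \<Rightarrow> real" where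
  "polar_integral \<mu> u v f = ((\<integral>t. f t \<partial>\<mu> (u + v)) - (\<integral>t. f t \<partial>\<mu> (u - v))) / 4"

lemma symmetric_op_polarize:
  assumes "symmetric_op B"
  shows "B (u + v) \<bullet> (u + v) - B (u - v) \<bullet> (u - v) = 4 * (B u \<bullet> v)"
proof -
  have "B v \<bullet> u = B u \<bullet> v"
    using symmetric_opD[OF assms, of v u] by (simp add: inner_commute)
  then show ?thesis
    using symmetric_op_linear[OF assms] by (simp add: linear_add linear_diff inner_add inner_diff)
qed

locale spectral_measures =
  fixes A :: "'a::{real_inner, complete_space} \<Rightarrow> 'a" and b :: real and \<mu> :: "'a \<Rightarrow> real measure"
  assumes symmetric_A: "symmetric_op A"
    and spectral: "\<And>u. is_spectral_measure A b u (\<mu> u)"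
begin

abbreviation "pol \<equiv> polar_integral \<mu>"

lemma bounded_\<mu>: "bounded_measure b (\<mu> u)"
  using spectral by (simp add: is_spectral_measure_def)

lemma finite_\<mu>: "finite_measure (\<mu> u)" and sets_\<mu>: "sets (\<mu> u) = sets borel" and space_\<mu>: "space (\<mu> u) = UNIV"
  using bounded_\<mu>[of u] sets_eq_imp_space_eq[of "\<mu> u" borel] by (auto simp: bounded_measure_def)

lemma moment: "(\<integral>t. t ^ j \<partial>\<mu> u) = (A ^^ j) u \<bullet> u"
  using spectral by (simp add: is_spectral_measure_def)

lemma sym_pow: "symmetric_op (A ^^ j)"
  using symmetric_A by (rule symmetric_op_funpow)

lemma pol_moment: "pol u v (\<lambda>t. t ^ j) = (A ^^ j) u \<bullet> v"
  using symmetric_op_polarize[OF sym_pow, of j u v] by (simp add: polar_integral_def moment)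

text \<open>Bilinearity holds for the moments, hence for all bounded functions.\<close>

lemma pol_add_left:
  assumes "bounded_fun b f"
  shows "pol (u + w) v f = pol u v f + pol w v f"
proof -
  have "signed_integral [(\<mu> (u + w + v), \<lambda>t. 1), (\<mu> (u + w - v), \<lambda>t. -1), (\<mu> (u + v), \<lambda>t. -1),
      (\<mu> (u - v), \<lambda>t. 1), (\<mu> (w + v), \<lambda>t. -1), (\<mu> (w - v), \<lambda>t. 1)] f = 0" (is "signed_integral ?xs _ = 0")
  proof (rule signed_integral_determined_by_moments[OF _ _ assms])
    fix j
    show "signed_integral ?xs (\<lambda>t. t ^ j) = 0"
      using symmetric_op_polarize[OF sym_pow, of j u v] symmetric_op_polarize[OF sym_pow, of j w v]
        symmetric_op_polarize[OF sym_pow, of j "u + w" v] linear_add[OF symmetric_op_linear[OF sym_pow], of j u w]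
      by (simp add: signed_integral_def moment inner_add_left)
  qed (auto simp: bounded_\<mu> bounded_fun_intros)
  then show ?thesis
    by (simp add: signed_integral_def polar_integral_def field_simps)
qed

lemma pol_scale_left:
  assumes "bounded_fun b f"
  shows "pol (c *\<^sub>R u) v f = c * pol u v f"
proof -
  have "signed_integral [(\<mu> (c *\<^sub>R u + v), \<lambda>t. 1), (\<mu> (c *\<^sub>R u - v), \<lambda>t. -1),
      (\<mu> (u + v), \<lambda>t. -c), (\<mu> (u - v), \<lambda>t. c)] f = 0" (is "signed_integral ?xs _ = 0")
  proof (rule signed_integral_determined_by_moments[OF _ _ assms])
    fix j
    have "(A ^^ j) (c *\<^sub>R u) \<bullet> v = c * ((A ^^ j) u \<bullet> v)"
      by (simp add: linear_scale[OF symmetric_op_linear[OF sym_pow]])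
    then show "signed_integral ?xs (\<lambda>t. t ^ j) = 0"
      using arg_cong[OF symmetric_op_polarize[OF sym_pow, of j u v], of "(*) c"]
        symmetric_op_polarize[OF sym_pow, of j "c *\<^sub>R u" v]
      by (simp add: signed_integral_def moment right_diff_distrib mult.commute mult.left_commute)
  qed (auto simp: bounded_\<mu> bounded_fun_intros)
  then have "(\<integral>t. f t \<partial>\<mu> (c *\<^sub>R u + v)) - (\<integral>t. f t \<partial>\<mu> (c *\<^sub>R u - v))
      = c * ((\<integral>t. f t \<partial>\<mu> (u + v)) - (\<integral>t. f t \<partial>\<mu> (u - v)))"
    by (simp add: signed_integral_def algebra_simps)
  then show ?thesis
    by (simp add: polar_integral_def)
qed

lemma pol_commute:
  assumes "bounded_fun b f"
  shows "pol u v f = pol v u f"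
proof -
  have "signed_integral [(\<mu> (u - v), \<lambda>t. 1), (\<mu> (v - u), \<lambda>t. -1)] f = 0" (is "signed_integral ?xs _ = 0")
  proof (rule signed_integral_determined_by_moments[OF _ _ assms])
    fix j
    have "(A ^^ j) (v - u) = - (A ^^ j) (u - v)"
      using linear_neg[OF symmetric_op_linear[OF sym_pow], of j "u - v"] by simp
    then show "signed_integral ?xs (\<lambda>t. t ^ j) = 0"
      by (simp add: signed_integral_def moment inner_diff)
  qed (auto simp: bounded_\<mu> bounded_fun_intros)
  then show ?thesis
    by (simp add: signed_integral_def polar_integral_def add.commute)
qed

lemma pol_self:
  assumes "bounded_fun b f"
  shows "pol u u f = (\<integral>t. f t \<partial>\<mu> u)"
proof -
  have "signed_integral [(\<mu> (u + u), \<lambda>t. 1), (\<mu> (u - u), \<lambda>t. -1), (\<mu> u, \<lambda>t. -4)] f = 0" (is "signed_integral ?xs _ = 0")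
  proof (rule signed_integral_determined_by_moments[OF _ _ assms])
    fix j
    show "signed_integral ?xs (\<lambda>t. t ^ j) = 0"
      using symmetric_op_polarize[OF sym_pow, of j u u]
      by (simp add: signed_integral_def moment del: diff_self)
  qed (auto simp: bounded_\<mu> bounded_fun_intros)
  then show ?thesis
    by (simp add: signed_integral_def polar_integral_def del: diff_self)
qed

lemma pol_bounded_linear:
  assumes S: "S \<in> sets borel"
  shows "bounded_linear (\<lambda>v. pol u v (indicator S))"
proof (rule bounded_linear_intro[where K="(norm u ^ 2 + 1) / 2"])
  have f: "bounded_fun b (indicator S)"
    using S by (rule bounded_fun_intros)
  show "pol u (v + w) (indicator S) = pol u v (indicator S) + pol u w (indicator S)" for v w
    unfolding pol_commute[OF f, of u] by (rule pol_add_left[OF f])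
  show scale: "pol u (c *\<^sub>R v) (indicator S) = c *\<^sub>R pol u v (indicator S)" for c v
    unfolding pol_commute[OF f, of u] by (simp add: pol_scale_left[OF f])
  have unit: "\<bar>pol u v (indicator S)\<bar> \<le> (norm u ^ 2 + (norm v)\<^sup>2) / 2" for v
  proof -
    have int: "0 \<le> (\<integral>t. indicat_real S t \<partial>\<mu> w)" "(\<integral>t. indicator S t \<partial>\<mu> w) \<le> (norm w)\<^sup>2" for w
    proof -
      interpret finite_measure "\<mu> w" by (rule finite_\<mu>)
      have "measure (\<mu> w) (space (\<mu> w)) = (norm w)\<^sup>2"
        using moment[of w 0] by (simp add: power2_norm_eq_inner)
      then show "(\<integral>t. indicator S t \<partial>\<mu> w) \<le> (norm w)\<^sup>2"
        using bounded_measure[of S] by (simp add: space_\<mu>)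
      show "0 \<le> (\<integral>t. indicat_real S t \<partial>\<mu> w)"
        by (rule Bochner_Integration.integral_nonneg) simp
    qed
    have "(norm (u + v))\<^sup>2 + (norm (u - v))\<^sup>2 = 2 * (norm u ^ 2 + (norm v)\<^sup>2)"
      by (simp add: power2_norm_eq_inner inner_add inner_diff)
    then show ?thesis
    proof -
      have "\<bar>(x - y) / 4\<bar> \<le> c / 2" if "p + q = 2 * c" "0 \<le> x" "x \<le> p" "0 \<le> y" "y \<le> q" for x y p q c :: real
      proof -
        have "\<bar>x - y\<bar> \<le> 2 * c" using that by linarith
        then show ?thesis by simp
      qed
      from this[OF \<open>_ = 2 * _\<close> int(1)[of "u + v"] int(2)[of "u + v"] int(1)[of "u - v"] int(2)[of "u - v"]]
      show ?thesis unfolding polar_integral_def .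
    qed
  qed
  show "norm (pol u v (indicator S)) \<le> norm v * ((norm u ^ 2 + 1) / 2)" for v
  proof (cases "v = 0")
    case True
    then show ?thesis using scale[of 0 v] by simp
  next
    case False
    define w where "w = (1 / norm v) *\<^sub>R v"
    have w: "v = norm v *\<^sub>R w" "norm w = 1"
      using False by (simp_all add: w_def)
    have "pol u v (indicator S) = norm v * pol u w (indicator S)"
      using scale[of "norm v" w] w(1) by simp
    then show ?thesis
      using mult_left_mono[OF unit[of w], of "norm v"] w(2) by (simp add: abs_mult)
  qed
qed

text \<open>The vector that represents the bounded functional \<open>v \<mapsto> \<langle>1\<^sub>S(A) u, v\<rangle>\<close>.\<close>

definition proj :: "real set \<Rightarrow> 'a \<Rightarrow> 'a" where
  "proj S u = (SOME w. \<forall>v. pol u v (indicator S) = w \<bullet> v)"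

lemma proj_inner:
  assumes "S \<in> sets borel"
  shows "proj S u \<bullet> v = pol u v (indicator S)"
proof -
  have "\<forall>v. pol u v (indicator S) = proj S u \<bullet> v"
    unfolding proj_def by (rule someI_ex[OF riesz_representation[OF pol_bounded_linear[OF assms]]])
  then have "pol u v (indicator S) = proj S u \<bullet> v" by (rule spec)
  then show ?thesis by (rule sym)
qed

lemma proj_symmetric:
  assumes S: "S \<in> sets borel"
  shows "symmetric_op (proj S)"
proof -
  note f = bounded_fun_intros(3)[OF S, of b]
  show ?thesis
    unfolding symmetric_op_def
  proof (intro conjI allI linearI)
    show "proj S (u + v) = proj S u + proj S v" for u v
      by (rule eq_by_inner) (simp add: proj_inner[OF S] pol_add_left[OF f] inner_add_left)
    show "proj S (c *\<^sub>R u) = c *\<^sub>R proj S u" for c u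
      by (rule eq_by_inner) (simp add: proj_inner[OF S] pol_scale_left[OF f])
    show "proj S u \<bullet> v = u \<bullet> proj S v" for u v
      using proj_inner[OF S, of u v] proj_inner[OF S, of v u] pol_commute[OF f, of u v]
      by (simp add: inner_commute)
  qed
qed

lemma proj_inner_self: "S \<in> sets borel \<Longrightarrow> proj S u \<bullet> u = measure (\<mu> u) S"
  by (simp add: proj_inner pol_self bounded_fun_intros space_\<mu>)

text \<open>The signed measure at \<open>(A\<^sup>j u, v)\<close> has density \<open>t\<^sup>j\<close> with respect to that at \<open>(u, v)\<close>: the moments are
  the same.\<close>

lemma pol_mult_power:
  assumes f: "bounded_fun b f"
  shows "pol u v (\<lambda>t. f t * t ^ j) = pol ((A ^^ j) u) v f"
proof -
  let ?w = "(A ^^ j) u"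
  have "signed_integral [(\<mu> (u + v), \<lambda>t. t ^ j), (\<mu> (u - v), \<lambda>t. - (t ^ j)), (\<mu> (?w + v), \<lambda>t. -1), (\<mu> (?w - v), \<lambda>t. 1)] f = 0" (is "signed_integral ?xs _ = 0")
  proof (rule signed_integral_determined_by_moments[OF _ _ f])
    fix k
    have "pol u v (\<lambda>t. t ^ (k + j)) = pol ?w v (\<lambda>t. t ^ k)"
      by (simp only: pol_moment funpow_add o_def)
    then show "signed_integral ?xs (\<lambda>t. t ^ k) = 0"
      by (simp add: signed_integral_def polar_integral_def power_add field_simps)
  next
    have "bounded_fun b (\<lambda>t. - (t ^ j))"
      using bounded_fun_intros(5)[OF bounded_fun_intros(1)[of b 0] bounded_fun_monom[of b j]] by simp
    then show "\<forall>(M, g)\<in>set ?xs.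
        bounded_measure b M \<and> bounded_fun b g"
      by (auto simp: bounded_\<mu> bounded_fun_intros bounded_fun_monom)
  qed
  then show ?thesis
    by (simp add: signed_integral_def polar_integral_def)
qed

text \<open>The signed measure at \<open>(u, proj S v)\<close> is the restriction to \<open>S\<close> of that at \<open>(u, v)\<close>.  The moments agree
  because \<open>proj S\<close> is symmetric and \<open>\<langle>A\<^sup>k u, proj S v\<rangle> = \<langle>proj S (A\<^sup>k u), v\<rangle>\<close>.\<close>

lemma pol_proj:
  assumes S: "S \<in> sets borel" and f: "bounded_fun b f"
  shows "pol u (proj S v) f = pol u v (\<lambda>t. f t * indicator S t)"
proof -
  let ?w = "proj S v"
  have "signed_integral [(\<mu> (u + v), indicator S), (\<mu> (u - v), \<lambda>t. - indicator S t), (\<mu> (u + ?w), \<lambda>t. -1), (\<mu> (u - ?w), \<lambda>t. 1)] f = 0" (is "signed_integral ?xs _ = 0")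
  proof (rule signed_integral_determined_by_moments[OF _ _ f])
    fix k
    have "pol u v (\<lambda>t. t ^ k * indicator S t) = pol ((A ^^ k) u) v (indicator S)"
      using pol_mult_power[OF bounded_fun_intros(3)[OF S], of u v k] by (simp add: mult.commute)
    also have "\<dots> = pol u ?w (\<lambda>t. t ^ k)"
      by (simp add: proj_inner[OF S, symmetric] pol_moment symmetric_opD[OF proj_symmetric[OF S]])
    finally show "signed_integral ?xs (\<lambda>t. t ^ k) = 0"
      by (simp add: signed_integral_def polar_integral_def)
  next
    have "bounded_fun b (\<lambda>t. - indicator S t)"
      using bounded_fun_intros(5)[OF bounded_fun_intros(1)[of b 0] bounded_fun_intros(3)[OF S]] by simp
    then show "\<forall>(M, g)\<in>set ?xs.
        bounded_measure b M \<and> bounded_fun b g"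
      using S by (auto simp: bounded_\<mu> bounded_fun_intros)
  qed
  then show ?thesis
    by (simp add: signed_integral_def polar_integral_def)
qed

lemma proj_Int:
  assumes "S \<in> sets borel" "T \<in> sets borel"
  shows "proj (S \<inter> T) u = proj S (proj T u)"
proof (rule eq_by_inner)
  fix v
  have "proj S (proj T u) \<bullet> v = pol v (proj T u) (indicator S)"
    using assms by (simp add: proj_inner pol_commute[OF bounded_fun_intros(3)])
  also have "\<dots> = pol v u (\<lambda>t. indicator S t * indicator T t)"
    using assms by (simp add: pol_proj bounded_fun_intros)
  also have "(\<lambda>t. indicator S t * indicator T t :: real) = indicator (S \<inter> T)"
    by (auto simp: indicator_def)
  also have "pol v u (indicator (S \<inter> T)) = proj (S \<inter> T) u \<bullet> v"
    using assms by (simp add: proj_inner pol_commute[OF bounded_fun_intros(3), of _ v])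
  finally show "proj (S \<inter> T) u \<bullet> v = proj S (proj T u) \<bullet> v" ..
qed

lemma proj_UNIV: "proj UNIV u = u"
proof (rule eq_by_inner)
  fix v
  have "(indicator UNIV :: real \<Rightarrow> real) = (\<lambda>t. t ^ 0)" by auto
  then show "proj UNIV u \<bullet> v = u \<bullet> v"
    using pol_moment[of u v 0] by (simp add: proj_inner)
qed

lemma proj_support: "proj {-b..b} u = u"
proof (rule eq_by_inner)
  fix v
  have "(\<integral>t. indicator {-b..b} t \<partial>\<mu> w) = (\<integral>t. t ^ 0 \<partial>\<mu> w)" for w
  proof (rule integral_cong_AE)
    have "AE t in \<mu> w. t \<in> {-b..b}"
      using bounded_\<mu>[of w] by (simp add: bounded_measure_def)
    then show "AE t in \<mu> w. indicator {-b..b} t = t ^ 0"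
      by eventually_elim (simp only: indicator_simps power_0)
  qed (simp_all add: bounded_measure_measurable[OF bounded_\<mu>])
  then show "proj {-b..b} u \<bullet> v = u \<bullet> v"
    using pol_moment[of u v 0] by (simp add: proj_inner polar_integral_def)
qed

lemma proj_sums:
  assumes "range S \<subseteq> sets borel" "disjoint_family S"
  shows "(\<lambda>n. proj (S n) u \<bullet> u) sums (proj (\<Union>n. S n) u \<bullet> u)"
proof -
  interpret finite_measure "\<mu> u" by (rule finite_\<mu>)
  have S: "S n \<in> sets borel" for n
    using assms(1) by (rule range_subsetD)
  have "(\<lambda>n. measure (\<mu> u) (S n)) sums measure (\<mu> u) (\<Union>n. S n)"
    by (rule finite_measure_UNION) (simp_all add: sets_\<mu> assms)
  then show ?thesis
    using S by (simp add: proj_inner_self)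
qed

text \<open>An isometry that commutes with \<open>A\<close> does not change the moments, hence not the spectral measures.\<close>

lemma proj_isometry:
  assumes lin: "linear J" and iso: "\<And>u v. J u \<bullet> J v = u \<bullet> v" and comm: "\<And>u. J (A u) = A (J u)"
    and S: "S \<in> sets borel"
  shows "proj S (J u) \<bullet> J v = proj S u \<bullet> v"
proof -
  have "signed_integral [(\<mu> (J w), \<lambda>t. 1), (\<mu> w, \<lambda>t. -1)] (indicator S) = 0" for w
  proof (rule signed_integral_determined_by_moments[where b=b, OF _ _ bounded_fun_intros(3)[OF S]])
    fix j
    show "signed_integral [(\<mu> (J w), \<lambda>t. 1), (\<mu> w, \<lambda>t. -1)] (\<lambda>t. t ^ j) = 0"
    proof -
      have "J ((A ^^ j) w) = (A ^^ j) (J w)"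
        by (rule funpow_commute_apply) (rule comm)
      then have "(A ^^ j) (J w) \<bullet> J w = (A ^^ j) w \<bullet> w"
        by (metis iso)
      then show ?thesis
        by (simp add: signed_integral_def moment)
    qed
  qed (auto simp: bounded_\<mu> bounded_fun_intros)
  then have "(\<integral>t. indicat_real S t \<partial>\<mu> (J w)) = (\<integral>t. indicator S t \<partial>\<mu> w)" for w
    by (simp add: signed_integral_def)
  then show ?thesis
    by (simp add: proj_inner[OF S] polar_integral_def linear_add[OF lin, symmetric] linear_diff[OF lin, symmetric])
qed

end

text \<open>Uniqueness of the resolution of the identity.  Multiplicativity of \<open>E\<close> says that applying \<open>E S\<close> to a
  vector restricts the polarized measures to \<open>S\<close>.  Together with \<open>A = \<integral> t dE(t)\<close> on the diagonal this
  shows that applying \<open>A\<close> multiplies them by \<open>t\<close>, and the moments follow by induction.\<close>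

lemma resolution_is_spectral:
  fixes A :: "'a::{real_inner, complete_space} \<Rightarrow> 'a" and E :: "real set \<Rightarrow> 'a \<Rightarrow> 'a" and \<nu> :: "'a \<Rightarrow> real measure"
  assumes A: "symmetric_op A"
    and E_sym: "\<And>S. S \<in> sets borel \<Longrightarrow> symmetric_op (E S)"
    and E_Int: "\<And>S T u. S \<in> sets borel \<Longrightarrow> T \<in> sets borel \<Longrightarrow> E (S \<inter> T) u = E S (E T u)"
    and \<nu>: "\<And>u. bounded_measure b (\<nu> u)" "\<And>S u. S \<in> sets borel \<Longrightarrow> measure (\<nu> u) S = E S u \<bullet> u"
    and A_int: "\<And>u. A u \<bullet> u = (\<integral>t. t \<partial>\<nu> u)"
    and range: "\<And>u. E UNIV (A u) = A u"
    and u: "E UNIV u = u"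
  shows "is_spectral_measure A b u (\<nu> u)"
proof -
  let ?pol = "polar_integral \<nu>"
  have space: "space (\<nu> w) = UNIV" for w
    using \<nu>(1)[of w] sets_eq_imp_space_eq[of "\<nu> w" borel] by (simp add: bounded_measure_def)
  have pol_ind: "?pol x y (indicator S) = E S x \<bullet> y" if "S \<in> sets borel" for S x y
    using symmetric_op_polarize[OF E_sym[OF that], of x y] that by (simp add: polar_integral_def space \<nu>(2))
  have pol_id: "?pol x y (\<lambda>t. t) = A x \<bullet> y" for x y
    using symmetric_op_polarize[OF A, of x y] by (simp add: polar_integral_def A_int[symmetric])
  have pol_E: "?pol x (E S y) f = ?pol x y (\<lambda>t. f t * indicator S t)"
    if S: "S \<in> sets borel" and f: "bounded_fun b f" for S x y f
  proof -
    let ?w = "E S y"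
    have minus: "bounded_fun b (\<lambda>t. - indicator S t)"
      using bounded_fun_intros(5)[OF bounded_fun_intros(1)[of b 0] bounded_fun_intros(3)[OF S]] by simp
    have "signed_integral [(\<nu> (x + y), indicator S), (\<nu> (x - y), \<lambda>t. - indicator S t), (\<nu> (x + ?w), \<lambda>t. -1), (\<nu> (x - ?w), \<lambda>t. 1)] f = 0" (is "signed_integral ?xs _ = 0")
    proof (rule signed_integral_determined_by_sets[OF _ _ f])
      fix T :: "real set" assume T: "T \<in> sets borel"
      have "?pol x y (indicator (S \<inter> T)) = ?pol x ?w (indicator T)"
        using S T by (simp add: pol_ind E_Int symmetric_opD[OF E_sym[OF S]])
      moreover have "(indicator (S \<inter> T) :: real \<Rightarrow> real) = (\<lambda>t. indicator T t * indicator S t)"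
        by (auto simp: indicator_def)
      ultimately show "signed_integral ?xs (indicator T) = 0"
        by (simp add: signed_integral_def polar_integral_def)
    qed (use S minus in \<open>auto simp: \<nu>(1) bounded_fun_intros\<close>)
    then show ?thesis
      by (simp add: signed_integral_def polar_integral_def)
  qed
  have pol_A: "?pol x y (\<lambda>t. f t * t) = ?pol (A x) y f" if f: "bounded_fun b f" for x y f
  proof -
    let ?w = "A x"
    have minus: "bounded_fun b (\<lambda>t. - t)"
      using bounded_fun_intros(5)[OF bounded_fun_intros(1)[of b 0] bounded_fun_intros(2)] by simp
    have "signed_integral [(\<nu> (x + y), \<lambda>t. t), (\<nu> (x - y), \<lambda>t. - t), (\<nu> (?w + y), \<lambda>t. -1), (\<nu> (?w - y), \<lambda>t. 1)] f = 0" (is "signed_integral ?xs _ = 0")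
    proof (rule signed_integral_determined_by_sets[OF _ _ f])
      fix S :: "real set" assume S: "S \<in> sets borel"
      have "?pol x y (\<lambda>t. t * indicator S t) = A x \<bullet> E S y"
        using pol_E[OF S bounded_fun_intros(2), of x y] by (simp add: pol_id)
      also have "\<dots> = ?pol (A x) y (indicator S)"
        by (simp add: pol_ind[OF S] symmetric_opD[OF E_sym[OF S]])
      finally show "signed_integral ?xs (indicator S) = 0"
        by (simp add: signed_integral_def polar_integral_def mult.commute)
    qed (use minus in \<open>auto simp: \<nu>(1) bounded_fun_intros\<close>)
    then show ?thesis
      by (simp add: signed_integral_def polar_integral_def)
  qed
  have pol_moment: "?pol x y (\<lambda>t. t ^ j) = (A ^^ j) x \<bullet> y" if "E UNIV x = x" for j x y
    using that
  proof (induction j arbitrary: x)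
    case 0
    have "(indicator UNIV :: real \<Rightarrow> real) = (\<lambda>t. t ^ 0)" by auto
    then show ?case using pol_ind[of UNIV x y] 0 by simp
  next
    case (Suc j)
    have "?pol x y (\<lambda>t. t ^ Suc j) = ?pol (A x) y (\<lambda>t. t ^ j)"
      using pol_A[OF bounded_fun_monom, of x y j] by (simp add: mult.commute)
    then show ?case
      using Suc.IH[OF range] by (simp add: funpow_swap1)
  qed
  have "(\<integral>t. t ^ j \<partial>\<nu> u) = (A ^^ j) u \<bullet> u" for j
  proof -
    have "signed_integral [(\<nu> (u + u), \<lambda>t. 1), (\<nu> (u - u), \<lambda>t. -1), (\<nu> u, \<lambda>t. -4)] (\<lambda>t. t ^ j) = 0" (is "signed_integral ?xs _ = 0")
    proof (rule signed_integral_determined_by_sets[where b=b, OF _ _ bounded_fun_monom])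
      fix S :: "real set" assume S: "S \<in> sets borel"
      show "signed_integral ?xs (indicator S) = 0"
        using symmetric_op_polarize[OF E_sym[OF S], of u u] S
        by (simp add: signed_integral_def space \<nu>(2) del: diff_self)
    qed (auto simp: \<nu>(1) bounded_fun_intros)
    then have "?pol u u (\<lambda>t. t ^ j) = (\<integral>t. t ^ j \<partial>\<nu> u)"
      by (simp add: signed_integral_def polar_integral_def del: diff_self)
    then show ?thesis
      using pol_moment[OF u] by simp
  qed
  then show ?thesis
    using \<nu>(1) by (simp add: is_spectral_measure_def)
qed

text \<open>Both sides are limits of the same sequence.  The integrals of \<open>(1 - c\<^sup>2 (s - t)\<^sup>2)\<^sup>n\<close> tend to the mass
  of \<open>{t}\<close> by dominated convergence, and they equal \<open>\<langle>(1 - C\<^sup>2)\<^sup>n u, u\<rangle>\<close>.\<close>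

lemma spectral_measure_atom:
  fixes A :: "'a::{real_inner, complete_space} \<Rightarrow> 'a"
  assumes sym: "symmetric_op A" and spectral: "is_spectral_measure A b u M"
    and c: "c > 0" and small: "\<And>s. s \<in> {-b..b} \<Longrightarrow> (c * (s - t))\<^sup>2 \<le> 1"
  defines "C \<equiv> \<lambda>v. c *\<^sub>R (A v - t *\<^sub>R v)"
  assumes N: "between_0_1 (\<lambda>v. C (C v))"
  shows "measure M {t} = (norm (kernel_projection (\<lambda>v. C (C v)) u))\<^sup>2"
proof -
  interpret A: linear A using sym by (rule symmetric_op_linear)
  have bM: "bounded_measure b M" and mom: "\<And>j. (\<integral>s. s ^ j \<partial>M) = (A ^^ j) u \<bullet> u"
    using spectral by (auto simp: is_spectral_measure_def)
  interpret finite_measure M using bM by (simp add: bounded_measure_def)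
  define R where "R = (\<lambda>v. v - C (C v))"
  \<comment> \<open>The extra power \<open>s ^ j\<close> makes the induction over \<open>n\<close> go through.\<close>
  have "(\<integral>s. (1 - (c * (s - t))\<^sup>2) ^ n * s ^ j \<partial>M) = (R ^^ n) ((A ^^ j) u) \<bullet> u" for n j
  proof (induction n arbitrary: j)
    case 0
    then show ?case using mom by simp
  next
    case (Suc n)
    define F where "F i s = (1 - (c * (s - t))\<^sup>2) ^ n * s ^ i" for i s
    interpret C: linear C
      unfolding C_def by (intro linear_compose_scale_right linear_compose_sub A.linear_axioms linear_scale_self)
    have linR: "linear R"
      unfolding R_def using C.linear_axioms
      by (intro linear_compose_sub linear_id[unfolded id_def] linear_compose[of C C, unfolded o_def])
    interpret Rn: linear "R ^^ n" using linR by (rule linear_funpow)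
    let ?w = "(A ^^ j) u"
    have int: "integrable M (F i)" for i
      unfolding F_def by (rule bounded_integrable[OF bM bounded_fun_continuous]) (intro continuous_intros)
    have "(\<integral>s. (1 - (c * (s - t))\<^sup>2) ^ Suc n * s ^ j \<partial>M)
        = (\<integral>s. (1 - (c * t)\<^sup>2) * F j s + (2 * c\<^sup>2 * t) * F (Suc j) s - c\<^sup>2 * F (Suc (Suc j)) s \<partial>M)"
      by (intro Bochner_Integration.integral_cong) (auto simp: F_def power2_eq_square algebra_simps)
    also have "\<dots> = (1 - (c * t)\<^sup>2) * (\<integral>s. F j s \<partial>M) + (2 * c\<^sup>2 * t) * (\<integral>s. F (Suc j) s \<partial>M) - c\<^sup>2 * (\<integral>s. F (Suc (Suc j)) s \<partial>M)"
      using int by simp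
    also have "\<dots> = (R ^^ n) ((1 - (c * t)\<^sup>2) *\<^sub>R ?w + (2 * c\<^sup>2 * t) *\<^sub>R A ?w - c\<^sup>2 *\<^sub>R A (A ?w)) \<bullet> u"
      unfolding F_def Suc by (simp add: Rn.add Rn.diff Rn.scale inner_add inner_diff)
    also have "(1 - (c * t)\<^sup>2) *\<^sub>R ?w + (2 * c\<^sup>2 * t) *\<^sub>R A ?w - c\<^sup>2 *\<^sub>R A (A ?w) = R ?w"
      by (simp add: R_def C_def A.diff A.scale power2_eq_square algebra_simps) (simp flip: scaleR_left_distrib)
    finally show ?case by (simp add: funpow_swap1)
  qed
  from this[of _ 0] have int: "(\<integral>s. (1 - (c * (s - t))\<^sup>2) ^ n \<partial>M) = (R ^^ n) u \<bullet> u" for n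
    by simp
  have "(\<lambda>n. \<integral>s. (1 - (c * (s - t))\<^sup>2) ^ n \<partial>M) \<longlonglongrightarrow> (\<integral>s. indicator {t} s \<partial>M)"
  proof (rule integral_dominated_convergence[where w="\<lambda>s. 1"])
    have AE: "AE s in M. s \<in> {-b..b}" using bM by (simp add: bounded_measure_def)
    show "AE s in M. (\<lambda>n. (1 - (c * (s - t))\<^sup>2) ^ n) \<longlonglongrightarrow> indicator {t} s"
      using AE
    proof eventually_elim
      case (elim s)
      show ?case
      proof (cases "s = t")
        case False
        then have "norm (1 - (c * (s - t))\<^sup>2) < 1"
          using small[OF elim] c by (simp add: abs_less_iff)
        then have "(\<lambda>n. (1 - (c * (s - t))\<^sup>2) ^ n) \<longlonglongrightarrow> 0"
          by (rule LIMSEQ_power_zero)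
        then show ?thesis using False by simp
      qed simp
    qed
    show "AE s in M. norm ((1 - (c * (s - t))\<^sup>2) ^ n) \<le> 1" for n
      using AE
    proof eventually_elim
      case (elim s)
      show ?case
        using small[OF elim] by (simp add: power_abs power_le_one abs_le_iff)
    qed
  qed (auto simp: bounded_measure_measurable[OF bM])
  moreover have "(\<lambda>n. (R ^^ n) u \<bullet> u) \<longlonglongrightarrow> kernel_projection (\<lambda>v. C (C v)) u \<bullet> u"
    unfolding R_def by (intro tendsto_inner kernel_projection_limit[OF N] tendsto_const)
  ultimately have "(\<integral>s. indicator {t} s \<partial>M) = kernel_projection (\<lambda>v. C (C v)) u \<bullet> u"
    unfolding int by (rule LIMSEQ_unique)
  moreover have "space M = UNIV"
    using bM sets_eq_imp_space_eq[of M borel] by (simp add: bounded_measure_def)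
  ultimately show ?thesis
    by (simp add: kernel_projection_norm[OF N])
qed

section \<open>The Hilbert space of square summable functions\<close>

text \<open>The type carries the real inner product only.  The value space is arbitrary; \<open>complex ^ 'd\<close> is used
  later, regarded as a Euclidean space of real dimension \<open>2 d\<close>.\<close>

typedef (overloaded) ('g, 'e::real_inner) l2 = "{f :: 'g \<Rightarrow> 'e. (\<lambda>x. (norm (f x))\<^sup>2) summable_on UNIV}"
  morphisms coeff l2_of
  by (rule exI[of _ "\<lambda>x. 0"]) simp

lemma coeff_summable: "(\<lambda>x. (norm (coeff f x))\<^sup>2) summable_on A"
  using coeff[of f] by (auto intro: summable_on_subset_banach)

lemma coeff_l2_of: "(\<lambda>x. (norm (f x))\<^sup>2) summable_on UNIV \<Longrightarrow> coeff (l2_of f) = f"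
  by (simp add: l2_of_inverse)

lemma l2_eqI: "(\<And>x. coeff f x = coeff g x) \<Longrightarrow> f = g"
  by (metis coeff_inject ext)

lemma norm_square_add_le: "(norm (a + b))\<^sup>2 \<le> 2 * (norm a)\<^sup>2 + 2 * (norm b)\<^sup>2" for a b :: "'e::real_inner"
proof -
  have "0 \<le> (norm (a - b))\<^sup>2" by simp
  then show ?thesis by (simp add: power2_norm_eq_inner inner_add inner_diff)
qed

lemma square_summable_add:
  fixes f g :: "'g \<Rightarrow> 'e::real_inner"
  assumes "(\<lambda>x. (norm (f x))\<^sup>2) summable_on A" "(\<lambda>x. (norm (g x))\<^sup>2) summable_on A"
  shows "(\<lambda>x. (norm (f x + g x))\<^sup>2) summable_on A"
proof (rule summable_on_comparison_test)
  show "(\<lambda>x. 2 * (norm (f x))\<^sup>2 + 2 * (norm (g x))\<^sup>2) summable_on A"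
    using assms by (intro summable_on_add summable_on_cmult_right)
qed (auto intro: norm_square_add_le)

lemma square_summable_scale:
  fixes f :: "'g \<Rightarrow> 'e::real_inner"
  assumes "(\<lambda>x. (norm (f x))\<^sup>2) summable_on A"
  shows "(\<lambda>x. (norm (c *\<^sub>R f x))\<^sup>2) summable_on A"
  using summable_on_cmult_right[OF assms, of "c\<^sup>2"] by (simp add: power_mult_distrib)

lemma inner_summable: "(\<lambda>x. coeff f x \<bullet> coeff g x) summable_on A"
proof -
  have "(\<lambda>x. norm (coeff f x \<bullet> coeff g x)) summable_on A"
  proof (rule Infinite_Sum.abs_summable_on_comparison_test')
    show "(\<lambda>x. (norm (coeff f x))\<^sup>2 + (norm (coeff g x))\<^sup>2) summable_on A"
      by (intro summable_on_add coeff_summable)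
    show "norm (coeff f x \<bullet> coeff g x) \<le> (norm (coeff f x))\<^sup>2 + (norm (coeff g x))\<^sup>2" for x
    proof -
      have "norm (coeff f x \<bullet> coeff g x) \<le> norm (coeff f x) * norm (coeff g x)"
        by (simp add: Cauchy_Schwarz_ineq2)
      moreover have "2 * (norm (coeff f x) * norm (coeff g x)) \<le> (norm (coeff f x))\<^sup>2 + (norm (coeff g x))\<^sup>2"
        using sum_squares_bound[of "norm (coeff f x)" "norm (coeff g x)"] by simp
      moreover have "0 \<le> norm (coeff f x) * norm (coeff g x)" by simp
      ultimately show ?thesis by linarith
    qed
  qed
  then show ?thesis
    by (rule summable_on_iff_abs_summable_on_real[THEN iffD2])
qed

instantiation l2 :: (type, real_inner) real_vector
begin

definition zero_l2 :: "('a, 'b) l2" where "zero_l2 = l2_of (\<lambda>x. 0)"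
definition plus_l2 :: "('a, 'b) l2 \<Rightarrow> ('a, 'b) l2 \<Rightarrow> ('a, 'b) l2"
  where "plus_l2 f g = l2_of (\<lambda>x. coeff f x + coeff g x)"
definition scaleR_l2 :: "real \<Rightarrow> ('a, 'b) l2 \<Rightarrow> ('a, 'b) l2"
  where "scaleR_l2 c f = l2_of (\<lambda>x. c *\<^sub>R coeff f x)"
definition uminus_l2 :: "('a, 'b) l2 \<Rightarrow> ('a, 'b) l2"
  where "uminus_l2 f = l2_of (\<lambda>x. - coeff f x)"
definition minus_l2 :: "('a, 'b) l2 \<Rightarrow> ('a, 'b) l2 \<Rightarrow> ('a, 'b) l2"
  where "minus_l2 f g = f + - g"

lemma coeff_zero: "coeff 0 x = (0::'b)"
  by (simp add: zero_l2_def coeff_l2_of)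

lemma coeff_add: "coeff (f + g) x = coeff f x + (coeff g x :: 'b)"
  by (simp add: plus_l2_def coeff_l2_of square_summable_add coeff_summable)

lemma coeff_scaleR: "coeff (c *\<^sub>R f) x = c *\<^sub>R (coeff f x :: 'b)"
  by (simp only: scaleR_l2_def coeff_l2_of[OF square_summable_scale[OF coeff_summable]])

lemma coeff_uminus: "coeff (- f) x = - (coeff f x :: 'b)"
  by (simp add: uminus_l2_def coeff_l2_of coeff_summable)

lemma coeff_diff: "coeff (f - g) x = coeff f x - (coeff g x :: 'b)"
  by (simp add: minus_l2_def coeff_add coeff_uminus)

instance
  by standard (auto intro!: l2_eqI simp: coeff_add coeff_zero coeff_scaleR coeff_uminus coeff_diff algebra_simps)

end

instantiation l2 :: (type, real_inner) real_inner
begin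

definition inner_l2 :: "('a, 'b) l2 \<Rightarrow> ('a, 'b) l2 \<Rightarrow> real"
  where "inner_l2 f g = (\<Sum>\<^sub>\<infinity>x. coeff f x \<bullet> coeff g x)"
definition norm_l2 :: "('a, 'b) l2 \<Rightarrow> real"
  where "norm_l2 f = sqrt (f \<bullet> f)"
definition sgn_l2 :: "('a, 'b) l2 \<Rightarrow> ('a, 'b) l2"
  where "sgn_l2 f = f /\<^sub>R norm f"
definition dist_l2 :: "('a, 'b) l2 \<Rightarrow> ('a, 'b) l2 \<Rightarrow> real"
  where "dist_l2 f g = norm (f - g)"
definition uniformity_l2 :: "(('a, 'b) l2 \<times> ('a, 'b) l2) filter"
  where "uniformity_l2 = (INF e\<in>{0<..}. principal {(x, y). dist x y < e})"
definition open_l2 :: "('a, 'b) l2 set \<Rightarrow> bool"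
  where "open_l2 U \<longleftrightarrow> (\<forall>x\<in>U. \<forall>\<^sub>F (x', y) in uniformity. x' = x \<longrightarrow> y \<in> U)"

instance
proof
  fix f g h :: "('a, 'b) l2" and a b :: real
  show "dist f g = norm (f - g)" by (rule dist_l2_def)
  show "sgn f = f /\<^sub>R norm f" by (rule sgn_l2_def)
  show "uniformity = (INF e\<in>{0<..}. principal {(x, y). dist (x::('a, 'b) l2) y < e})" by (rule uniformity_l2_def)
  show "open U \<longleftrightarrow> (\<forall>x\<in>U. \<forall>\<^sub>F (x', y) in uniformity. x' = x \<longrightarrow> y \<in> U)" for U :: "('a, 'b) l2 set"
    by (rule open_l2_def)
  show "f \<bullet> g = g \<bullet> f" by (simp add: inner_l2_def inner_commute)
  show "(f + g) \<bullet> h = f \<bullet> h + g \<bullet> h"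
    by (simp add: inner_l2_def coeff_add inner_add_left infsum_add inner_summable)
  show "a *\<^sub>R f \<bullet> g = a * (f \<bullet> g)"
    by (simp add: inner_l2_def coeff_scaleR infsum_cmult_right inner_summable)
  show "0 \<le> f \<bullet> f" by (simp add: inner_l2_def infsum_nonneg)
  show "norm f = sqrt (f \<bullet> f)" by (rule norm_l2_def)
  show "f \<bullet> f = 0 \<longleftrightarrow> f = 0"
  proof
    assume "f \<bullet> f = 0"
    then have "coeff f x \<bullet> coeff f x = 0" for x
      by (intro nonneg_infsum_le_0D[of "\<lambda>x. coeff f x \<bullet> coeff f x" UNIV]) (simp_all add: inner_l2_def inner_summable)
    then show "f = 0" by (intro l2_eqI) (simp add: coeff_zero)
  qed (simp add: inner_l2_def coeff_zero)
qed

end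

lemma coeff_sum: "coeff (\<Sum>i\<in>I. f i) x = (\<Sum>i\<in>I. coeff (f i) x)"
  by (induction I rule: infinite_finite_induct) (auto simp: coeff_zero coeff_add)

lemma l2_norm_square: "(norm f)\<^sup>2 = (\<Sum>\<^sub>\<infinity>x. (norm (coeff f x))\<^sup>2)" for f :: "('g, 'e::real_inner) l2"
  by (simp add: power2_norm_eq_inner inner_l2_def)

lemma l2_partial_sum_le: "finite F \<Longrightarrow> (\<Sum>x\<in>F. (norm (coeff f x))\<^sup>2) \<le> (norm f)\<^sup>2"
  unfolding l2_norm_square by (rule finite_sum_le_infsum[OF coeff_summable]) auto

lemma norm_coeff_le: "norm (coeff f x) \<le> norm f"
  by (rule power2_le_imp_le[OF _ norm_ge_zero]) (use l2_partial_sum_le[of "{x}" f] in simp)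

lemma l2_of_bounded:
  fixes f :: "'g \<Rightarrow> 'e::real_inner"
  assumes "\<And>F. finite F \<Longrightarrow> (\<Sum>x\<in>F. (norm (f x))\<^sup>2) \<le> K\<^sup>2" "0 \<le> K"
  shows "coeff (l2_of f) = f" "norm (l2_of f) \<le> K"
proof -
  have "(\<lambda>x. (norm (f x))\<^sup>2) summable_on UNIV"
    using assms(1) by (intro nonneg_bounded_partial_sums_imp_summable_on[where C="K\<^sup>2"]) (auto simp: eventually_finite_subsets_at_top)
  then show *: "coeff (l2_of f) = f" by (rule coeff_l2_of)
  have "(norm (l2_of f))\<^sup>2 \<le> K\<^sup>2"
    unfolding l2_norm_square using assms(1) coeff_summable[of "l2_of f"]
    by (intro infsum_le_finite_sums) (auto simp: *)
  then show "norm (l2_of f) \<le> K"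
    using assms(2) by (rule power2_le_imp_le)
qed

instance l2 :: (type, "{real_inner, complete_space}") complete_space
proof
  fix X :: "nat \<Rightarrow> ('a, 'b) l2" assume X: "Cauchy X"
  have "Cauchy (\<lambda>n. coeff (X n) x)" for x
  proof (rule metric_CauchyI)
    fix e :: real assume "e > 0"
    then obtain N where N: "\<And>m n. m \<ge> N \<Longrightarrow> n \<ge> N \<Longrightarrow> dist (X m) (X n) < e"
      using metric_CauchyD[OF X] by blast
    have "dist (coeff (X m) x) (coeff (X n) x) \<le> dist (X m) (X n)" for m n
      using norm_coeff_le[of "X m - X n" x] by (simp add: dist_norm coeff_diff)
    then show "\<exists>M. \<forall>m\<ge>M. \<forall>n\<ge>M. dist (coeff (X m) x) (coeff (X n) x) < e"
      using N le_less_trans by blast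
  qed
  then have "\<exists>l. (\<lambda>n. coeff (X n) x) \<longlonglongrightarrow> l" for x
    using Cauchy_convergent convergent_def by blast
  then obtain g where g: "\<And>x. (\<lambda>n. coeff (X n) x) \<longlonglongrightarrow> g x" by metis
  have close: "\<exists>N. \<forall>m\<ge>N. coeff (l2_of (\<lambda>x. coeff (X m) x - g x)) = (\<lambda>x. coeff (X m) x - g x) \<and>
      norm (l2_of (\<lambda>x. coeff (X m) x - g x)) \<le> e" if e: "e > 0" for e
  proof -
    obtain N where N: "\<And>m n. m \<ge> N \<Longrightarrow> n \<ge> N \<Longrightarrow> dist (X m) (X n) < e"
      using metric_CauchyD[OF X e] by blast
    have "(\<Sum>x\<in>F. (norm (coeff (X m) x - g x))\<^sup>2) \<le> e\<^sup>2" if m: "m \<ge> N" and "finite F" for m F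
    proof (rule LIMSEQ_le_const2)
      show "(\<lambda>n. \<Sum>x\<in>F. (norm (coeff (X m) x - coeff (X n) x))\<^sup>2) \<longlonglongrightarrow> (\<Sum>x\<in>F. (norm (coeff (X m) x - g x))\<^sup>2)"
        by (intro tendsto_intros g)
      have "(\<Sum>x\<in>F. (norm (coeff (X m) x - coeff (X n) x))\<^sup>2) \<le> e\<^sup>2" if "n \<ge> N" for n
      proof -
        have "(\<Sum>x\<in>F. (norm (coeff (X m) x - coeff (X n) x))\<^sup>2) \<le> (norm (X m - X n))\<^sup>2"
          using l2_partial_sum_le[OF \<open>finite F\<close>, of "X m - X n"] by (simp add: coeff_diff)
        also have "\<dots> \<le> e\<^sup>2"
          using N[OF m that] by (intro power_mono) (auto simp: dist_norm)
        finally show ?thesis .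
      qed
      then show "\<exists>K. \<forall>n\<ge>K. (\<Sum>x\<in>F. (norm (coeff (X m) x - coeff (X n) x))\<^sup>2) \<le> e\<^sup>2" by blast
    qed
    note bound = this
    show ?thesis
    proof (intro exI allI impI conjI)
      fix m assume "m \<ge> N"
      note * = l2_of_bounded[OF bound[OF this] less_imp_le[OF e]]
      show "coeff (l2_of (\<lambda>x. coeff (X m) x - g x)) = (\<lambda>x. coeff (X m) x - g x)"
        by (rule *(1))
      show "norm (l2_of (\<lambda>x. coeff (X m) x - g x)) \<le> e"
        by (rule *(2))
    qed
  qed
  obtain N where N: "coeff (l2_of (\<lambda>x. coeff (X N) x - g x)) = (\<lambda>x. coeff (X N) x - g x)"
    using close[of 1] by auto
  define G where "G = X N - l2_of (\<lambda>x. coeff (X N) x - g x)"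
  have G: "coeff G x = g x" for x
    by (simp add: G_def coeff_diff N)
  have "X \<longlonglongrightarrow> G"
  proof (rule metric_LIMSEQ_I)
    fix e :: real assume "e > 0"
    then obtain K where K: "\<And>m. m \<ge> K \<Longrightarrow> coeff (l2_of (\<lambda>x. coeff (X m) x - g x)) = (\<lambda>x. coeff (X m) x - g x) \<and>
        norm (l2_of (\<lambda>x. coeff (X m) x - g x)) \<le> e / 2"
      using close[of "e / 2"] by auto
    have "dist (X m) G < e" if "m \<ge> K" for m
    proof -
      have "X m - G = l2_of (\<lambda>x. coeff (X m) x - g x)"
        using K[OF that] by (intro l2_eqI) (simp add: coeff_diff G)
      then show ?thesis
        using K[OF that] \<open>e > 0\<close> by (simp add: dist_norm)
    qed
    then show "\<exists>no. \<forall>n\<ge>no. dist (X n) G < e" by blast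
  qed
  then show "convergent X" by (rule convergentI)
qed

text \<open>The orthogonal projection onto the functions supported in \<open>Y\<close>.\<close>

definition restr :: "'g set \<Rightarrow> ('g, 'e::real_inner) l2 \<Rightarrow> ('g, 'e) l2" where
  "restr Y f = l2_of (\<lambda>x. if x \<in> Y then coeff f x else 0)"

lemma coeff_restr: "coeff (restr Y f) x = (if x \<in> Y then coeff f x else 0)"
proof -
  have "(\<lambda>x. (norm (if x \<in> Y then coeff f x else 0))\<^sup>2) summable_on UNIV"
    by (rule summable_on_comparison_test[OF coeff_summable[of f]]) auto
  then show ?thesis by (simp add: restr_def coeff_l2_of)
qed

lemma restr_restr: "restr Y (restr Z f) = restr (Y \<inter> Z) f"
  by (rule l2_eqI) (simp add: coeff_restr)

lemma symmetric_op_restr: "symmetric_op (restr Y)"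
  unfolding symmetric_op_def
proof (intro conjI allI linearI)
  show "restr Y (f + g) = restr Y f + restr Y g" for f g :: "('a, 'b) l2"
    by (rule l2_eqI) (simp add: coeff_restr coeff_add)
  show "restr Y (c *\<^sub>R f) = c *\<^sub>R restr Y f" for c and f :: "('a, 'b) l2"
    by (rule l2_eqI) (simp add: coeff_restr coeff_scaleR)
  show "restr Y f \<bullet> g = f \<bullet> restr Y g" for f g :: "('a, 'b) l2"
    by (simp add: inner_l2_def coeff_restr if_distrib if_distribR cong: if_cong)
qed

lemma symmetric_idempotent_norm_le:
  fixes P :: "'a::real_inner \<Rightarrow> 'a"
  assumes "symmetric_op P" "\<And>f. P (P f) = P f"
  shows "norm (P f) \<le> norm f"
proof -
  have "(norm (P f))\<^sup>2 = P f \<bullet> f"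
    using symmetric_opD[OF assms(1), of "P f" f] by (simp add: power2_norm_eq_inner assms(2))
  also have "\<dots> \<le> norm (P f) * norm f"
    by (rule norm_cauchy_schwarz)
  finally show ?thesis
    by (cases "P f = 0") (auto simp: power2_eq_square)
qed

lemma norm_restr_le: "norm (restr Y f) \<le> norm f"
  by (rule symmetric_idempotent_norm_le[OF symmetric_op_restr]) (simp add: restr_restr)

definition single :: "'g \<Rightarrow> 'e::real_inner \<Rightarrow> ('g, 'e) l2" where
  "single g v = l2_of (\<lambda>x. if x = g then v else 0)"

lemma coeff_single: "coeff (single g v) x = (if x = g then v else 0)"
proof -
  have "(\<lambda>x. (norm (if x = g then v else 0))\<^sup>2) summable_on UNIV \<longleftrightarrow> (\<lambda>x. (norm (if x = g then v else 0))\<^sup>2) summable_on {g}"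
    by (intro summable_on_cong_neutral) auto
  then show ?thesis by (simp add: single_def coeff_l2_of)
qed

lemma inner_single: "f \<bullet> single g v = coeff f g \<bullet> v"
proof -
  have "f \<bullet> single g v = (\<Sum>\<^sub>\<infinity>x\<in>{g}. coeff f x \<bullet> v)"
    unfolding inner_l2_def by (intro infsum_cong_neutral) (auto simp: coeff_single)
  then show ?thesis by simp
qed

lemma norm_single: "norm (single g v) = norm v"
  by (simp add: norm_eq_sqrt_inner inner_single coeff_single)

lemma restr_single: "restr Y (single g v) = (if g \<in> Y then single g v else 0)"
  by (rule l2_eqI) (simp add: coeff_restr coeff_single coeff_zero)

lemma parseval:
  fixes f :: "('g, 'e::euclidean_space) l2"
  assumes "restr Y f = f"
  shows "(\<lambda>x. \<Sum>v\<in>Basis. (f \<bullet> single x v)\<^sup>2) summable_on Y"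
    and "(norm f)\<^sup>2 = (\<Sum>\<^sub>\<infinity>x\<in>Y. \<Sum>v\<in>Basis. (f \<bullet> single x v)\<^sup>2)"
proof -
  have eq: "(\<Sum>v\<in>Basis. (f \<bullet> single x v)\<^sup>2) = (norm (coeff f x))\<^sup>2" for x
    unfolding inner_single power2_norm_eq_inner
    by (subst euclidean_inner) (simp add: power2_eq_square)
  show "(\<lambda>x. \<Sum>v\<in>Basis. (f \<bullet> single x v)\<^sup>2) summable_on Y"
    unfolding eq by (rule coeff_summable)
  have "coeff f x = 0" if "x \<notin> Y" for x
    using arg_cong[OF assms, of "\<lambda>f. coeff f x"] that by (simp add: coeff_restr)
  then show "(norm f)\<^sup>2 = (\<Sum>\<^sub>\<infinity>x\<in>Y. \<Sum>v\<in>Basis. (f \<bullet> single x v)\<^sup>2)"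
    unfolding eq l2_norm_square by (intro infsum_cong_neutral) auto
qed

section \<open>Right translations and traces\<close>

text \<open>Values off the carrier are set to \<open>0\<close>, so this is an isometry on functions supported in the carrier.\<close>

definition right_trans :: "('g, 'x) monoid_scheme \<Rightarrow> 'g \<Rightarrow> ('g, 'e::real_inner) l2 \<Rightarrow> ('g, 'e) l2" where
  "right_trans G h f = l2_of (\<lambda>x. if x \<in> carrier G then coeff f (x \<otimes>\<^bsub>G\<^esub> h) else 0)"

lemma bij_betw_right_mult:
  assumes "group G" "h \<in> carrier G"
  shows "bij_betw (\<lambda>x. x \<otimes>\<^bsub>G\<^esub> h) (carrier G) (carrier G)"
proof -
  interpret group G by fact
  show ?thesis
    using assms(2) by (intro bij_betw_byWitness[where f'="\<lambda>x. x \<otimes>\<^bsub>G\<^esub> inv\<^bsub>G\<^esub> h"]) (auto simp: m_assoc)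
qed

lemma coeff_right_trans:
  assumes "group G" "h \<in> carrier G"
  shows "coeff (right_trans G h f) x = (if x \<in> carrier G then coeff f (x \<otimes>\<^bsub>G\<^esub> h) else 0)"
proof -
  have "(\<lambda>x. (norm (coeff f (x \<otimes>\<^bsub>G\<^esub> h)))\<^sup>2) summable_on carrier G"
    using summable_on_reindex_bij_betw[OF bij_betw_right_mult[OF assms], of "\<lambda>x. (norm (coeff f x))\<^sup>2"]
    by (simp add: coeff_summable)
  then have "(\<lambda>x. (norm (if x \<in> carrier G then coeff f (x \<otimes>\<^bsub>G\<^esub> h) else 0))\<^sup>2) summable_on UNIV"
    by (subst summable_on_cong_neutral[where T="carrier G"]) (auto cong: if_cong)
  then show ?thesis by (simp add: right_trans_def coeff_l2_of)
qed

lemma inner_right_trans: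
  assumes "group G" "h \<in> carrier G" "restr (carrier G) g = g"
  shows "right_trans G h f \<bullet> right_trans G h g = f \<bullet> g"
proof -
  have zero: "coeff g x = 0" if "x \<notin> carrier G" for x
    using arg_cong[OF assms(3), of "\<lambda>f. coeff f x"] that by (simp add: coeff_restr)
  have "right_trans G h f \<bullet> right_trans G h g = (\<Sum>\<^sub>\<infinity>x\<in>carrier G. coeff f (x \<otimes>\<^bsub>G\<^esub> h) \<bullet> coeff g (x \<otimes>\<^bsub>G\<^esub> h))"
    unfolding inner_l2_def by (intro infsum_cong_neutral) (auto simp: coeff_right_trans[OF assms(1,2)])
  also have "\<dots> = (\<Sum>\<^sub>\<infinity>x\<in>carrier G. coeff f x \<bullet> coeff g x)"
    by (rule infsum_reindex_bij_betw[OF bij_betw_right_mult[OF assms(1,2)]])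
  also have "\<dots> = f \<bullet> g"
    unfolding inner_l2_def by (intro infsum_cong_neutral) (auto simp: zero)
  finally show ?thesis .
qed

lemma right_trans_linear:
  assumes "group G" "h \<in> carrier G"
  shows "linear (right_trans G h)"
proof (rule linearI)
  show "right_trans G h (f + g) = right_trans G h f + right_trans G h g" for f g :: "('a, 'c) l2"
    by (rule l2_eqI) (simp add: coeff_right_trans[OF assms] coeff_add)
  show "right_trans G h (c *\<^sub>R f) = c *\<^sub>R right_trans G h f" for c and f :: "('a, 'c) l2"
    by (rule l2_eqI) (simp add: coeff_right_trans[OF assms] coeff_scaleR)
qed

lemma right_trans_bounded_linear:
  assumes "group G" "h \<in> carrier G"
  shows "bounded_linear (right_trans G h :: ('g, 'e::real_inner) l2 \<Rightarrow> _)"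
proof (rule bounded_linear_intro[where K=1])
  fix f :: "('g, 'e) l2"
  have "right_trans G h f = right_trans G h (restr (carrier G) f)"
    using assms by (intro l2_eqI) (simp add: coeff_right_trans coeff_restr group.is_monoid monoid.m_closed)
  then have "norm (right_trans G h f) = norm (restr (carrier G) f)"
    using inner_right_trans[OF assms, of "restr (carrier G) f" "restr (carrier G) f"]
    by (simp add: norm_eq_sqrt_inner restr_restr)
  then show "norm (right_trans G h f) \<le> norm f * 1"
    using norm_restr_le by simp
qed (simp_all add: linear_add[OF right_trans_linear[OF assms]] linear_scale[OF right_trans_linear[OF assms]])

lemma right_trans_single:
  assumes "group G" "h \<in> carrier G" "g \<in> carrier G"
  shows "right_trans G h (single g v) = single (g \<otimes>\<^bsub>G\<^esub> inv\<^bsub>G\<^esub> h) v"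
proof (rule l2_eqI)
  interpret group G by fact
  fix x
  have "x \<otimes>\<^bsub>G\<^esub> h = g \<longleftrightarrow> x = g \<otimes>\<^bsub>G\<^esub> inv\<^bsub>G\<^esub> h" if "x \<in> carrier G"
    using that assms by (metis inv_solve_right)
  then show "coeff (right_trans G h (single g v)) x = coeff (single (g \<otimes>\<^bsub>G\<^esub> inv\<^bsub>G\<^esub> h) v) x"
    using assms by (auto simp: coeff_right_trans coeff_single)
qed

lemma has_sum_finite_sum:
  fixes f :: "'i \<Rightarrow> 'a \<Rightarrow> real"
  assumes "finite I" "\<And>i. i \<in> I \<Longrightarrow> (f i has_sum S i) A"
  shows "((\<lambda>x. \<Sum>i\<in>I. f i x) has_sum (\<Sum>i\<in>I. S i)) A"
  using assms by (induction I rule: finite_induct) (auto intro: has_sum_add)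

text \<open>The section \<open>s\<close> splits the preimage of a set \<open>X\<close> into the free orbits \<open>s x H\<close> of the kernel, for \<open>x\<close> in \<open>X\<close>.\<close>

locale fibred_group =
  fixes G :: "('g, 'x) monoid_scheme" (structure) and Q :: "('q, 'y) monoid_scheme"
    and p :: "'g \<Rightarrow> 'q" and s :: "'q \<Rightarrow> 'g"
  assumes group_G: "group G" and group_Q: "group Q" and hom_p: "p \<in> hom G Q"
    and sect: "\<And>x. x \<in> carrier Q \<Longrightarrow> s x \<in> carrier G \<and> p (s x) = x"
begin

sublocale G: group G by (rule group_G)
sublocale Q: group Q by (rule group_Q)

abbreviation H :: "'g set" where "H \<equiv> kernel G Q p"

lemma p_mult: "x \<in> carrier G \<Longrightarrow> y \<in> carrier G \<Longrightarrow> p (x \<otimes> y) = p x \<otimes>\<^bsub>Q\<^esub> p y"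
  using hom_p by (simp add: hom_def)

lemma p_closed: "x \<in> carrier G \<Longrightarrow> p x \<in> carrier Q"
  using hom_p by (auto simp: hom_def)

lemma p_inv: "x \<in> carrier G \<Longrightarrow> p (inv x) = inv\<^bsub>Q\<^esub> p x"
  using group_hom.hom_inv[of G Q p] group_G group_Q hom_p by (simp add: group_hom_def group_hom_axioms_def)

lemma H_carrier: "h \<in> H \<Longrightarrow> h \<in> carrier G"
  by (simp add: kernel_def)

lemma H_inv: "h \<in> H \<Longrightarrow> inv h \<in> H"
  by (simp add: kernel_def p_inv)

lemma p_H: "x \<in> carrier G \<Longrightarrow> h \<in> H \<Longrightarrow> p (x \<otimes> h) = p x"
  by (simp add: kernel_def p_mult p_closed)

lemma fibre_bij: "x \<in> carrier Q \<Longrightarrow> bij_betw (\<lambda>h. s x \<otimes> h) H (preimage G p {x})"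
proof (rule bij_betw_byWitness[where f'="\<lambda>y. inv s x \<otimes> y"])
  assume x: "x \<in> carrier Q"
  note sx = sect[OF x]
  show "\<forall>h\<in>H. inv s x \<otimes> (s x \<otimes> h) = h"
    using sx by (auto simp: H_carrier G.m_assoc[symmetric])
  show "\<forall>y\<in>preimage G p {x}. s x \<otimes> (inv s x \<otimes> y) = y"
    using sx by (auto simp: preimage_def G.m_assoc[symmetric])
  show "(\<lambda>h. s x \<otimes> h) ` H \<subseteq> preimage G p {x}"
    using sx by (auto simp: preimage_def p_H H_carrier)
  show "(\<lambda>y. inv s x \<otimes> y) ` preimage G p {x} \<subseteq> H"
    using sx x by (auto simp: preimage_def kernel_def p_mult p_inv)
qed

definition equivariant :: "(('g, 'e::real_inner) l2 \<Rightarrow> ('g, 'e) l2) \<Rightarrow> bool" where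
  "equivariant Z \<longleftrightarrow> (\<forall>h\<in>H. \<forall>f. Z (right_trans G h f) = right_trans G h (Z f))"

lemma equivariant_comp: "equivariant Z \<Longrightarrow> equivariant W \<Longrightarrow> equivariant (\<lambda>f. Z (W f))"
  by (simp add: equivariant_def)

lemma equivariant_funpow: "equivariant Z \<Longrightarrow> equivariant (Z ^^ n)"
  by (induction n) (auto simp: equivariant_def)

lemma equivariant_add: "equivariant Z \<Longrightarrow> equivariant W \<Longrightarrow> equivariant (\<lambda>f. Z f + W f)"
  by (simp add: equivariant_def linear_add[OF right_trans_linear[OF group_G]] H_carrier)

lemma equivariant_restr: "equivariant (restr (preimage G p X))"
  unfolding equivariant_def
proof (intro ballI allI)
  fix h f assume h: "h \<in> H"
  show "restr (preimage G p X) (right_trans G h f) = right_trans G h (restr (preimage G p X) f)"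
    using p_H[OF _ h] H_carrier[OF h]
    by (intro l2_eqI) (auto simp: coeff_restr coeff_right_trans[OF group_G] preimage_def)
qed

lemma equivariant_kernel_projection:
  fixes N :: "('g, 'e::{real_inner, complete_space}) l2 \<Rightarrow> ('g, 'e) l2"
  assumes "between_0_1 N" "equivariant N"
  shows "equivariant (kernel_projection N)"
  unfolding equivariant_def
proof (intro ballI allI)
  fix h f assume h: "h \<in> H"
  show "kernel_projection N (right_trans G h f) = right_trans G h (kernel_projection N f)"
    using assms(2) h
    by (subst kernel_projection_commute[OF assms(1) right_trans_bounded_linear[OF group_G H_carrier[OF h]]])
       (auto simp: equivariant_def)
qed

lemma infsum_preimage:
  fixes \<phi> :: "'g \<Rightarrow> real"
  assumes X: "finite X" "X \<subseteq> carrier Q" and sum: "\<phi> summable_on preimage G p X"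
  shows "(\<Sum>\<^sub>\<infinity>y\<in>preimage G p X. \<phi> y) = (\<Sum>x\<in>X. \<Sum>\<^sub>\<infinity>h\<in>H. \<phi> (s x \<otimes> h))"
proof -
  have "(\<Sum>x\<in>X. \<Sum>\<^sub>\<infinity>h\<in>H. \<phi> (s x \<otimes> h)) = (\<Sum>x\<in>X. infsum \<phi> (preimage G p {x}))"
    using X by (intro sum.cong refl infsum_reindex_bij_betw fibre_bij) auto
  also have "\<dots> = infsum \<phi> (\<Union>x\<in>X. preimage G p {x})"
  proof (rule sum_infsum[OF X(1)])
    show "\<phi> summable_on preimage G p {x}" if "x \<in> X" for x
      using sum by (rule summable_on_subset_banach) (use that in \<open>auto simp: preimage_def\<close>)
  qed (auto simp: preimage_def)
  also have "(\<Union>x\<in>X. preimage G p {x}) = preimage G p X"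
    by (auto simp: preimage_def)
  finally show ?thesis ..
qed

text \<open>The unnormalized trace over the fundamental domain \<open>s ` X\<close>.  \<open>Basis\<close> is a real basis of the value
  space, so for complex values every complex dimension counts twice.\<close>

definition ftrace :: "'q set \<Rightarrow> (('g, 'e::euclidean_space) l2 \<Rightarrow> ('g, 'e) l2) \<Rightarrow> real" where
  "ftrace X Z = (\<Sum>x\<in>X. \<Sum>v\<in>Basis. Z (single (s x) v) \<bullet> single (s x) v)"

text \<open>The left side adds the squared matrix entries with column in the fundamental domain and row anywhere over
  \<open>X\<close>.  By equivariance the translation by \<open>h \<in> H\<close> can be moved from the row to the column, which gives the
  entries with row in the fundamental domain.\<close>

lemma hilbert_schmidt_adjoint:
  fixes Z Z' :: "('g, 'e::euclidean_space) l2 \<Rightarrow> ('g, 'e) l2"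
  assumes X: "finite X" "X \<subseteq> carrier Q"
    and adj: "\<And>f g. Z f \<bullet> g = f \<bullet> Z' g"
    and eq: "equivariant Z"
    and supp: "\<And>f. restr (preimage G p X) (Z f) = Z f" "\<And>f. restr (preimage G p X) (Z' f) = Z' f"
  shows "(\<Sum>x\<in>X. \<Sum>v\<in>Basis. (norm (Z (single (s x) v)))\<^sup>2) = (\<Sum>x\<in>X. \<Sum>v\<in>Basis. (norm (Z' (single (s x) v)))\<^sup>2)"
proof -
  let ?Y = "preimage G p X"
  define K where "K x y = (\<Sum>v\<in>Basis. \<Sum>w\<in>Basis. (Z (single x v) \<bullet> single y w)\<^sup>2)" for x y
  have K_inv: "K x (y \<otimes> h) = K (x \<otimes> inv h) y"
    if "x \<in> carrier G" "y \<in> carrier G" "h \<in> H" for x y h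
  proof -
    have h: "h \<in> carrier G" using that H_carrier by blast
    have "Z (single x v) \<bullet> single (y \<otimes> h) w = Z (single (x \<otimes> inv h) v) \<bullet> single y w" for v w
    proof -
      have "Z (single x v) \<bullet> single (y \<otimes> h) w
          = right_trans G h (Z (single x v)) \<bullet> right_trans G h (single (y \<otimes> h) w)"
        using that h by (intro inner_right_trans[symmetric] group_G) (auto simp: restr_single)
      also have "\<dots> = Z (right_trans G h (single x v)) \<bullet> right_trans G h (single (y \<otimes> h) w)"
        using eq that by (simp add: equivariant_def)
      finally show ?thesis
        using that h by (simp add: right_trans_single[OF group_G] G.m_assoc)
    qed
    then show ?thesis by (simp add: K_def)
  qed
  have parseval_sum: "((\<lambda>y. \<Sum>w\<in>Basis. (f \<bullet> single y w)\<^sup>2) has_sum (norm f)\<^sup>2) ?Y" if "restr ?Y f = f" for f :: "('g, 'e) l2"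
    using parseval[OF that] by (simp add: has_sum_infsum)
  have K_left: "((\<lambda>y. K x y) has_sum (\<Sum>v\<in>Basis. (norm (Z (single x v)))\<^sup>2)) ?Y" for x
    unfolding K_def by (intro has_sum_finite_sum parseval_sum supp) simp
  have K': "K x y = (\<Sum>w\<in>Basis. \<Sum>v\<in>Basis. (Z' (single y w) \<bullet> single x v)\<^sup>2)" for x y
  proof -
    have "Z (single x v) \<bullet> single y w = Z' (single y w) \<bullet> single x v" for v w
      by (subst adj) (rule inner_commute)
    then show ?thesis
      unfolding K_def by (simp only:) (rule sum.swap)
  qed
  have K_right: "((\<lambda>x. K x y) has_sum (\<Sum>v\<in>Basis. (norm (Z' (single y v)))\<^sup>2)) ?Y" for y
    unfolding K' by (intro has_sum_finite_sum parseval_sum supp) simp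
  have bij: "bij_betw (\<lambda>h. inv h) H H"
    by (rule bij_betw_byWitness[where f'="\<lambda>h. inv h"]) (auto simp: H_inv H_carrier)
  have sX: "s x \<in> carrier G" if "x \<in> X" for x using that X sect by blast
  have "(\<Sum>x\<in>X. \<Sum>v\<in>Basis. (norm (Z (single (s x) v)))\<^sup>2) = (\<Sum>x\<in>X. \<Sum>y\<in>X. \<Sum>\<^sub>\<infinity>h\<in>H. K (s x) (s y \<otimes> h))"
    by (simp only: infsumI[OF K_left, symmetric] infsum_preimage[OF X has_sum_imp_summable[OF K_left]])
  also have "\<dots> = (\<Sum>x\<in>X. \<Sum>y\<in>X. \<Sum>\<^sub>\<infinity>h\<in>H. K (s x \<otimes> inv h) (s y))"
    by (intro sum.cong infsum_cong refl K_inv sX)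
  also have "\<dots> = (\<Sum>x\<in>X. \<Sum>y\<in>X. \<Sum>\<^sub>\<infinity>h\<in>H. K (s x \<otimes> h) (s y))"
    by (intro sum.cong refl infsum_reindex_bij_betw[OF bij])
  also have "\<dots> = (\<Sum>y\<in>X. \<Sum>x\<in>X. \<Sum>\<^sub>\<infinity>h\<in>H. K (s x \<otimes> h) (s y))"
    by (rule sum.swap)
  also have "\<dots> = (\<Sum>y\<in>X. \<Sum>v\<in>Basis. (norm (Z' (single (s y) v)))\<^sup>2)"
    by (simp only: infsumI[OF K_right, symmetric] infsum_preimage[OF X has_sum_imp_summable[OF K_right]])
  finally show ?thesis .
qed

text \<open>Equivariant operators with range in the functions over \<open>X\<close> that are adjoint to each other.\<close>

definition adjoint_pair :: "'q set \<Rightarrow> (('g, 'e::real_inner) l2 \<Rightarrow> ('g, 'e) l2) \<Rightarrow> (('g, 'e) l2 \<Rightarrow> ('g, 'e) l2) \<Rightarrow> bool" where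
  "adjoint_pair X Z Z' \<longleftrightarrow> (\<forall>f g. Z f \<bullet> g = f \<bullet> Z' g) \<and> equivariant Z \<and> equivariant Z' \<and>
     (\<forall>f. restr (preimage G p X) (Z f) = Z f) \<and> (\<forall>f. restr (preimage G p X) (Z' f) = Z' f)"

text \<open>Polarization of the equality of the Hilbert-Schmidt norms of an operator and its adjoint.\<close>

lemma ftrace_commute:
  fixes V V' W W' :: "('g, 'e::euclidean_space) l2 \<Rightarrow> ('g, 'e) l2"
  assumes X: "finite X" "X \<subseteq> carrier Q" and V: "adjoint_pair X V V'" and W: "adjoint_pair X W W'"
  shows "ftrace X (\<lambda>f. V (W f)) = ftrace X (\<lambda>f. W (V f))"
proof -
  let ?S = "\<lambda>Z :: ('g, 'e) l2 \<Rightarrow> ('g, 'e) l2. \<Sum>x\<in>X. \<Sum>v\<in>Basis. (norm (Z (single (s x) v)))\<^sup>2"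
  have adjoint: "?S Z = ?S Z'" if "adjoint_pair X Z Z'" for Z Z'
    using that by (intro hilbert_schmidt_adjoint[OF X]) (auto simp: adjoint_pair_def)
  have polar: "2 * ftrace X (\<lambda>f. V (W f)) = ?S (\<lambda>f. W f + V' f) - ?S W - ?S V'"
    if "\<And>f g. V f \<bullet> g = f \<bullet> V' g" for V V' W :: "('g, 'e) l2 \<Rightarrow> ('g, 'e) l2"
  proof -
    have "2 * (V (W f) \<bullet> f) = (norm (W f + V' f))\<^sup>2 - (norm (W f))\<^sup>2 - (norm (V' f))\<^sup>2" for f
      by (simp add: that power2_norm_eq_inner inner_add inner_commute[of "V' f" "W f"])
    then show ?thesis
      by (simp add: ftrace_def sum_distrib_left sum_subtractf)
  qed
  have "adjoint_pair X (\<lambda>f. W f + V' f) (\<lambda>f. W' f + V f)"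
  proof -
    have "V' f \<bullet> g = f \<bullet> V g" for f g
      using V unfolding adjoint_pair_def by (metis inner_commute)
    then show ?thesis
      using V W by (simp add: adjoint_pair_def equivariant_add inner_add linear_add[OF symmetric_op_linear[OF symmetric_op_restr]])
  qed
  from adjoint[OF this] have "?S (\<lambda>f. W f + V' f) = ?S (\<lambda>f. V f + W' f)"
    by (simp add: add.commute)
  then have "2 * ftrace X (\<lambda>f. V (W f)) = 2 * ftrace X (\<lambda>f. W (V f))"
    using V W adjoint[OF V] adjoint[OF W] by (subst (1 2) polar) (auto simp: adjoint_pair_def)
  then show ?thesis by simp
qed

end

lemma between_0_1I:
  assumes "symmetric_op N" "\<And>f. N f \<bullet> f = (norm (K f))\<^sup>2" "\<And>f. norm (K f) \<le> norm f"
  shows "between_0_1 N"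
  unfolding between_0_1_def
proof (intro conjI allI)
  show "N f \<bullet> f \<le> f \<bullet> f" for f
    unfolding assms(2) power2_norm_eq_inner[symmetric] using assms(3) by (intro power_mono) auto
qed (use assms in simp_all)

lemma between_0_1_square:
  assumes "symmetric_op C" "\<And>f. norm (C f) \<le> norm f"
  shows "between_0_1 (\<lambda>f. C (C f))"
proof (rule between_0_1I[where K=C])
  show "symmetric_op (\<lambda>f. C (C f))"
    using symmetric_op_funpow[OF assms(1), of 2] by (simp add: numeral_2_eq_2 o_def)
qed (use assms in \<open>auto simp: symmetric_opD power2_norm_eq_inner\<close>)

lemma between_0_1_sandwich:
  assumes C: "symmetric_op C" "\<And>f. norm (C f) \<le> norm f" and R: "symmetric_op R" "\<And>f. R (R f) = R f"
  shows "between_0_1 (\<lambda>f. C (R (C f)))" and "C (R (C f)) \<bullet> f = (norm (R (C f)))\<^sup>2"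
proof -
  show *: "C (R (C f)) \<bullet> f = (norm (R (C f)))\<^sup>2" for f
    using symmetric_opD[OF R(1), of "R (C f)" "C f"]
    by (simp add: symmetric_opD[OF C(1)] power2_norm_eq_inner R(2))
  show "between_0_1 (\<lambda>f. C (R (C f)))"
  proof (rule between_0_1I[OF _ *])
    show "norm (R (C f)) \<le> norm f" for f
      using symmetric_idempotent_norm_le[OF R, of "C f"] C(2)[of f] by linarith
  qed (rule symmetric_op_conjugate[OF C(1) R(1)])
qed

lemma kernel_square:
  assumes "symmetric_op C" "C (C f) = 0"
  shows "C f = 0"
  using symmetric_opD[OF assms(1), of "C f" f] assms(2) by simp

context fibred_group
begin

lemma ftrace_diff: "ftrace X (\<lambda>f. Z f - W f) = ftrace X Z - ftrace X W"
  by (simp add: ftrace_def inner_diff sum_subtractf)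

lemma ftrace_add: "ftrace X (\<lambda>f. Z f + W f) = ftrace X Z + ftrace X W"
  by (simp add: ftrace_def inner_add sum.distrib)

lemma adjoint_pair_sym: "adjoint_pair X Z Z' \<Longrightarrow> adjoint_pair X Z' Z"
  unfolding adjoint_pair_def by (metis inner_commute)

text \<open>The trace property gives \<open>tr (B' B)\<^sup>k = tr (B B')\<^sup>k\<close> for \<open>k > 0\<close>, and \<open>1 - (1 - z)\<^sup>n\<close> has no constant
  term.\<close>

lemma ftrace_complement_power:
  fixes B B' :: "('g, 'e::euclidean_space) l2 \<Rightarrow> ('g, 'e) l2"
  assumes X: "finite X" "X \<subseteq> carrier Q" and B: "adjoint_pair X B B'" and lin: "linear B" "linear B'"
  shows "ftrace X (\<lambda>f. f - ((\<lambda>f. f - B' (B f)) ^^ n) f) = ftrace X (\<lambda>f. f - ((\<lambda>f. f - B (B' f)) ^^ n) f)"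
proof -
  define N where "N = (\<lambda>f. B' (B f))"
  define W where "W = (\<lambda>f. B (B' f))"
  have adj: "B f \<bullet> g = f \<bullet> B' g" "B' f \<bullet> g = f \<bullet> B g" for f g
    using B adjoint_pair_sym[OF B] by (auto simp: adjoint_pair_def)
  have eq: "equivariant B" "equivariant B'" and supp: "restr (preimage G p X) (B f) = B f" "restr (preimage G p X) (B' f) = B' f" for f
    using B by (auto simp: adjoint_pair_def)
  have linN: "linear N" and linW: "linear W"
    unfolding N_def W_def using lin by (auto intro: linear_compose[unfolded o_def])
  have symN: "symmetric_op N"
    using linN by (simp add: symmetric_op_def N_def adj)
  have pow: "ftrace X (\<lambda>f. N ((N ^^ k) f)) = ftrace X (\<lambda>f. W ((W ^^ k) f))" for k
  proof -
    have BN: "B ((N ^^ k) f) = (W ^^ k) (B f)" for f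
      by (induction k) (simp_all add: N_def W_def)
    have supp_pow: "restr (preimage G p X) ((N ^^ k) (B' f)) = (N ^^ k) (B' f)" for f
      by (cases k) (simp_all add: N_def supp)
    have "equivariant N"
      unfolding N_def by (rule equivariant_comp[OF eq(2,1)])
    then have "adjoint_pair X (\<lambda>f. B ((N ^^ k) f)) (\<lambda>f. (N ^^ k) (B' f))"
      using equivariant_comp[OF eq(1) equivariant_funpow, of N k] equivariant_comp[OF equivariant_funpow eq(2), of N k]
      by (simp add: adjoint_pair_def adj supp supp_pow symmetric_opD[OF symmetric_op_funpow[OF symN]])
    from ftrace_commute[OF X adjoint_pair_sym[OF B] this] have "ftrace X (\<lambda>f. B' (B ((N ^^ k) f))) = ftrace X (\<lambda>f. (W ^^ k) (B (B' f)))"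
      by (simp only: BN)
    then show ?thesis
      unfolding funpow_swap1[of W] by (simp only: N_def W_def)
  qed
  have pow_compl: "ftrace X (\<lambda>f. N ((N ^^ k) (((\<lambda>f. f - N f) ^^ n) f))) = ftrace X (\<lambda>f. W ((W ^^ k) (((\<lambda>f. f - W f) ^^ n) f)))" for k n
  proof (induction n arbitrary: k)
    case (Suc n)
    have step: "Z ((Z ^^ k) (((\<lambda>f. f - Z f) ^^ Suc n) f))
        = Z ((Z ^^ k) (((\<lambda>f. f - Z f) ^^ n) f)) - Z ((Z ^^ Suc k) (((\<lambda>f. f - Z f) ^^ n) f))"
      if "linear Z" for Z :: "('g, 'e) l2 \<Rightarrow> ('g, 'e) l2" and f
      using linear_diff[OF that] linear_diff[OF linear_funpow[OF that]] by (simp add: funpow_swap1)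
    show ?case
      by (simp only: step[OF linN] step[OF linW] ftrace_diff Suc)
  qed (use pow in simp)
  have "ftrace X (\<lambda>f. f - ((\<lambda>f. f - N f) ^^ n) f) = ftrace X (\<lambda>f. f - ((\<lambda>f. f - W f) ^^ n) f)"
  proof (induction n)
    case (Suc n)
    have step: "f - ((\<lambda>f. f - Z f) ^^ Suc n) f = (f - ((\<lambda>f. f - Z f) ^^ n) f) + Z ((Z ^^ 0) (((\<lambda>f. f - Z f) ^^ n) f))"
      for Z :: "('g, 'e) l2 \<Rightarrow> ('g, 'e) l2" and f
      by simp
    show ?case
      by (simp only: step[of _ N] step[of _ W] ftrace_add Suc pow_compl)
  qed simp
  then show ?thesis by (simp add: N_def W_def)
qed

text \<open>The sums are the dimensions of \<open>ker A\<close> and \<open>ker C\<close>, measured over \<open>X\<close>.  Let \<open>E\<close> be the projection onto the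
  functions \<open>f\<close> such that \<open>C f\<close> vanishes over \<open>X - D\<close>.  It contains \<open>ker C\<close> and, by locality, the
  restrictions of \<open>ker A\<close>, so the dimension of \<open>ker A\<close> is at most the trace of \<open>E\<close>.  The
  operator \<open>B = C E\<close> maps into functions on \<open>D\<close> and its kernel is that of \<open>E\<close> plus \<open>ker C\<close>.  Hence
  the trace of \<open>E\<close> minus the dimension of \<open>ker C\<close> is the limit of the traces of
  \<open>1 - (1 - B\<^sup>* B)\<^sup>n\<close>.  These are the traces of \<open>1 - (1 - B B\<^sup>*)\<^sup>n\<close>, an operator below the identity that
  only sees basis vectors over \<open>D\<close>.\<close>

theorem kernel_trace_inequality:
  fixes A :: "('g, 'e::euclidean_space) l2 \<Rightarrow> ('g, 'e) l2"
  assumes X: "finite X" "X \<subseteq> carrier Q" and D: "D \<subseteq> X"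
    and A: "symmetric_op A" "\<And>f. norm (A f) \<le> norm f" "equivariant A"
    and local: "\<And>f x. x \<in> preimage G p (X - D) \<Longrightarrow> coeff (A f) x = coeff (A (restr (preimage G p X) f)) x"
  defines "C \<equiv> \<lambda>f. restr (preimage G p X) (A (restr (preimage G p X) f))"
  shows "(\<Sum>x\<in>X. \<Sum>v\<in>Basis. (norm (kernel_projection (\<lambda>f. A (A f)) (single (s x) v)))\<^sup>2)
    \<le> (\<Sum>x\<in>X. \<Sum>v\<in>Basis. (norm (kernel_projection (\<lambda>f. C (C f)) (single (s x) v)))\<^sup>2)
      + real (card D) * real DIM('e)"
proof -
  define Y where "Y = preimage G p X"
  define R where "R = (restr (preimage G p (X - D)) :: ('g, 'e) l2 \<Rightarrow> ('g, 'e) l2)"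
  note P_sym = symmetric_op_restr[of Y]
  have C_eq: "C = (\<lambda>f. restr Y (A (restr Y f)))" by (simp add: C_def Y_def)
  have PC: "restr Y (C f) = C f" "C (restr Y f) = C f" for f
    by (simp_all add: C_eq restr_restr)
  have C: "symmetric_op C"
    unfolding C_eq by (rule symmetric_op_conjugate[OF P_sym A(1)])
  have C_le: "norm (C f) \<le> norm f" for f
    unfolding C_eq using norm_restr_le[of Y "A (restr Y f)"] A(2)[of "restr Y f"] norm_restr_le[of Y f] by linarith
  have C_equi: "equivariant C"
    unfolding C_def by (rule equivariant_comp[OF equivariant_restr equivariant_comp[OF A(3) equivariant_restr]])
  have R: "symmetric_op R" "R (R f) = R f" for f
    by (simp_all add: R_def symmetric_op_restr restr_restr)
  define N' where "N' = (\<lambda>f. C (R (C f)))"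
  have N': "between_0_1 N'" "N' f \<bullet> f = (norm (R (C f)))\<^sup>2" for f
    unfolding N'_def by (rule between_0_1_sandwich[OF C C_le R])+
  define E where "E = kernel_projection N'"
  have E: "symmetric_op E" and E_norm: "E f \<bullet> f = (norm (E f))\<^sup>2" and E_le: "norm (E f) \<le> norm f" for f
    unfolding E_def by (rule kernel_projection_symmetric[OF N'(1)] kernel_projection_norm[OF N'(1)] kernel_projection_le[OF N'(1)])+
  have E_kernel: "R (C (E f)) = 0" for f
  proof -
    have "N' (E f) = 0"
      unfolding E_def by (rule kernel_projection_in_kernel[OF N'(1)])
    then show ?thesis
      using N'(2)[of "E f"] by simp
  qed
  have E_fix: "E f = f" if "R (C f) = 0" for f
    unfolding E_def by (rule kernel_projection_of_kernel) (simp add: N'_def that linear_0[OF symmetric_op_linear[OF C]])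
  have E_idem: "E (E f) = E f" for f
    by (rule E_fix) (rule E_kernel)
  have E_P: "restr Y (E f) = E (restr Y f)" for f
  proof -
    have "bounded_linear (restr Y :: ('g, 'e) l2 \<Rightarrow> _)"
      by (intro bounded_linear_intro[where K=1])
        (simp_all add: linear_add[OF symmetric_op_linear[OF symmetric_op_restr]]
          linear_scale[OF symmetric_op_linear[OF symmetric_op_restr]] norm_restr_le)
    then show ?thesis
      unfolding E_def by (rule kernel_projection_commute[OF N'(1)]) (simp add: N'_def PC)
  qed
  have E_equi: "equivariant E"
    unfolding E_def
  proof (rule equivariant_kernel_projection[OF N'(1)])
    show "equivariant N'"
      unfolding N'_def R_def by (rule equivariant_comp[OF C_equi equivariant_comp[OF equivariant_restr C_equi]])
  qed
  define M where "M = kernel_projection (\<lambda>f. C (C f))"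
  note CC = between_0_1_square[OF C C_le]
  have M: "symmetric_op M" and M_norm: "M f \<bullet> f = (norm (M f))\<^sup>2" and M_kernel: "C (M f) = 0" for f
    unfolding M_def by (rule kernel_projection_symmetric[OF CC] kernel_projection_norm[OF CC]
      kernel_square[OF C kernel_projection_in_kernel[OF CC]])+
  have M_fix: "M f = f" if "C f = 0" for f
    unfolding M_def by (rule kernel_projection_of_kernel) (simp add: that linear_0[OF symmetric_op_linear[OF C]])
  have EM: "E (M f) = M f" for f
    by (rule E_fix) (simp add: M_kernel linear_0[OF symmetric_op_linear[OF R(1)]])
  \<comment> \<open>The cut down kernel vectors are fixed by \<open>E\<close>, hence \<open>\<langle>K, u\<rangle> = \<langle>K, E u\<rangle>\<close>.\<close>
  have step1: "norm (kernel_projection (\<lambda>f. A (A f)) u) \<le> norm (E u)" if u: "restr Y u = u" for u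
  proof -
    note AA = between_0_1_square[OF A(1,2)]
    define K where "K = kernel_projection (\<lambda>f. A (A f)) u"
    have AK: "A K = 0"
      unfolding K_def by (rule kernel_square[OF A(1) kernel_projection_in_kernel[OF AA]])
    have "R (C (restr Y K)) = 0"
    proof (rule l2_eqI)
      fix x
      show "coeff (R (C (restr Y K))) x = coeff 0 x"
      proof (cases "x \<in> preimage G p (X - D)")
        case True
        then have "x \<in> Y" by (auto simp: Y_def preimage_def)
        then show ?thesis
          using local[OF True, of K] True by (simp add: R_def C_eq coeff_restr restr_restr AK coeff_zero Y_def[symmetric])
      qed (simp add: R_def coeff_restr coeff_zero)
    qed
    then have "E (restr Y K) = restr Y K" by (rule E_fix)
    then have "K \<bullet> u = E (restr Y K) \<bullet> u"
      using symmetric_opD[OF P_sym, of K u] u by simp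
    also have "\<dots> = K \<bullet> restr Y (E u)"
      by (simp add: symmetric_opD[OF E] symmetric_opD[OF P_sym])
    also have "\<dots> = K \<bullet> E u" using E_P[of u] u by simp
    also have "\<dots> \<le> norm K * norm (E u)" by (rule norm_cauchy_schwarz)
    finally have "norm K * norm K \<le> norm K * norm (E u)"
      using kernel_projection_norm[OF AA, of u] by (simp add: K_def power2_eq_square)
    then show ?thesis
      unfolding K_def[symmetric] by (cases "K = 0") auto
  qed
  define B where "B = (\<lambda>f. C (E f))"
  define B' where "B' = (\<lambda>f. E (C f))"
  have B: "adjoint_pair X B B'"
    unfolding adjoint_pair_def B_def B'_def Y_def[symmetric]
    using equivariant_comp[OF C_equi E_equi] equivariant_comp[OF E_equi C_equi]
    by (simp add: PC symmetric_opD[OF C] symmetric_opD[OF E] E_P)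
  have linB: "linear B" "linear B'"
    using linear_compose[OF symmetric_op_linear[OF E] symmetric_op_linear[OF C]]
      linear_compose[OF symmetric_op_linear[OF C] symmetric_op_linear[OF E]]
    by (simp_all add: B_def B'_def o_def)
  define N where "N = (\<lambda>f. B' (B f))"
  define W where "W = (\<lambda>f. B (B' f))"
  have N: "between_0_1 N"
  proof (rule between_0_1I[where K=B])
    show "symmetric_op N"
      unfolding N_def B_def B'_def using symmetric_op_conjugate[OF E symmetric_op_funpow[OF C, of 2]]
      by (simp add: numeral_2_eq_2)
    show "N f \<bullet> f = (norm (B f))\<^sup>2" for f
      by (simp add: N_def B_def B'_def symmetric_opD[OF C] symmetric_opD[OF E] power2_norm_eq_inner)
    show "norm (B f) \<le> norm f" for f
      unfolding B_def using C_le[of "E f"] E_le[of f] by linarith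
  qed
  have W: "between_0_1 W"
  proof (rule between_0_1I[where K=B'])
    show "symmetric_op W"
      unfolding W_def B_def B'_def E_idem by (rule symmetric_op_conjugate[OF C E])
    show "W f \<bullet> f = (norm (B' f))\<^sup>2" for f
      by (simp add: W_def B_def B'_def symmetric_opD[OF C] symmetric_opD[OF E] power2_norm_eq_inner)
    show "norm (B' f) \<le> norm f" for f
      unfolding B'_def using C_le[of f] E_le[of "C f"] by linarith
  qed
  \<comment> \<open>\<open>1 - E + M\<close> is the projection onto the kernel of \<open>N\<close>, whence the vector \<open>?v\<close> below.\<close>
  have step2: "(norm (E u))\<^sup>2 - (norm (M u))\<^sup>2 \<le> (norm u)\<^sup>2 - (norm (kernel_projection N u))\<^sup>2" for u
  proof -
    define w where "w = kernel_projection N u"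
    have "N w = 0"
      unfolding w_def by (rule kernel_projection_in_kernel[OF N])
    then have "B w \<bullet> B w = 0"
      using B unfolding adjoint_pair_def N_def by (metis inner_zero_right)
    then have CEw: "C (E w) = 0" by (simp add: B_def)
    let ?v = "M u + (u - E u)"
    have "w \<bullet> E u = M (E w) \<bullet> u"
      using M_fix[OF CEw] by (simp add: symmetric_opD[OF E])
    also have "\<dots> = w \<bullet> M u"
      using symmetric_opD[OF E, of w "M u"] by (simp add: symmetric_opD[OF M] EM)
    finally have "w \<bullet> u = w \<bullet> ?v"
      by (simp add: inner_add inner_diff)
    also have "\<dots> \<le> norm w * norm ?v" by (rule norm_cauchy_schwarz)
    finally have "norm w * norm w \<le> norm w * norm ?v"
      using kernel_projection_norm[OF N, of u] by (simp add: w_def power2_eq_square)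
    then have "norm w \<le> norm ?v" by (cases "w = 0") auto
    then have "(norm w)\<^sup>2 \<le> (norm ?v)\<^sup>2" by (intro power_mono) auto
    also have "(norm ?v)\<^sup>2 = (norm (M u))\<^sup>2 + (norm u)\<^sup>2 - (norm (E u))\<^sup>2"
    proof -
      have "M u \<bullet> E u = M u \<bullet> u"
        using symmetric_opD[OF E, of "M u" u] by (simp add: EM)
      moreover have "E u \<bullet> E u = E u \<bullet> u"
        using symmetric_opD[OF E, of "E u" u] by (simp add: E_idem)
      ultimately show ?thesis
        by (simp add: power2_norm_eq_inner inner_add inner_diff inner_commute)
    qed
    finally show ?thesis by (simp add: w_def)
  qed
  \<comment> \<open>Columns of \<open>W\<close> off \<open>D\<close> vanish because its rows do and \<open>W\<close> is symmetric.\<close>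
  have W_zero: "W (single (s x) v) = 0" if x: "x \<in> X - D" for x v
  proof -
    have "s x \<in> preimage G p (X - D)"
      using x X sect[of x] by (auto simp: preimage_def)
    then have "coeff (C (E g)) (s x) = 0" for g
      using arg_cong[OF E_kernel[of g], of "\<lambda>f. coeff f (s x)"] by (simp add: R_def coeff_restr coeff_zero)
    then have "W g \<bullet> single (s x) v = 0" for g
      by (simp add: W_def B_def B'_def inner_single)
    then have "W (single (s x) v) \<bullet> W (single (s x) v) = 0"
      using W by (simp add: between_0_1_def symmetric_opD)
    then show ?thesis by simp
  qed
  have W_trace: "ftrace X (\<lambda>f. f - ((\<lambda>f. f - W f) ^^ n) f) \<le> real (card D) * real DIM('e)" for n
  proof -
    let ?t = "\<lambda>x. \<Sum>v\<in>Basis. (single (s x) v - ((\<lambda>f. f - W f) ^^ n) (single (s x) v)) \<bullet> single (s x) (v::'e)"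
    have "?t x = 0" if "x \<in> X - D" for x
    proof -
      have "((\<lambda>f. f - W f) ^^ n) (single (s x) v) = single (s x) v" for v :: 'e
        using W_zero[OF that, of v] by (induction n) auto
      then show ?thesis by simp
    qed
    then have "ftrace X (\<lambda>f. f - ((\<lambda>f. f - W f) ^^ n) f) = (\<Sum>x\<in>D. ?t x)"
      unfolding ftrace_def using X D by (intro sum.mono_neutral_right) auto
    also have "\<dots> \<le> (\<Sum>x\<in>D. real DIM('e))"
    proof (rule sum_mono)
      fix x
      have "(single (s x) v - ((\<lambda>f. f - W f) ^^ n) (single (s x) v)) \<bullet> single (s x) v \<le> 1" if "v \<in> Basis" for v :: 'e
        using bernstein_positive[OF W, of 0 n "single (s x) v"] that
        by (simp add: inner_diff inner_single coeff_single coeff_diff inner_same_Basis)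
      then have "?t x \<le> (\<Sum>v\<in>(Basis :: 'e set). 1)" by (intro sum_mono) auto
      then show "?t x \<le> real DIM('e)" by simp
    qed
    finally show ?thesis by simp
  qed
  have "(\<lambda>n. ftrace X (\<lambda>f. f - ((\<lambda>f. f - N f) ^^ n) f)) \<longlonglongrightarrow>
      (\<Sum>x\<in>X. \<Sum>v\<in>Basis. (norm (single (s x) (v::'e)))\<^sup>2 - (norm (kernel_projection N (single (s x) v)))\<^sup>2)"
    unfolding ftrace_def inner_diff_left kernel_projection_norm[OF N, symmetric]
    unfolding power2_norm_eq_inner
    by (intro tendsto_intros kernel_projection_limit[OF N])
  then have limit: "(\<Sum>x\<in>X. \<Sum>v\<in>Basis. (norm (single (s x) (v::'e)))\<^sup>2 - (norm (kernel_projection N (single (s x) v)))\<^sup>2)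
      \<le> real (card D) * real DIM('e)"
    by (rule LIMSEQ_le_const2)
      (use W_trace ftrace_complement_power[OF X B linB] in \<open>simp add: N_def W_def\<close>)
  have "(\<Sum>x\<in>X. \<Sum>v\<in>Basis. (norm (kernel_projection (\<lambda>f. A (A f)) (single (s x) (v::'e))))\<^sup>2)
      \<le> (\<Sum>x\<in>X. \<Sum>v\<in>Basis. (norm (M (single (s x) v)))\<^sup>2
          + ((norm (single (s x) v))\<^sup>2 - (norm (kernel_projection N (single (s x) v)))\<^sup>2))"
  proof (intro sum_mono)
    fix x and v :: 'e assume x: "x \<in> X"
    let ?u = "single (s x) v"
    have "s x \<in> Y"
      using x X sect[of x] by (auto simp: Y_def preimage_def)
    then have "(norm (kernel_projection (\<lambda>f. A (A f)) ?u))\<^sup>2 \<le> (norm (E ?u))\<^sup>2"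
      by (intro power_mono step1) (auto simp: restr_single)
    then show "(norm (kernel_projection (\<lambda>f. A (A f)) ?u))\<^sup>2
        \<le> (norm (M ?u))\<^sup>2 + ((norm ?u)\<^sup>2 - (norm (kernel_projection N ?u))\<^sup>2)"
      using step2[of ?u] by linarith
  qed
  also have "\<dots> \<le> (\<Sum>x\<in>X. \<Sum>v\<in>Basis. (norm (M (single (s x) v)))\<^sup>2) + real (card D) * real DIM('e)"
    using limit by (simp add: sum.distrib)
  finally show ?thesis
    unfolding M_def .
qed

end

section \<open>Convergence of distribution functions at every point\<close>

definition positive_weights :: "real \<Rightarrow> (real measure \<times> (real \<Rightarrow> real)) list \<Rightarrow> bool" where
  "positive_weights b xs \<longleftrightarrow> (\<forall>(M, g)\<in>set xs. bounded_measure b M \<and> bounded_fun b g \<and> (\<forall>t. 0 \<le> g t))"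

lemma positive_weightsD: "positive_weights b xs \<Longrightarrow> \<forall>(M, g)\<in>set xs. bounded_measure b M \<and> bounded_fun b g"
  by (auto simp: positive_weights_def)

lemma signed_integral_mono:
  assumes "positive_weights b xs" "bounded_fun b f" "bounded_fun b h" "\<And>t. t \<in> {-b..b} \<Longrightarrow> f t \<le> h t"
  shows "signed_integral xs f \<le> signed_integral xs h"
  using assms(1)
proof (induction xs)
  case (Cons x xs)
  obtain M g where x: "x = (M, g)" by (cases x)
  then have M: "bounded_measure b M" and g: "bounded_fun b g" "\<And>t. 0 \<le> g t" and xs: "positive_weights b xs"
    using Cons.prems by (auto simp: positive_weights_def)
  have "(\<integral>t. f t * g t \<partial>M) \<le> (\<integral>t. h t * g t \<partial>M)"
  proof (rule integral_mono_AE)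
    show "integrable M (\<lambda>t. f t * g t)" "integrable M (\<lambda>t. h t * g t)"
      using bounded_integrable[OF M bounded_fun_intros(6)] assms g by auto
    have "AE t in M. t \<in> {-b..b}" using M by (simp add: bounded_measure_def)
    then show "AE t in M. f t * g t \<le> h t * g t"
      by eventually_elim (rule mult_right_mono[OF assms(4) g(2)])
  qed
  then show ?case
    using Cons.IH[OF xs] by (simp add: x signed_integral_def)
qed (simp add: signed_integral_def)

lemma signed_integral_diff:
  assumes "positive_weights b xs" "bounded_fun b f" "bounded_fun b h"
  shows "signed_integral xs (\<lambda>t. f t - h t) = signed_integral xs f - signed_integral xs h"
  using signed_integral_linear(1)[OF positive_weightsD[OF assms(1)] bounded_fun_intros(5)[OF assms(2,3)] assms(3)]
  by simp

lemma signed_integral_close: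
  assumes xs: "positive_weights b xs" and f: "bounded_fun b f" "bounded_fun b h"
    and close: "\<And>t. t \<in> {-b..b} \<Longrightarrow> \<bar>f t - h t\<bar> \<le> e"
  shows "\<bar>signed_integral xs f - signed_integral xs h\<bar> \<le> e * signed_integral xs (\<lambda>t. 1)"
proof -
  have e: "signed_integral xs (\<lambda>t. c * 1) = c * signed_integral xs (\<lambda>t. 1)" for c
    by (rule signed_integral_linear(2)[OF positive_weightsD[OF xs]]) (rule bounded_fun_intros)+
  have two_sided: "f t - h t \<le> e * 1" "(-e) * 1 \<le> f t - h t" if "t \<in> {-b..b}" for t
    using close[OF that] by (simp_all add: abs_le_iff)
  have "signed_integral xs (\<lambda>t. f t - h t) \<le> signed_integral xs (\<lambda>t. e * 1)"
    by (intro signed_integral_mono[OF xs] bounded_fun_intros f two_sided)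
  moreover have "signed_integral xs (\<lambda>t. (-e) * 1) \<le> signed_integral xs (\<lambda>t. f t - h t)"
    by (intro signed_integral_mono[OF xs] bounded_fun_intros f two_sided)
  ultimately show ?thesis
    unfolding e signed_integral_diff[OF xs f] by (simp add: abs_le_iff)
qed

text \<open>Weierstrass approximation, with the total masses under control because they are the zeroth moments.\<close>

lemma continuous_integrals_converge:
  assumes xs: "\<And>m. positive_weights b (xs m)" and ys: "positive_weights b ys"
    and moments: "\<And>j. (\<lambda>m. signed_integral (xs m) (\<lambda>t. t ^ j)) \<longlonglongrightarrow> signed_integral ys (\<lambda>t. t ^ j)"
    and f: "continuous_on UNIV f"
  shows "(\<lambda>m. signed_integral (xs m) f) \<longlonglongrightarrow> signed_integral ys f"
proof (rule LIMSEQ_I)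
  fix e :: real assume e: "e > 0"
  let ?one = "\<lambda>t::real. 1 :: real"
  have one: "(\<lambda>m. signed_integral (xs m) ?one) \<longlonglongrightarrow> signed_integral ys ?one"
    using moments[of 0] by simp
  define K where "K = signed_integral ys ?one + 1"
  have "signed_integral ys (\<lambda>t. 0) \<le> signed_integral ys ?one"
    by (rule signed_integral_mono[OF ys]) (auto intro: bounded_fun_intros)
  moreover have "signed_integral ys (\<lambda>t. 0) = 0"
    using signed_integral_linear(2)[OF positive_weightsD[OF ys] bounded_fun_intros(1)[of b 0] bounded_fun_intros(1)[of b 0], of 0] by simp
  ultimately have K: "K > 0" "signed_integral ys ?one \<le> K"
    by (auto simp: K_def)
  have bound: "\<forall>\<^sub>F m in sequentially. signed_integral (xs m) ?one < K"
    using order_tendstoD(2)[OF one, of K] by (simp add: K_def)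
  define d where "d = e / (4 * K)"
  have d: "d > 0" using e K by (simp add: d_def)
  obtain p where p: "real_polynomial_function p" "\<And>t. t \<in> {-b..b} \<Longrightarrow> \<bar>f t - p t\<bar> < d"
    using Stone_Weierstrass_real_polynomial_function[OF _ continuous_on_subset[OF f subset_UNIV] d, of "{-b..b}"] by blast
  obtain a N where pn: "p = (\<lambda>t. \<Sum>i\<le>N. a i * t ^ i)"
    using p(1) real_polynomial_function_iff_sum by blast
  have p_sum: "signed_integral zs p = (\<Sum>i\<le>N. a i * signed_integral zs (\<lambda>t. t ^ i))" if "positive_weights b zs" for zs
  proof -
    note zs = positive_weightsD[OF that]
    have "signed_integral zs p = (\<Sum>i\<le>N. signed_integral zs (\<lambda>t. a i * t ^ i))"
      unfolding pn by (intro signed_integral_sum[OF zs]) (auto intro: bounded_fun_intros bounded_fun_monom)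
    then show ?thesis
      by (simp add: signed_integral_linear(2)[OF zs bounded_fun_monom bounded_fun_monom])
  qed
  have "(\<lambda>m. signed_integral (xs m) p) \<longlonglongrightarrow> signed_integral ys p"
    unfolding p_sum[OF xs] p_sum[OF ys] by (intro tendsto_intros moments)
  from tendstoD[OF this, of "e / 2"]
  have lim: "\<forall>\<^sub>F m in sequentially. \<bar>signed_integral (xs m) p - signed_integral ys p\<bar> < e / 2"
    using e by (simp add: dist_real_def)
  have "continuous_on UNIV p"
    unfolding pn by (intro continuous_intros)
  note bf = bounded_fun_continuous[OF f] bounded_fun_continuous[OF this]
  have close: "\<bar>signed_integral zs f - signed_integral zs p\<bar> \<le> e / 4"
    if zs: "positive_weights b zs" "signed_integral zs ?one \<le> K" for zs
  proof -
    have "\<bar>signed_integral zs f - signed_integral zs p\<bar> \<le> d * signed_integral zs ?one"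
      using p(2) less_imp_le by (intro signed_integral_close[OF zs(1) bf]) blast
    also have "\<dots> \<le> d * K"
      using d zs(2) by (intro mult_left_mono) auto
    finally show ?thesis using K by (simp add: d_def)
  qed
  have "\<forall>\<^sub>F m in sequentially. norm (signed_integral (xs m) f - signed_integral ys f) < e"
    using bound lim
  proof eventually_elim
    case (elim m)
    have "\<bar>signed_integral (xs m) f - signed_integral (xs m) p\<bar> \<le> e / 4" "\<bar>signed_integral ys f - signed_integral ys p\<bar> \<le> e / 4"
      using close[OF xs] close[OF ys K(2)] elim(1) by auto
    then show ?case using elim(2) unfolding real_norm_def by linarith
  qed
  then show "\<exists>no. \<forall>n\<ge>no. norm (signed_integral (xs n) f - signed_integral ys f) < e"
    by (simp add: eventually_sequentially)
qed

text \<open>Continuous functions that decrease to the indicator of \<open>{..t}\<close> bound the limit from above.  Below,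
  functions that increase to the indicator of \<open>{..<t}\<close> only see the open half-line; the missing mass at \<open>t\<close>
  is supplied by the assumption on atoms.\<close>

theorem distribution_functions_converge:
  assumes xs: "\<And>m. positive_weights b (xs m)" and ys: "positive_weights b ys"
    and moments: "\<And>j. (\<lambda>m. signed_integral (xs m) (\<lambda>t. t ^ j)) \<longlonglongrightarrow> signed_integral ys (\<lambda>t. t ^ j)"
    and atom: "\<And>m. signed_integral ys (indicator {t}) \<le> signed_integral (xs m) (indicator {t}) + \<epsilon> m"
    and \<epsilon>: "\<epsilon> \<longlonglongrightarrow> 0"
  shows "(\<lambda>m. signed_integral (xs m) (indicator {..t})) \<longlonglongrightarrow> signed_integral ys (indicator {..t})"
proof -
  let ?F = "\<lambda>m. signed_integral (xs m) (indicator {..t})"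
  let ?L = "signed_integral ys (indicator {..t})"
  \<comment> \<open>The reflected ramp, which increases to the indicator of \<open>{..<t}\<close>.\<close>
  define h where "h n x = 1 - ramp n (-t) (-x)" for n x
  have cont: "continuous_on UNIV (ramp n t)" "continuous_on UNIV (h n)" for n
    unfolding h_def by (intro continuous_intros continuous_on_ramp continuous_on_compose2[OF continuous_on_ramp[of UNIV]]; simp)+
  have h_le: "h n x + indicator {t} x \<le> indicator {..t} x" for n x
    by (cases "x = t"; cases "x \<le> t") (auto simp: h_def ramp_def mult_le_0_iff)
  have ramp_ge: "indicator {..t} x \<le> ramp n t x" for n x
    using ramp_bounds[of n t x] by (auto simp: indicator_def ramp_def mult_le_0_iff)
  have ind: "bounded_fun b (indicator {..t})" "bounded_fun b (indicator {t})"
    by (intro bounded_fun_intros; simp)+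
  have h_lim: "(\<lambda>n. h n x) \<longlonglongrightarrow> indicator {..<t} x" for x
  proof -
    have "(indicator {..<t} x :: real) = 1 - indicator {..-t} (-x)"
      by (auto simp: indicator_def)
    then show ?thesis
      unfolding h_def using tendsto_diff[OF tendsto_const ramp_tendsto_indicator] by metis
  qed
  have upper: "\<forall>\<^sub>F m in sequentially. ?F m < ?L + e" if "e > 0" for e
  proof -
    have "(\<lambda>n. signed_integral ys (ramp n t)) \<longlonglongrightarrow> ?L"
    proof (rule signed_integral_limit[OF positive_weightsD[OF ys], where B=1])
      show "\<bar>ramp n t x\<bar> \<le> 1" for n x
        using ramp_bounds[of n t x] by simp
    qed (auto intro: ramp_tendsto_indicator borel_measurable_continuous_onI continuous_on_ramp)
    then have "\<forall>\<^sub>F n in sequentially. signed_integral ys (ramp n t) < ?L + e"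
      by (rule order_tendstoD(2)) (use that in simp)
    then obtain n where n: "signed_integral ys (ramp n t) < ?L + e"
      by (auto simp: eventually_sequentially)
    have "\<forall>\<^sub>F m in sequentially. signed_integral (xs m) (ramp n t) < ?L + e"
      using order_tendstoD(2)[OF continuous_integrals_converge[OF xs ys moments cont(1)] n] .
    then show ?thesis
    proof eventually_elim
      case (elim m)
      have "?F m \<le> signed_integral (xs m) (ramp n t)"
        using ramp_ge by (intro signed_integral_mono[OF xs] ind bounded_fun_continuous cont) auto
      then show ?case using elim by simp
    qed
  qed
  have lower: "\<forall>\<^sub>F m in sequentially. ?L - e < ?F m" if e: "e > 0" for e
  proof -
    have split: "?L = signed_integral ys (indicator {..<t}) + signed_integral ys (indicator {t})"
    proof -
      have "(indicator {..t} :: real \<Rightarrow> real) = (\<lambda>x. indicator {..<t} x + indicator {t} x)"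
        by (auto simp: indicator_def)
      then show ?thesis
        using signed_integral_linear(1)[OF positive_weightsD[OF ys] _ ind(2), of "indicator {..<t}"]
        by (simp add: bounded_fun_intros)
    qed
    have "(\<lambda>n. signed_integral ys (h n)) \<longlonglongrightarrow> signed_integral ys (indicator {..<t})"
    proof (rule signed_integral_limit[OF positive_weightsD[OF ys], where B=1])
      show "\<bar>h n x\<bar> \<le> 1" for n x
        using ramp_bounds[of n "-t" "-x"] by (simp add: h_def)
    qed (auto intro: h_lim borel_measurable_continuous_onI cont)
    then have "\<forall>\<^sub>F n in sequentially. signed_integral ys (indicator {..<t}) - e / 2 < signed_integral ys (h n)"
      by (rule order_tendstoD(1)) (use e in simp)
    then obtain n where n: "signed_integral ys (indicator {..<t}) - e / 2 < signed_integral ys (h n)"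
      by (auto simp: eventually_sequentially)
    have "\<forall>\<^sub>F m in sequentially. signed_integral ys (indicator {..<t}) - e / 2 < signed_integral (xs m) (h n)"
      using order_tendstoD(1)[OF continuous_integrals_converge[OF xs ys moments cont(2)] n] .
    moreover have "\<forall>\<^sub>F m in sequentially. \<epsilon> m < e / 2"
      using order_tendstoD(2)[OF \<epsilon>, of "e / 2"] e by simp
    ultimately show ?thesis
    proof eventually_elim
      case (elim m)
      have "signed_integral (xs m) (h n) + signed_integral (xs m) (indicator {t})
          = signed_integral (xs m) (\<lambda>x. h n x + indicator {t} x)"
        by (rule signed_integral_linear(1)[OF positive_weightsD[OF xs], symmetric]) (intro ind bounded_fun_continuous cont)+
      also have "\<dots> \<le> ?F m"
        using h_le by (intro signed_integral_mono[OF xs] ind bounded_fun_intros(4) bounded_fun_continuous cont) auto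
      finally show ?case
        using elim atom[of m] split by linarith
    qed
  qed
  show ?thesis
    by (rule order_tendstoI) (use upper[of "_ - ?L"] lower[of "?L - _"] in \<open>auto simp: algebra_simps\<close>)
qed

section \<open>Complex operators and their real counterparts\<close>

lemma norm_vector_scalar_mult: "norm (c *s v) = cmod c * norm v" for v :: "complex ^ 'd"
  by (simp add: norm_vec_def norm_mult L2_set_right_distrib)

lemma inner_complex_vec: "v \<bullet> w = Re (\<Sum>a\<in>UNIV. v $ a * cnj (w $ a))" for v w :: "complex ^ 'd"
  by (simp add: inner_vec_def inner_complex_def)

definition cscale :: "complex \<Rightarrow> ('g, complex ^ 'd) l2 \<Rightarrow> ('g, complex ^ 'd) l2" where
  "cscale c f = l2_of (\<lambda>x. c *s coeff f x)"

lemma coeff_cscale: "coeff (cscale c f) x = c *s coeff f x"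
proof -
  have "(\<lambda>x. (norm (c *s coeff f x))\<^sup>2) summable_on UNIV"
    using summable_on_cmult_right[OF coeff_summable[of f UNIV], of "(cmod c)\<^sup>2"]
    by (simp add: norm_vector_scalar_mult power_mult_distrib)
  then show ?thesis by (simp add: cscale_def coeff_l2_of)
qed

lemma vec_scaleR: "r *\<^sub>R v = complex_of_real r *s v" for v :: "complex ^ 'd"
  by (simp add: vec_eq_iff scaleR_conv_of_real[where 'a=complex])

lemma cscale_decompose: "cscale c f = Re c *\<^sub>R f + Im c *\<^sub>R cscale \<i> f"
proof (rule l2_eqI)
  fix x
  have "c * z = complex_of_real (Re c) * z + complex_of_real (Im c) * (\<i> * z)" for z
    by (simp add: complex_eq_iff algebra_simps)
  then show "coeff (cscale c f) x = coeff (Re c *\<^sub>R f + Im c *\<^sub>R cscale \<i> f) x"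
    by (simp add: coeff_cscale coeff_add coeff_scaleR vec_scaleR vec_eq_iff)
qed

lemma inner_cscale_i: "cscale \<i> f \<bullet> cscale \<i> g = f \<bullet> g" for f g :: "('g, complex ^ 'd) l2"
proof -
  have "(\<i> *s v) \<bullet> (\<i> *s w) = v \<bullet> w" for v w :: "complex ^ 'd"
    by (simp add: inner_complex_vec mult.assoc mult.left_commute)
  then show ?thesis by (simp add: inner_l2_def coeff_cscale)
qed

lemma cscale_i_i: "cscale \<i> (cscale \<i> f) = - f"
  by (rule l2_eqI) (simp add: coeff_cscale coeff_uminus vec_eq_iff)

lemma linear_cscale: "linear (cscale c)"
proof (rule linearI)
  show "cscale c (f + g) = cscale c f + cscale c g" for f g :: "('a, complex ^ 'b) l2"
    by (rule l2_eqI) (simp add: coeff_cscale coeff_add vector_add_ldistrib)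
  show "cscale c (r *\<^sub>R f) = r *\<^sub>R cscale c f" for r and f :: "('a, complex ^ 'b) l2"
    by (rule l2_eqI) (simp add: coeff_cscale coeff_scaleR vec_scaleR vec_eq_iff mult.left_commute)
qed

lemma inner_cscale_swap: "cscale \<i> f \<bullet> g = - (f \<bullet> cscale \<i> g)"
  using inner_cscale_i[of f "cscale \<i> g"] by (simp add: cscale_i_i)

text \<open>The complex inner product in terms of the real one and multiplication by \<open>\<i>\<close>.\<close>

lemma ip_coeff: "ip (coeff f) (coeff g) = Complex (f \<bullet> g) (f \<bullet> cscale \<i> g)"
proof -
  let ?h = "\<lambda>x. \<Sum>a\<in>UNIV. coeff f x $ a * cnj (coeff g x $ a)"
  have re: "Re (?h x) = coeff f x \<bullet> coeff g x" for x
    by (simp add: inner_complex_vec)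
  have im: "Im (?h x) = coeff f x \<bullet> coeff (cscale \<i> g) x" for x
    by (simp add: inner_complex_vec coeff_cscale sum_subtractf algebra_simps)
  have "((\<lambda>x. complex_of_real (Re (?h x)) + \<i> * complex_of_real (Im (?h x))) has_sum
      (complex_of_real (f \<bullet> g) + \<i> * complex_of_real (f \<bullet> cscale \<i> g))) UNIV"
    unfolding re im inner_l2_def
    by (intro has_sum_add has_sum_cmult_right has_sum_of_real has_sum_infsum inner_summable)
  then have "(?h has_sum Complex (f \<bullet> g) (f \<bullet> cscale \<i> g)) UNIV"
    unfolding Complex_eq by (simp only: complex_eq[symmetric])
  then show ?thesis
    unfolding ip_def by (rule infsumI)
qed

lemma l2norm_coeff: "l2norm (coeff f) = norm f"
  by (simp add: l2norm_def l2_norm_square[symmetric])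

lemma ell2_iff: "f \<in> ell2 Y \<longleftrightarrow> (\<exists>u. f = coeff u \<and> restr Y u = u)"
proof
  assume f: "f \<in> ell2 Y"
  then have "coeff (l2_of f) = f" by (simp add: ell2_def coeff_l2_of)
  moreover have "restr Y (l2_of f) = l2_of f"
    using f by (intro l2_eqI) (simp add: coeff_restr calculation ell2_def)
  ultimately show "\<exists>u. f = coeff u \<and> restr Y u = u" by metis
next
  assume "\<exists>u. f = coeff u \<and> restr Y u = u"
  then obtain u where u: "f = coeff u" "restr Y u = u" by blast
  have "coeff u x = 0" if "x \<notin> Y" for x
    using arg_cong[OF u(2), of "\<lambda>f. coeff f x"] that by (simp add: coeff_restr)
  then show "f \<in> ell2 Y"
    using coeff_summable[of u UNIV] u by (simp add: ell2_def)
qed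

lemma coeff_in_ell2: "restr Y u = u \<Longrightarrow> coeff u \<in> ell2 Y"
  by (auto simp: ell2_iff)

lemma l2_of_coeff: "l2_of (coeff u) = u"
  by (rule coeff_inverse)

lemma coeff_l2_of_ell2: "f \<in> ell2 Y \<Longrightarrow> coeff (l2_of f) = f \<and> restr Y (l2_of f) = l2_of f"
  by (auto simp: ell2_iff l2_of_coeff)

lemma restr_cscale: "restr Y (cscale c u) = cscale c (restr Y u)"
  by (rule l2_eqI) (simp add: coeff_restr coeff_cscale)

text \<open>A symmetric operator for the real inner product that commutes with \<open>\<i>\<close> is complex linear and self-adjoint.\<close>

lemma orth_projection_of_l2:
  assumes sym: "symmetric_op (Z :: ('g, complex ^ 'd) l2 \<Rightarrow> ('g, complex ^ 'd) l2)" and idem: "\<And>u. Z (Z u) = Z u"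
    and J: "\<And>u. Z (cscale \<i> u) = cscale \<i> (Z u)" and supp: "\<And>u. restr Y u = u \<Longrightarrow> restr Y (Z u) = Z u"
  shows "orth_projection Y (\<lambda>f. coeff (Z (l2_of f)))"
proof -
  note lin = symmetric_op_linear[OF sym]
  have Zc: "Z (cscale c u) = cscale c (Z u)" for c u
    unfolding cscale_decompose[of c] by (simp add: linear_add[OF lin] linear_scale[OF lin] J)
  have "bounded_op Y (\<lambda>f. coeff (Z (l2_of f)))"
    unfolding bounded_op_def
  proof (intro conjI ballI allI exI)
    fix f h :: "'g \<Rightarrow> complex ^ 'd" and c assume "f \<in> ell2 Y"
    then obtain u where u: "f = coeff u" "restr Y u = u" by (auto simp: ell2_iff)
    show "coeff (Z (l2_of f)) \<in> ell2 Y"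
      using supp[OF u(2)] by (simp add: u(1) l2_of_coeff coeff_in_ell2)
    show "l2norm (coeff (Z (l2_of f))) \<le> 1 * l2norm f"
      using symmetric_idempotent_norm_le[OF sym idem] by (simp add: u(1) l2_of_coeff l2norm_coeff)
    have scaled: "(\<lambda>x. c *s f x) = coeff (cscale c u)"
      by (simp add: u(1) coeff_cscale fun_eq_iff)
    show "coeff (Z (l2_of (\<lambda>x. c *s f x))) = (\<lambda>x. c *s coeff (Z (l2_of f)) x)"
      unfolding scaled l2_of_coeff Zc by (simp add: u(1) l2_of_coeff coeff_cscale fun_eq_iff)
    assume "h \<in> ell2 Y"
    then obtain v where v: "h = coeff v" by (auto simp: ell2_iff)
    have added: "(\<lambda>x. f x + h x) = coeff (u + v)"
      by (simp add: u(1) v coeff_add fun_eq_iff)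
    show "coeff (Z (l2_of (\<lambda>x. f x + h x))) = (\<lambda>x. coeff (Z (l2_of f)) x + coeff (Z (l2_of h)) x)"
      unfolding added l2_of_coeff linear_add[OF lin] by (simp add: u(1) v l2_of_coeff coeff_add fun_eq_iff)
  qed
  moreover have "self_adjoint_op Y (\<lambda>f. coeff (Z (l2_of f)))"
    unfolding self_adjoint_op_def
    by (auto simp: ell2_iff l2_of_coeff ip_coeff symmetric_opD[OF sym] J)
  ultimately show ?thesis
    by (auto simp: orth_projection_def ell2_iff l2_of_coeff idem)
qed

text \<open>The converse passage.  An operator on \<open>ell2 Y\<close> has meaningful values only there, so it is precomposed with
  the projection.\<close>

definition lift_op :: "'g set \<Rightarrow> (('g \<Rightarrow> complex ^ 'd) \<Rightarrow> ('g \<Rightarrow> complex ^ 'd)) \<Rightarrow> ('g, complex ^ 'd) l2 \<Rightarrow> ('g, complex ^ 'd) l2" where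
  "lift_op Y B u = l2_of (B (coeff (restr Y u)))"

lemma lift_op:
  assumes "orth_projection Y B"
  shows coeff_lift_op: "\<And>u. coeff (lift_op Y B u) = B (coeff (restr Y u))"
    and restr_lift_op: "\<And>u. restr Y (lift_op Y B u) = lift_op Y B u"
    and symmetric_lift_op: "symmetric_op (lift_op Y B)"
proof -
  have B: "bounded_op Y B" "self_adjoint_op Y B" using assms by (auto simp: orth_projection_def)
  have mem: "coeff (restr Y u) \<in> ell2 Y" for u :: "('a, complex ^ 'b) l2"
    by (rule coeff_in_ell2) (simp add: restr_restr)
  then have mem': "B (coeff (restr Y u)) \<in> ell2 Y" for u
    using B by (auto simp: bounded_op_def)
  show coeff: "coeff (lift_op Y B u) = B (coeff (restr Y u))" and supp: "restr Y (lift_op Y B u) = lift_op Y B u" for u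
    using coeff_l2_of_ell2[OF mem', of u] by (simp_all add: lift_op_def)
  note lin = symmetric_op_linear[OF symmetric_op_restr]
  show "symmetric_op (lift_op Y B)"
    unfolding symmetric_op_def
  proof (intro conjI allI linearI l2_eqI)
    fix u v :: "('a, complex ^ 'b) l2" and r :: real and x
    have "coeff (restr Y (u + v)) = (\<lambda>x. coeff (restr Y u) x + coeff (restr Y v) x)"
      by (simp add: linear_add[OF lin] coeff_add fun_eq_iff)
    then show "coeff (lift_op Y B (u + v)) x = coeff (lift_op Y B u + lift_op Y B v) x"
      using B(1) mem by (simp add: coeff coeff_add bounded_op_def)
    have "coeff (restr Y (r *\<^sub>R u)) = (\<lambda>x. complex_of_real r *s coeff (restr Y u) x)"
      by (simp add: linear_scale[OF lin] coeff_scaleR vec_scaleR fun_eq_iff)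
    then show "coeff (lift_op Y B (r *\<^sub>R u)) x = coeff (r *\<^sub>R lift_op Y B u) x"
      using B(1) mem by (simp add: coeff coeff_scaleR vec_scaleR bounded_op_def)
    have "ip (B (coeff (restr Y u))) (coeff (restr Y v)) = ip (coeff (restr Y u)) (B (coeff (restr Y v)))"
      using B(2) mem by (simp add: self_adjoint_op_def)
    then have "lift_op Y B u \<bullet> restr Y v = restr Y u \<bullet> lift_op Y B v"
      unfolding coeff[symmetric] ip_coeff by simp
    then show "lift_op Y B u \<bullet> v = u \<bullet> lift_op Y B v"
      using symmetric_opD[OF symmetric_op_restr, of Y "lift_op Y B u" v] symmetric_opD[OF symmetric_op_restr, of Y u "lift_op Y B v"]
      by (simp add: supp)
  qed
qed

section \<open>The Borel functional calculus computes spectral measures\<close>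

lemma scalar_measure_eq:
  assumes "\<And>S. S \<in> sets borel \<Longrightarrow> Re (ip (E S f) f) = measure M S" and M: "finite_measure M" "sets M = sets borel"
  shows "scalar_measure E f = M"
proof -
  have UNIV: "space M = UNIV" using sets_eq_imp_space_eq[OF M(2)] by simp
  have "scalar_measure E f = measure_of UNIV (sets borel) (emeasure M)"
    unfolding scalar_measure_def
  proof (rule measure_of_eq)
    fix S assume "S \<in> sigma_sets UNIV (sets (borel :: real measure))"
    then have "S \<in> sets borel"
      using sets.sigma_sets_eq[of "borel :: real measure"] by simp
    then show "ennreal (Re (ip (E S f) f)) = emeasure M S"
      using assms(1) by (simp add: finite_measure.emeasure_eq_measure[OF M(1)])
  qed simp
  also have "\<dots> = M"
    using measure_of_of_measure[of M] by (simp add: UNIV M(2))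
  finally show ?thesis .
qed

lemma measure_of_sums:
  assumes nonneg: "\<And>S. S \<in> sets borel \<Longrightarrow> 0 \<le> m S"
    and sums: "\<And>S :: nat \<Rightarrow> real set. range S \<subseteq> sets borel \<Longrightarrow> disjoint_family S \<Longrightarrow> (\<lambda>n. m (S n)) sums m (\<Union>n. S n)"
  shows "finite_measure (measure_of UNIV (sets (borel :: real measure)) (\<lambda>S. ennreal (m S)))"
    and "\<And>S. S \<in> sets borel \<Longrightarrow> measure (measure_of UNIV (sets borel) (\<lambda>S. ennreal (m S))) S = m S"
proof -
  let ?M = "measure_of UNIV (sets (borel :: real measure)) (\<lambda>S. ennreal (m S))"
  have sigma: "sigma_algebra UNIV (sets (borel :: real measure))"
    using sets.sigma_algebra_axioms[of "borel :: real measure"] by simp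
  have empty: "m {} = 0"
    using sums[of "\<lambda>n. {}"] sums_unique2[of "\<lambda>n. m {}"] summable_const_iff[of "m {}"] sums_summable by (force simp: disjoint_family_on_def)
  have em: "emeasure ?M S = ennreal (m S)" if S: "S \<in> sets borel" for S
  proof (rule emeasure_measure_of_sigma[OF sigma _ _ S])
    show "positive (sets borel) (\<lambda>S. ennreal (m S))"
      by (simp add: positive_def empty)
    show "countably_additive (sets borel) (\<lambda>S. ennreal (m S))"
    proof (rule countably_additiveI)
      fix S :: "nat \<Rightarrow> real set"
      assume S: "range S \<subseteq> sets borel" "disjoint_family S"
      then have "m (S i) \<ge> 0" for i using nonneg by auto
      then show "(\<Sum>i. ennreal (m (S i))) = ennreal (m (\<Union>i. S i))"
        using sums[OF S] by (intro suminf_ennreal_eq) auto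
    qed
  qed
  show "finite_measure ?M"
    by (rule finite_measureI) (simp add: em)
  show "measure ?M S = m S" if "S \<in> sets borel" for S
    using nonneg[OF that] by (simp add: measure_def em[OF that])
qed

text \<open>A bounded self-adjoint complex linear operator \<open>Z\<close> on the subspace \<open>ell2 Y\<close>, extended by zero.\<close>

locale complex_operator =
  fixes Y :: "'g set" and Z :: "('g, complex ^ 'd) l2 \<Rightarrow> ('g, complex ^ 'd) l2" and b :: real
  assumes sym_Z: "symmetric_op Z" and b: "b > 0" and Z_le: "\<And>u. norm (Z u) \<le> b * norm u"
    and restr_Z: "\<And>u. restr Y (Z u) = Z u" and Z_restr: "\<And>u. Z (restr Y u) = Z u"
    and Z_i: "\<And>u. Z (cscale \<i> u) = cscale \<i> (Z u)"
begin

lemma spectral_measure_ex: "\<exists>M. is_spectral_measure Z b u M"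
proof (rule spectral_measure_exists[OF sym_Z b])
  fix u
  have "\<bar>Z u \<bullet> u\<bar> \<le> norm (Z u) * norm u" by (rule Cauchy_Schwarz_ineq2)
  also have "\<dots> \<le> (b * norm u) * norm u" by (intro mult_right_mono Z_le) simp
  finally show "\<bar>Z u \<bullet> u\<bar> \<le> b * (u \<bullet> u)"
    by (simp add: power2_norm_eq_inner[symmetric] power2_eq_square)
qed

definition smeas :: "('g, complex ^ 'd) l2 \<Rightarrow> real measure" where
  "smeas u = (SOME M. is_spectral_measure Z b u M)"

lemma smeas: "is_spectral_measure Z b u (smeas u)"
  unfolding smeas_def using spectral_measure_ex by (rule someI_ex)

sublocale spectral_measures Z b smeas
  by standard (rule sym_Z smeas)+

lemma proj_commute:
  assumes S: "S \<in> sets borel" and lin: "linear J" and iso: "\<And>u v. J u \<bullet> J v = u \<bullet> v"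
    and comm: "\<And>u. J (Z u) = Z (J u)" and surj: "\<And>u. J (J' u) = u"
  shows "proj S (J u) = J (proj S u)"
proof (rule eq_by_inner)
  fix v
  have "proj S (J u) \<bullet> v = proj S u \<bullet> J' v"
    using proj_isometry[OF lin iso comm S, of u "J' v"] by (simp add: surj)
  also have "\<dots> = J (proj S u) \<bullet> v"
    using iso[of "proj S u" "J' v"] by (simp add: surj)
  finally show "proj S (J u) \<bullet> v = J (proj S u) \<bullet> v" .
qed

lemma proj_cscale: "S \<in> sets borel \<Longrightarrow> proj S (cscale \<i> u) = cscale \<i> (proj S u)"
proof (rule proj_commute[where J'="\<lambda>u. - cscale \<i> u"])
  show "cscale \<i> (- cscale \<i> u) = u" for u
    by (simp add: linear_neg[OF linear_cscale] cscale_i_i)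
qed (simp_all add: linear_cscale inner_cscale_i Z_i)

text \<open>The reflection \<open>2 P - 1\<close> in the subspace of functions on \<open>Y\<close> is an isometry that commutes with \<open>Z\<close>.\<close>

lemma proj_restr:
  assumes S: "S \<in> sets borel"
  shows "proj S (restr Y u) = restr Y (proj S u)"
proof -
  define V where "V = (\<lambda>u. 2 *\<^sub>R restr Y u - u :: ('g, complex ^ 'd) l2)"
  note P = symmetric_op_restr[of Y] and lin = symmetric_op_linear[OF symmetric_op_restr]
  have "symmetric_op V"
    unfolding V_def by (intro symmetric_op_diff symmetric_op_scale P symmetric_op_id)
  have VV: "V (V u) = u" for u
    by (simp add: V_def linear_diff[OF lin] linear_add[OF lin] restr_restr scaleR_2)
  have "proj S (V u) = V (proj S u)"
  proof (rule proj_commute[OF S, where J'=V])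
    show "linear V" by (rule symmetric_op_linear) fact
    show "V u \<bullet> V v = u \<bullet> v" for u v
      using symmetric_opD[OF \<open>symmetric_op V\<close>, of u "V v"] by (simp add: VV)
    show "V (Z u) = Z (V u)" for u
      by (simp add: V_def restr_Z Z_restr linear_diff[OF symmetric_op_linear[OF sym_Z]]
          linear_scale[OF symmetric_op_linear[OF sym_Z]])
  qed (rule VV)
  then have "2 *\<^sub>R proj S (restr Y u) = 2 *\<^sub>R restr Y (proj S u)"
    using proj_symmetric[OF S]
    by (simp add: V_def linear_diff[OF symmetric_op_linear] linear_scale[OF symmetric_op_linear])
  then show ?thesis by simp
qed

lemma ip_proj: "S \<in> sets borel \<Longrightarrow> ip (coeff (proj S u)) (coeff u) = complex_of_real (proj S u \<bullet> u)"
proof -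
  assume S: "S \<in> sets borel"
  have "proj S u \<bullet> cscale \<i> u = - (cscale \<i> u \<bullet> proj S u)"
    using symmetric_opD[OF proj_symmetric[OF S], of u "cscale \<i> u"] inner_cscale_swap[of u "proj S u"]
    by (simp add: proj_cscale[OF S])
  then have "proj S u \<bullet> cscale \<i> u = 0" by (simp add: inner_commute)
  then show ?thesis by (simp add: ip_coeff complex_of_real_def)
qed

lemma spectral_resolution_ex:
  assumes T: "\<And>u. restr Y u = u \<Longrightarrow> T (coeff u) = coeff (Z u)"
  shows "\<exists>E. spectral_resolution Y T E"
proof (rule exI)
  let ?E = "\<lambda>S f. coeff (proj S (l2_of f))"
  show "spectral_resolution Y T ?E"
    unfolding spectral_resolution_def
  proof (intro conjI ballI allI impI)
    fix S :: "real set" assume S: "S \<in> sets borel"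
    show "orth_projection Y (?E S)"
    proof (rule orth_projection_of_l2[OF proj_symmetric[OF S]])
      show "proj S (proj S u) = proj S u" for u using proj_Int[OF S S, of u] by simp
      show "proj S (cscale \<i> u) = cscale \<i> (proj S u)" for u by (rule proj_cscale[OF S])
      show "restr Y u = u \<Longrightarrow> restr Y (proj S u) = proj S u" for u using proj_restr[OF S, of u] by simp
    qed
    fix S' :: "real set" and f :: "'g \<Rightarrow> complex ^ 'd" assume S': "S' \<in> sets borel"
    show "?E (S \<inter> S') f = ?E S (?E S' f)"
      by (simp add: l2_of_coeff proj_Int[OF S S'])
  next
    fix f :: "'g \<Rightarrow> complex ^ 'd" assume "f \<in> ell2 Y"
    then obtain u where u: "f = coeff u" "restr Y u = u" by (auto simp: ell2_iff)
    show "?E UNIV f = f" by (simp add: u l2_of_coeff proj_UNIV)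
    show "ip (T f) f = complex_of_real (\<integral>t. t \<partial>scalar_measure ?E f)"
    proof -
      have "scalar_measure ?E f = smeas u"
        by (rule scalar_measure_eq[OF _ finite_\<mu> sets_\<mu>]) (simp add: u l2_of_coeff ip_proj proj_inner_self)
      moreover have "(\<integral>t. t \<partial>smeas u) = Z u \<bullet> u" using moment[of u 1] by simp
      moreover have "Z u \<bullet> cscale \<i> u = 0"
        using symmetric_opD[OF sym_Z, of u "cscale \<i> u"] inner_cscale_swap[of u "Z u"] by (simp add: Z_i inner_commute)
      ultimately show ?thesis by (simp add: u T ip_coeff complex_of_real_def)
    qed
  next
    show "\<exists>M. \<forall>f\<in>ell2 Y. ?E {-M..M} f = f"
      by (rule exI[of _ b]) (auto simp: ell2_iff l2_of_coeff proj_support)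
  next
    fix S :: "nat \<Rightarrow> real set" and f :: "'g \<Rightarrow> complex ^ 'd"
    assume S: "range S \<subseteq> sets borel \<and> disjoint_family S" and "f \<in> ell2 Y"
    then obtain u where u: "f = coeff u" by (auto simp: ell2_iff)
    have "S n \<in> sets borel" for n using S by auto
    then show "(\<lambda>n. ip (?E (S n) f) f) sums ip (?E (\<Union>n. S n) f) f"
      using sums_of_real[OF proj_sums[of S u]] S by (simp add: u l2_of_coeff ip_proj)
  qed
qed

text \<open>Lifting a resolution \<open>E\<close> on \<open>ell2 Y\<close> to the whole space turns it into a projection valued measure as in
  \<open>resolution_is_spectral\<close>, with \<open>E UNIV\<close> the projection onto the functions on \<open>Y\<close>.\<close>

theorem resolution_measure:
  assumes T: "\<And>u. restr Y u = u \<Longrightarrow> T (coeff u) = coeff (Z u)"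
    and E: "spectral_resolution Y T E" and u: "restr Y u = u" and S: "S \<in> sets borel"
  shows "sets (scalar_measure E (coeff u)) = sets borel"
    and "measure (scalar_measure E (coeff u)) S = measure (smeas u) S"
    and "ip (E S (coeff u)) (coeff u) = complex_of_real (measure (scalar_measure E (coeff u)) S)"
proof -
  have proj: "orth_projection Y (E S)" if "S \<in> sets borel" for S
    using E that by (simp add: spectral_resolution_def)
  define L where "L S = lift_op Y (E S)" for S
  have L: "symmetric_op (L S)" "coeff (L S v) = E S (coeff (restr Y v))" "restr Y (L S v) = L S v"
    if "S \<in> sets borel" for S v
    unfolding L_def using lift_op[OF proj[OF that]] by auto
  have mem: "coeff (restr Y v) \<in> ell2 Y" for v :: "('g, complex ^ 'd) l2"
    by (rule coeff_in_ell2) (simp add: restr_restr)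
  have L_Int: "L (S \<inter> T) v = L S (L T v)" if "S \<in> sets borel" "T \<in> sets borel" for S T v
  proof -
    have "E (S \<inter> T) (coeff (restr Y v)) = E S (E T (coeff (restr Y v)))"
      using E that mem[of v] by (simp add: spectral_resolution_def)
    then have "coeff (L (S \<inter> T) v) = coeff (L S (L T v))"
      using that by (simp add: L)
    then show ?thesis by (simp add: coeff_inject)
  qed
  have L_UNIV: "L UNIV v = restr Y v" for v
    using E mem[of v] L(2)[of UNIV v] by (simp add: spectral_resolution_def coeff_inject)
  have ip_L: "ip (E S (coeff (restr Y v))) (coeff (restr Y v)) = complex_of_real (L S v \<bullet> v)" if S: "S \<in> sets borel" for S v
  proof -
    have "ip (E S (coeff (restr Y v))) (coeff (restr Y v)) = ip (coeff (restr Y v)) (E S (coeff (restr Y v)))"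
      using proj[OF S] mem[of v] by (simp add: orth_projection_def self_adjoint_op_def)
    then have eq: "ip (coeff (L S v)) (coeff (restr Y v)) = ip (coeff (restr Y v)) (coeff (L S v))"
      by (simp add: L[OF S])
    then have "L S v \<bullet> cscale \<i> (restr Y v) = restr Y v \<bullet> cscale \<i> (L S v)"
      by (simp add: ip_coeff)
    then have "L S v \<bullet> cscale \<i> (restr Y v) = 0"
      using inner_cscale_swap[of "restr Y v" "L S v"] by (simp add: inner_commute)
    moreover have "L S v \<bullet> restr Y v = L S v \<bullet> v"
      using symmetric_opD[OF symmetric_op_restr, of Y "L S v" v] by (simp add: L[OF S])
    ultimately show ?thesis
      unfolding L(2)[OF S, symmetric] ip_coeff by (simp add: complex_of_real_def)
  qed
  have pos: "0 \<le> L S v \<bullet> v" if S: "S \<in> sets borel" for S v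
  proof -
    have "L S v \<bullet> v = L S v \<bullet> L S v"
      using symmetric_opD[OF L(1)[OF S], of "L S v" v] L_Int[OF S S, of v] by simp
    then show ?thesis by simp
  qed
  define \<nu> where "\<nu> v = scalar_measure E (coeff (restr Y v))" for v
  have \<nu>_eq: "\<nu> v = measure_of UNIV (sets borel) (\<lambda>S. ennreal (L S v \<bullet> v))" for v
    unfolding \<nu>_def scalar_measure_def
  proof (rule measure_of_eq)
    fix S assume "S \<in> sigma_sets UNIV (sets (borel :: real measure))"
    then have "S \<in> sets borel"
      using sets.sigma_sets_eq[of "borel :: real measure"] by simp
    then show "ennreal (Re (ip (E S (coeff (restr Y v))) (coeff (restr Y v)))) = ennreal (L S v \<bullet> v)"
      by (simp add: ip_L)
  qed simp
  have sums: "(\<lambda>n. L (S n) v \<bullet> v) sums (L (\<Union>n. S n) v \<bullet> v)"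
    if S: "range S \<subseteq> sets borel" "disjoint_family S" for S :: "nat \<Rightarrow> real set" and v
  proof -
    have "S n \<in> sets borel" for n using S by auto
    moreover have "(\<lambda>n. ip (E (S n) (coeff (restr Y v))) (coeff (restr Y v))) sums ip (E (\<Union>n. S n) (coeff (restr Y v))) (coeff (restr Y v))"
      using E S mem[of v] by (simp add: spectral_resolution_def)
    ultimately have "(\<lambda>n. complex_of_real (L (S n) v \<bullet> v)) sums complex_of_real (L (\<Union>n. S n) v \<bullet> v)"
      by (simp add: ip_L)
    then show ?thesis by (simp add: sums_of_real_iff)
  qed
  have sets_\<nu>: "sets (\<nu> v) = sets borel" for v
    unfolding \<nu>_eq using sets.sigma_sets_eq[of "borel :: real measure"] by simp
  have fin_\<nu>: "finite_measure (\<nu> v)" and meas_\<nu>: "S \<in> sets borel \<Longrightarrow> measure (\<nu> v) S = L S v \<bullet> v" for v S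
    unfolding \<nu>_eq using measure_of_sums[of "\<lambda>S. L S v \<bullet> v"] pos sums by auto
  obtain c where c: "\<And>f. f \<in> ell2 Y \<Longrightarrow> E {-c..c} f = f"
    using E unfolding spectral_resolution_def by blast
  \<comment> \<open>The interval that carries \<open>E\<close> need not be \<open>[-b, b]\<close>; both measures live on the larger one.\<close>
  define d where "d = max b c"
  have L_d: "L {-d..d} v = restr Y v" for v
  proof -
    have "L {-c..c} v = restr Y v"
      using c[OF mem[of v]] L(2)[of "{-c..c}" v] by (simp add: coeff_inject)
    moreover have "{-d..d} \<inter> {-c..c} = {-c..c}" by (auto simp: d_def)
    ultimately have "L {-d..d} (restr Y v) = restr Y v"
      using L_Int[OF atLeastAtMost_borel atLeastAtMost_borel, of "-d" d "-c" c v] by (simp only:)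
    then show ?thesis by (simp add: L_def lift_op_def restr_restr)
  qed
  have bounded_\<nu>: "bounded_measure d (\<nu> v)" for v
    unfolding bounded_measure_def
  proof (intro conjI fin_\<nu> sets_\<nu>)
    interpret finite_measure "\<nu> v" by (rule fin_\<nu>)
    have space: "space (\<nu> v) = UNIV" using sets_eq_imp_space_eq[OF sets_\<nu>] by simp
    have "measure (\<nu> v) (space (\<nu> v) - {-d..d}) = measure (\<nu> v) UNIV - measure (\<nu> v) {-d..d}"
      unfolding space[symmetric] by (rule finite_measure_compl) (simp add: sets_\<nu>)
    also have "\<dots> = 0"
      by (simp add: meas_\<nu> L_d L_UNIV)
    finally have "emeasure (\<nu> v) (UNIV - {-d..d}) = 0"
      by (simp add: emeasure_eq_measure space)
    then show "AE t in \<nu> v. t \<in> {-d..d}"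
      by (intro AE_I[where N="UNIV - {-d..d}"]) (auto simp: sets_\<nu>)
  qed
  have "is_spectral_measure Z d u (\<nu> u)"
  proof (rule resolution_is_spectral[where E=L])
    show "symmetric_op Z" by (rule sym_Z)
    show "L UNIV (Z v) = Z v" for v by (simp add: L_UNIV restr_Z)
    show "L UNIV u = u" by (simp add: L_UNIV u)
    show "Z v \<bullet> v = (\<integral>t. t \<partial>\<nu> v)" for v
    proof -
      have "ip (T (coeff (restr Y v))) (coeff (restr Y v)) = complex_of_real (\<integral>t. t \<partial>\<nu> v)"
        using E mem[of v] by (simp add: spectral_resolution_def \<nu>_def)
      moreover have "T (coeff (restr Y v)) = coeff (Z v)"
        using T[of "restr Y v"] by (simp add: restr_restr Z_restr)
      ultimately have "Z v \<bullet> restr Y v = (\<integral>t. t \<partial>\<nu> v)"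
        by (simp add: ip_coeff complex_of_real_def)
      then show ?thesis
        using symmetric_opD[OF symmetric_op_restr, of Y "Z v" v] by (simp add: restr_Z)
    qed
  qed (use L(1) L_Int bounded_\<nu> meas_\<nu> in auto)
  moreover have "is_spectral_measure Z d u (smeas u)"
    by (rule is_spectral_measure_mono[OF smeas]) (simp add: d_def)
  ultimately have int: "(\<integral>t. indicator S t \<partial>\<nu> u) = (\<integral>t. indicat_real S t \<partial>smeas u)"
    using S by (intro spectral_measure_unique[of Z d u]) (auto intro: bounded_fun_intros)
  have \<nu>u: "\<nu> u = scalar_measure E (coeff u)" by (simp add: \<nu>_def u)
  have "space (\<nu> u) = UNIV" using sets_eq_imp_space_eq[OF sets_\<nu>] by simp
  then show "measure (scalar_measure E (coeff u)) S = measure (smeas u) S"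
    using int by (simp add: \<nu>u space_\<mu>)
  show "sets (scalar_measure E (coeff u)) = sets borel"
    using sets_\<nu>[of u] by (simp add: \<nu>u)
  show "ip (E S (coeff u)) (coeff u) = complex_of_real (measure (scalar_measure E (coeff u)) S)"
    using ip_L[OF S, of u] meas_\<nu>[OF S, of u] by (simp add: \<nu>u u)
qed

text \<open>\<open>E {..t}\<close> witnesses that the operator chosen by \<open>borel_calculus\<close> exists, and the chosen operator has
  the diagonal values of the witness.\<close>

theorem borel_calculus_indicator:
  assumes T: "\<And>u. restr Y u = u \<Longrightarrow> T (coeff u) = coeff (Z u)" and u: "restr Y u = u"
  shows "ip (borel_calculus Y T (indicator {..t}) (coeff u)) (coeff u) = complex_of_real (measure (smeas u) {..t})"
proof -
  define E where "E = spectral_measure Y T"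
  have E: "spectral_resolution Y T E"
    unfolding E_def spectral_measure_def by (rule someI_ex[OF spectral_resolution_ex[OF T]])
  have int: "(\<integral>x. (indicator {..t} x :: complex) \<partial>scalar_measure E (coeff v)) = complex_of_real (measure (scalar_measure E (coeff v)) {..t})"
    if "restr Y v = v" for v
  proof -
    have "space (scalar_measure E (coeff v)) = UNIV"
      using sets_eq_imp_space_eq[OF resolution_measure(1)[OF T E that, of UNIV]] by simp
    moreover have "(\<integral>x. (indicator {..t} x :: complex) \<partial>scalar_measure E (coeff v))
        = (\<integral>x. complex_of_real (indicator {..t} x) \<partial>scalar_measure E (coeff v))"
      by (intro Bochner_Integration.integral_cong) (auto simp: indicator_def)
    ultimately show ?thesis
      by (simp add: integral_complex_of_real)
  qed
  let ?P = "\<lambda>B. bounded_op Y B \<and> (\<forall>f\<in>ell2 Y. ip (B f) f = (\<integral>x. (indicator {..t} x :: complex) \<partial>scalar_measure E f))"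
  have "?P (E {..t})"
  proof
    show "bounded_op Y (E {..t})"
      using E by (simp add: spectral_resolution_def orth_projection_def)
    show "\<forall>f\<in>ell2 Y. ip (E {..t} f) f = (\<integral>x. indicator {..t} x \<partial>scalar_measure E f)"
      using int resolution_measure(3)[OF T E] by (auto simp: ell2_iff)
  qed
  then have "?P (borel_calculus Y T (indicator {..t}))"
    unfolding borel_calculus_def E_def[symmetric] by (rule someI[of ?P])
  then have "ip (borel_calculus Y T (indicator {..t}) (coeff u)) (coeff u)
      = complex_of_real (measure (scalar_measure E (coeff u)) {..t})"
    using coeff_in_ell2[OF u] int[OF u] by simp
  also have "measure (scalar_measure E (coeff u)) {..t} = measure (smeas u) {..t}"
    by (rule resolution_measure(2)[OF T E u borel_closed[OF closed_atMost]])
  finally show ?thesis .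
qed

end

section \<open>Twisted convolution operators\<close>

locale twisted_convolution = fibred_group G Q p s
  for G :: "('g, 'x) monoid_scheme" (structure) and Q :: "('q, 'y) monoid_scheme" and p :: "'g \<Rightarrow> 'q" and s :: "'q \<Rightarrow> 'g" +
  fixes \<sigma>' :: "'q \<Rightarrow> 'q \<Rightarrow> complex" and A :: "'g \<Rightarrow> complex ^ 'd ^ 'd"
  assumes multiplier: "multiplier Q \<sigma>'" and A_twisted: "A \<in> twisted_matrices G"
    and A_self_adjoint: "self_adjoint_op (carrier G) (twisted_op G (pullback p \<sigma>') A)"
begin

abbreviation \<sigma> where "\<sigma> \<equiv> pullback p \<sigma>'"
abbreviation T where "T \<equiv> twisted_op G \<sigma> A"

definition supp :: "'g set" where "supp = {g. A g \<noteq> 0}"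

lemma finite_supp: "finite supp" and supp_carrier: "g \<in> supp \<Longrightarrow> g \<in> carrier G"
  using A_twisted by (auto simp: supp_def twisted_matrices_def)

lemma norm_\<sigma>: "x \<in> carrier G \<Longrightarrow> y \<in> carrier G \<Longrightarrow> cmod (\<sigma> x y) = 1"
  using multiplier by (simp add: multiplier_def pullback_def p_closed)

lemma \<sigma>_cocycle:
  assumes "x \<in> carrier G" "y \<in> carrier G" "z \<in> carrier G"
  shows "\<sigma> y z * \<sigma> x (y \<otimes> z) = \<sigma> (x \<otimes> y) z * \<sigma> x y"
  using multiplier assms by (simp add: multiplier_def pullback_def p_closed p_mult)

lemma \<sigma>_one: "x \<in> carrier G \<Longrightarrow> \<sigma> \<one> x = 1"
  using multiplier by (simp add: multiplier_def pullback_def p_closed group_hom.hom_one[of G Q p]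
      group_hom_def group_hom_axioms_def group_G group_Q hom_p)

text \<open>The substitution \<open>h = g\<inverse> x\<close> exhibits the operator as a finite sum of weighted left translations.\<close>

lemma twisted_op_sum:
  assumes x: "x \<in> carrier G"
  shows "T f x = (\<Sum>g\<in>supp. A g *v (\<sigma> g (inv g \<otimes> x) *s f (inv g \<otimes> x)))"
proof -
  let ?\<phi> = "\<lambda>h. A (x \<otimes> inv h) *v (\<sigma> (x \<otimes> inv h) h *s f h)"
  let ?i = "\<lambda>g. inv g \<otimes> x"
  have inv_i: "x \<otimes> inv (?i g) = g" if "g \<in> carrier G" for g
    using that x by (simp add: G.inv_mult_group G.m_assoc[symmetric])
  have inj: "inj_on ?i supp"
    by (rule inj_on_inverseI[where g="\<lambda>h. x \<otimes> inv h"]) (simp add: inv_i supp_carrier)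
  have "T f x = infsum ?\<phi> (carrier G)"
    using x by (simp add: twisted_op_def)
  also have "\<dots> = infsum ?\<phi> (?i ` supp)"
  proof (rule infsum_cong_neutral)
    fix h assume h: "h \<in> carrier G - ?i ` supp"
    have "h = ?i (x \<otimes> inv h)"
      using h x by (simp add: G.inv_mult_group G.m_assoc)
    then have "x \<otimes> inv h \<notin> supp"
      using h by blast
    then show "?\<phi> h = 0" by (simp add: supp_def)
  next
    fix h assume "h \<in> ?i ` supp - carrier G"
    then show "?\<phi> h = 0" using x supp_carrier by auto
  qed simp
  also have "\<dots> = (\<Sum>g\<in>supp. ?\<phi> (?i g))"
    using finite_supp by (simp add: sum.reindex[OF inj])
  also have "\<dots> = (\<Sum>g\<in>supp. A g *v (\<sigma> g (?i g) *s f (?i g)))"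
    by (intro sum.cong refl) (simp add: inv_i supp_carrier)
  finally show ?thesis .
qed

definition shift :: "'g \<Rightarrow> ('g, complex ^ 'd) l2 \<Rightarrow> ('g, complex ^ 'd) l2" where
  "shift g f = l2_of (\<lambda>x. if x \<in> carrier G
     then A g *v (\<sigma> g (inv g \<otimes> x) *s coeff f (inv g \<otimes> x)) else 0)"

lemma shift:
  assumes g: "g \<in> carrier G"
  shows coeff_shift: "coeff (shift g f) = (\<lambda>x. if x \<in> carrier G
      then A g *v (\<sigma> g (inv g \<otimes> x) *s coeff f (inv g \<otimes> x)) else 0)"
    and norm_shift_le: "norm (shift g f) \<le> onorm ((*v) (A g)) * norm f"
proof -
  let ?C = "onorm ((*v) (A g))"
  let ?f = "\<lambda>x. if x \<in> carrier G then A g *v (\<sigma> g (inv g \<otimes> x) *s coeff f (inv g \<otimes> x)) else 0"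
  have C: "0 \<le> ?C" by (intro onorm_pos_le matrix_vector_mul_bounded_linear)
  have "(\<Sum>x\<in>F. (norm (?f x))\<^sup>2) \<le> (?C * norm f)\<^sup>2" if F: "finite F" for F
  proof -
    let ?F = "F \<inter> carrier G"
    have "(\<Sum>x\<in>F. (norm (?f x))\<^sup>2) = (\<Sum>x\<in>?F. (norm (?f x))\<^sup>2)"
      using F by (intro sum.mono_neutral_right) auto
    also have "\<dots> \<le> (\<Sum>x\<in>?F. ?C\<^sup>2 * (norm (coeff f (inv g \<otimes> x)))\<^sup>2)"
    proof (rule sum_mono)
      fix x assume x: "x \<in> ?F"
      have "norm (?f x) \<le> ?C * norm (\<sigma> g (inv g \<otimes> x) *s coeff f (inv g \<otimes> x))"
        using x onorm[OF matrix_vector_mul_bounded_linear] by simp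
      also have "\<dots> = ?C * norm (coeff f (inv g \<otimes> x))"
        using x g by (simp add: norm_vector_scalar_mult norm_\<sigma>)
      finally have "(norm (?f x))\<^sup>2 \<le> (?C * norm (coeff f (inv g \<otimes> x)))\<^sup>2"
        by (intro power_mono) auto
      then show "(norm (?f x))\<^sup>2 \<le> ?C\<^sup>2 * (norm (coeff f (inv g \<otimes> x)))\<^sup>2"
        by (simp add: power_mult_distrib)
    qed
    also have "\<dots> = ?C\<^sup>2 * (\<Sum>y\<in>(\<lambda>x. inv g \<otimes> x) ` ?F. (norm (coeff f y))\<^sup>2)"
      using g by (subst sum.reindex) (auto simp: inj_on_def sum_distrib_left)
    also have "\<dots> \<le> ?C\<^sup>2 * (norm f)\<^sup>2"
      using F by (intro mult_left_mono l2_partial_sum_le) auto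
    finally show ?thesis by (simp add: power_mult_distrib)
  qed
  from l2_of_bounded[OF this] C
  show "coeff (shift g f) = ?f" "norm (shift g f) \<le> ?C * norm f"
    unfolding shift_def by auto
qed

definition op :: "('g, complex ^ 'd) l2 \<Rightarrow> ('g, complex ^ 'd) l2" where
  "op f = (\<Sum>g\<in>supp. shift g f)"

lemma coeff_op_sum: "coeff (op f) x = (if x \<in> carrier G
    then \<Sum>g\<in>supp. A g *v (\<sigma> g (inv g \<otimes> x) *s coeff f (inv g \<otimes> x)) else 0)"
  by (auto simp: op_def coeff_sum coeff_shift supp_carrier intro!: sum.cong)

lemma coeff_op: "coeff (op f) = T (coeff f)"
proof
  show "coeff (op f) x = T (coeff f) x" for x
    using twisted_op_sum[of x "coeff f"] by (cases "x \<in> carrier G") (simp_all add: coeff_op_sum, simp add: twisted_op_def)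
qed

text \<open>The summand \<open>1\<close> keeps the bound positive if \<open>A = 0\<close>.\<close>

definition bound :: real where "bound = (\<Sum>g\<in>supp. onorm ((*v) (A g))) + 1"

lemma bound_pos: "bound > 0"
proof -
  have "0 \<le> (\<Sum>g\<in>supp. onorm ((*v) (A g)))"
    by (intro sum_nonneg onorm_pos_le matrix_vector_mul_bounded_linear)
  then show ?thesis by (simp add: bound_def)
qed

lemma norm_op_le: "norm (op f) \<le> bound * norm f"
proof -
  have "norm (op f) \<le> (\<Sum>g\<in>supp. onorm ((*v) (A g)) * norm f)"
    unfolding op_def by (intro sum_norm_le norm_shift_le supp_carrier)
  also have "\<dots> \<le> bound * norm f"
    by (simp add: bound_def sum_distrib_right distrib_right)
  finally show ?thesis .
qed

lemma op_restr: "op (restr (carrier G) f) = op f"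
  by (rule l2_eqI) (auto simp: coeff_op_sum coeff_restr supp_carrier intro!: sum.cong)

lemma restr_op: "restr (carrier G) (op f) = op f"
  by (rule l2_eqI) (simp add: coeff_op_sum coeff_restr)

lemma op_symmetric: "symmetric_op op"
  unfolding symmetric_op_def
proof (intro conjI allI linearI)
  show "op (f + g) = op f + op g" for f g
    by (rule l2_eqI) (simp add: coeff_op_sum coeff_add vector_add_ldistrib matrix_vector_right_distrib sum.distrib)
  show "op (c *\<^sub>R f) = c *\<^sub>R op f" for c f
  proof (rule l2_eqI)
    have "w *s (complex_of_real c *s v) = complex_of_real c *s (w *s v)" for w and v :: "complex ^ 'd"
      by (simp add: vec_eq_iff)
    then show "coeff (op (c *\<^sub>R f)) x = coeff (c *\<^sub>R op f) x" for x
      by (simp add: coeff_op_sum coeff_scaleR vec_scaleR vector_scalar_commute[symmetric] vec.scale_sum_right mult.commute)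
  qed
  show "op f \<bullet> g = f \<bullet> op g" for f g
  proof -
    let ?R = "restr (carrier G) :: ('g, complex ^ 'd) l2 \<Rightarrow> _"
    have mem: "coeff (?R h) \<in> ell2 (carrier G)" for h
      by (rule coeff_in_ell2) (simp add: restr_restr)
    have "ip (coeff (op (?R f))) (coeff (?R g)) = ip (coeff (?R f)) (coeff (op (?R g)))"
      using A_self_adjoint mem[of f] mem[of g] by (simp add: self_adjoint_op_def coeff_op)
    then have "op f \<bullet> ?R g = ?R f \<bullet> op g"
      by (simp add: ip_coeff op_restr)
    then show ?thesis
      using symmetric_opD[OF symmetric_op_restr, of "carrier G" "op f" g]
        symmetric_opD[OF symmetric_op_restr, of "carrier G" f "op g"] by (simp add: restr_op)
  qed
qed

lemma op_cscale: "op (cscale c f) = cscale c (op f)"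
proof (rule l2_eqI)
  have "w *s (c *s v) = c *s (w *s v)" for w and v :: "complex ^ 'd"
    by (simp add: vec_eq_iff)
  then show "coeff (op (cscale c f)) x = coeff (cscale c (op f)) x" for x
    by (simp add: coeff_op_sum coeff_cscale vector_scalar_commute[symmetric] vec.scale_sum_right mult.commute)
qed

text \<open>The twist only depends on classes modulo \<open>H\<close>, because the multiplier is a pullback.\<close>

lemma equivariant_op: "equivariant op"
  unfolding equivariant_def
proof (intro ballI allI l2_eqI)
  fix h f x assume h: "h \<in> H"
  note hG = H_carrier[OF h]
  have "\<sigma> g (inv g \<otimes> (x \<otimes> h)) = \<sigma> g (inv g \<otimes> x)" if "g \<in> carrier G" "x \<in> carrier G" for g
    using that p_H[OF _ h] hG by (simp add: pullback_def G.m_assoc[symmetric])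
  then show "coeff (op (right_trans G h f)) x = coeff (right_trans G h (op f)) x"
    using hG by (auto simp: coeff_op_sum coeff_right_trans[OF group_G hG] supp_carrier G.m_assoc intro!: sum.cong)
qed

text \<open>For \<open>h\<close> outside of \<open>H\<close> plain right translations need not commute with \<open>A\<close>.  The phase \<open>cnj (\<sigma> x h)\<close> is the
  correction that the cocycle identity asks for.\<close>

definition twisted_trans :: "'g \<Rightarrow> ('g, complex ^ 'd) l2 \<Rightarrow> ('g, complex ^ 'd) l2" where
  "twisted_trans h f = l2_of (\<lambda>x. cnj (\<sigma> x h) *s coeff (right_trans G h f) x)"

lemma coeff_twisted_trans:
  assumes h: "h \<in> carrier G"
  shows "coeff (twisted_trans h f) x = (if x \<in> carrier G then cnj (\<sigma> x h) *s coeff f (x \<otimes> h) else 0)"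
proof -
  have eq: "(norm (cnj (\<sigma> x h) *s coeff (right_trans G h f) x))\<^sup>2 = (norm (coeff (right_trans G h f) x))\<^sup>2" for x
    using h by (cases "x \<in> carrier G") (simp_all add: coeff_right_trans[OF group_G] norm_vector_scalar_mult norm_\<sigma>)
  have "(\<lambda>x. (norm (cnj (\<sigma> x h) *s coeff (right_trans G h f) x))\<^sup>2) summable_on UNIV"
    unfolding eq by (rule coeff_summable)
  then show ?thesis
    by (simp add: twisted_trans_def coeff_l2_of) (simp add: coeff_right_trans[OF group_G h])
qed

lemma inner_twisted_trans:
  assumes h: "h \<in> carrier G" and g: "restr (carrier G) g = g"
  shows "twisted_trans h f \<bullet> twisted_trans h g = f \<bullet> g"
proof -
  have "(c *s v) \<bullet> (c *s w) = v \<bullet> w" if "cmod c = 1" for c and v w :: "complex ^ 'd"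
  proof -
    have "c * cnj c = 1"
      using that by (simp add: complex_norm_square[symmetric] power2_eq_square)
    then have "c * x * cnj (c * y) = x * cnj y" for x y
      by (simp add: mult_ac)
    then show ?thesis
      unfolding inner_complex_vec vector_smult_component by (simp only:)
  qed
  then have "coeff (twisted_trans h f) x \<bullet> coeff (twisted_trans h g) x = coeff (right_trans G h f) x \<bullet> coeff (right_trans G h g) x" for x
    using h by (simp add: coeff_twisted_trans coeff_right_trans[OF group_G] norm_\<sigma>)
  then have "twisted_trans h f \<bullet> twisted_trans h g = right_trans G h f \<bullet> right_trans G h g"
    by (simp add: inner_l2_def)
  then show ?thesis
    using inner_right_trans[OF group_G h g] by simp
qed

lemma twisted_trans_op:
  assumes h: "h \<in> carrier G"
  shows "twisted_trans h (op f) = op (twisted_trans h f)"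
proof (rule l2_eqI)
  fix x
  show "coeff (twisted_trans h (op f)) x = coeff (op (twisted_trans h f)) x"
  proof (cases "x \<in> carrier G")
    case True
    have "cnj (\<sigma> x h) *s (A g *v (\<sigma> g (inv g \<otimes> (x \<otimes> h)) *s coeff f (inv g \<otimes> (x \<otimes> h))))
        = A g *v (\<sigma> g (inv g \<otimes> x) *s (cnj (\<sigma> (inv g \<otimes> x) h) *s coeff f (inv g \<otimes> x \<otimes> h)))"
      if g: "g \<in> supp" for g
    proof -
      let ?y = "inv g \<otimes> x"
      have gG: "g \<in> carrier G" using g by (rule supp_carrier)
      have y: "?y \<in> carrier G" "g \<otimes> ?y = x"
        using gG True by (simp_all add: G.m_assoc[symmetric])
      have unit: "c * cnj c = 1" if "cmod c = 1" for c
        using that by (simp add: complex_norm_square[symmetric])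
      have cocycle: "\<sigma> ?y h * \<sigma> g (?y \<otimes> h) = \<sigma> x h * \<sigma> g ?y"
        using \<sigma>_cocycle[OF gG y(1) h] y(2) by simp
      have "cnj (\<sigma> x h) * \<sigma> g (?y \<otimes> h) = cnj (\<sigma> x h) * cnj (\<sigma> ?y h) * (\<sigma> ?y h * \<sigma> g (?y \<otimes> h))"
        using unit[OF norm_\<sigma>[OF y(1) h]] by (simp add: mult_ac)
      also have "\<dots> = cnj (\<sigma> ?y h) * \<sigma> g ?y"
        using unit[OF norm_\<sigma>[OF True h]] unfolding cocycle by (simp add: mult_ac)
      finally have "cnj (\<sigma> x h) * \<sigma> g (?y \<otimes> h) = \<sigma> g ?y * cnj (\<sigma> ?y h)"
        by (simp add: mult.commute)
      moreover have "inv g \<otimes> (x \<otimes> h) = ?y \<otimes> h"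
        using gG True h by (simp add: G.m_assoc)
      ultimately show ?thesis
        by (simp add: vector_scalar_commute[symmetric] vector_smult_assoc)
    qed
    then show ?thesis
      using True h
      by (simp add: coeff_op_sum coeff_twisted_trans vec.scale_sum_right supp_carrier cong: sum.cong)
  qed (simp add: coeff_twisted_trans[OF h] coeff_op_sum)
qed

lemma twisted_trans_single:
  assumes g: "g \<in> carrier G"
  shows "twisted_trans g (single g v) = single \<one> v"
proof (rule l2_eqI)
  fix x
  have "x \<otimes> g = g \<longleftrightarrow> x = \<one>" if "x \<in> carrier G"
    using that g by (rule G.r_cancel_one[rotated])
  then show "coeff (twisted_trans g (single g v)) x = coeff (single \<one> v) x"
    using g by (auto simp: coeff_twisted_trans coeff_single \<sigma>_one)
qed

lemma moments_homogeneous: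
  assumes g: "g \<in> carrier G"
  shows "(op ^^ j) (single g v) \<bullet> single g v = (op ^^ j) (single \<one> v) \<bullet> single \<one> v"
proof -
  have "twisted_trans g ((op ^^ j) (single g v)) = (op ^^ j) (single \<one> v)"
    unfolding twisted_trans_single[OF g, symmetric] by (rule funpow_commute_apply) (rule twisted_trans_op[OF g])
  then show ?thesis
    using inner_twisted_trans[OF g, of "single g v" "(op ^^ j) (single g v)"] g
    by (simp add: restr_single twisted_trans_single)
qed

end

section \<open>Foelner exhaustions\<close>

definition word_product :: "('q, 'x) monoid_scheme \<Rightarrow> 'q list \<Rightarrow> 'q" where
  "word_product Q ws = foldr (\<lambda>s t. s \<otimes>\<^bsub>Q\<^esub> t) ws \<one>\<^bsub>Q\<^esub>"

lemma word_product_closed: "group Q \<Longrightarrow> set ws \<subseteq> carrier Q \<Longrightarrow> word_product Q ws \<in> carrier Q"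
  by (induction ws) (auto simp: word_product_def group.is_monoid monoid.m_closed)

lemma word_product_append:
  assumes "group Q" "set vs \<subseteq> carrier Q" "set ws \<subseteq> carrier Q"
  shows "word_product Q (vs @ ws) = word_product Q vs \<otimes>\<^bsub>Q\<^esub> word_product Q ws"
proof -
  interpret group Q by fact
  have ws: "word_product Q ws \<in> carrier Q" by (rule word_product_closed) fact+
  have Cons: "word_product Q (a # us) = a \<otimes>\<^bsub>Q\<^esub> word_product Q us" for a us by (simp add: word_product_def)
  show ?thesis
    using assms(2)
  proof (induction vs)
    case Nil
    show ?case using ws by (simp add: word_product_def)
  next
    case (Cons a vs)
    then have "word_product Q vs \<in> carrier Q" by (intro word_product_closed assms(1)) auto
    then show ?case
      using Cons ws by (simp add: \<open>\<And>us a. word_product Q (a # us) = _\<close> m_assoc)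
  qed
qed

lemma generated_by_words:
  assumes Q: "group Q" and S: "S \<subseteq> carrier Q" and g: "g \<in> generate Q S"
  shows "\<exists>ws. set ws \<subseteq> S \<union> (\<lambda>s. inv\<^bsub>Q\<^esub> s) ` S \<and> word_product Q ws = g"
proof -
  interpret group Q by fact
  let ?S = "S \<union> (\<lambda>s. inv\<^bsub>Q\<^esub> s) ` S"
  have S': "?S \<subseteq> carrier Q" using S by auto
  have single: "\<exists>ws. set ws \<subseteq> ?S \<and> word_product Q ws = h" if "h \<in> ?S" for h
    using that S' by (intro exI[of _ "[h]"]) (auto simp: word_product_def)
  show ?thesis
    using g
  proof (induction g rule: generate.induct)
    case one
    show ?case by (rule exI[of _ "[]"]) (simp add: word_product_def)
  next
    case (incl h)
    then show ?case by (intro single) blast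
  next
    case (inv h)
    then show ?case by (intro single) blast
  next
    case (eng h1 h2)
    then obtain vs ws where "set vs \<subseteq> ?S" "word_product Q vs = h1" "set ws \<subseteq> ?S" "word_product Q ws = h2" by blast
    then show ?case
      using S' word_product_append[OF Q, of vs ws] by (intro exI[of _ "vs @ ws"]) auto
  qed
qed

text \<open>Every group element is a product of generators and inverses, so it equals a word of length \<open>word_length\<close>, and
  there are finitely many words of bounded length.\<close>

lemma finite_word_ball:
  assumes Q: "group Q" and S: "finite_generating_set Q S"
  shows "finite {g \<in> carrier Q. word_length Q S g \<le> n}"
proof -
  let ?S = "S \<union> (\<lambda>s. inv\<^bsub>Q\<^esub> s) ` S"
  have "finite (word_product Q ` {ws. set ws \<subseteq> ?S \<and> length ws \<le> n})"
    using S by (intro finite_imageI finite_lists_length_le) (auto simp: finite_generating_set_def)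
  moreover have "{g \<in> carrier Q. word_length Q S g \<le> n} \<subseteq> word_product Q ` {ws. set ws \<subseteq> ?S \<and> length ws \<le> n}"
  proof
    fix g assume g: "g \<in> {g \<in> carrier Q. word_length Q S g \<le> n}"
    let ?P = "\<lambda>n. \<exists>ws. length ws = n \<and> set ws \<subseteq> ?S \<and> foldr (\<lambda>s t. s \<otimes>\<^bsub>Q\<^esub> t) ws \<one>\<^bsub>Q\<^esub> = g"
    have "g \<in> generate Q S" "S \<subseteq> carrier Q"
      using g S by (auto simp: finite_generating_set_def)
    then have "\<exists>k. ?P k"
      using generated_by_words[OF Q, of S g] by (auto simp: word_product_def)
    then have "?P (word_length Q S g)"
      unfolding word_length_def by (rule LeastI_ex)
    then show "g \<in> word_product Q ` {ws. set ws \<subseteq> ?S \<and> length ws \<le> n}"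
      using g by (auto simp: word_product_def)
  qed
  ultimately show ?thesis by (rule finite_subset[rotated])
qed

lemma finite_outer_boundary:
  assumes Q: "group Q" and S: "finite_generating_set Q S" and X: "finite X" "X \<subseteq> carrier Q"
  shows "finite (outer_boundary Q S \<delta> X)"
proof -
  interpret group Q by fact
  let ?B = "{g \<in> carrier Q. word_length Q S g \<le> nat \<lfloor>\<delta>\<rfloor>}"
  have "outer_boundary Q S \<delta> X \<subseteq> (\<lambda>(g, x). g \<otimes>\<^bsub>Q\<^esub> x) ` (?B \<times> X)"
  proof
    fix y assume "y \<in> outer_boundary Q S \<delta> X"
    then obtain x where y: "y \<in> carrier Q" and x: "x \<in> X" and le: "real (word_length Q S (y \<otimes>\<^bsub>Q\<^esub> inv\<^bsub>Q\<^esub> x)) \<le> \<delta>"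
      by (auto simp: outer_boundary_def word_dist_def)
    have "x \<in> carrier Q" using x X by auto
    then have "y = (y \<otimes>\<^bsub>Q\<^esub> inv\<^bsub>Q\<^esub> x) \<otimes>\<^bsub>Q\<^esub> x" "y \<otimes>\<^bsub>Q\<^esub> inv\<^bsub>Q\<^esub> x \<in> ?B"
      using y le by (auto simp: m_assoc le_nat_floor)
    then show "y \<in> (\<lambda>(g, x). g \<otimes>\<^bsub>Q\<^esub> x) ` (?B \<times> X)"
      using x by (intro image_eqI[of _ _ "(y \<otimes>\<^bsub>Q\<^esub> inv\<^bsub>Q\<^esub> x, x)"]) auto
  qed
  then show ?thesis
    by (rule finite_subset) (use finite_word_ball[OF Q S] X in simp)
qed

definition near_boundary :: "('q, 'y) monoid_scheme \<Rightarrow> 'q set \<Rightarrow> 'q set \<Rightarrow> 'q set" where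
  "near_boundary Q F X = {x \<in> X. \<exists>w\<in>F. w \<otimes>\<^bsub>Q\<^esub> x \<notin> X}"

text \<open>For fixed \<open>w\<close> the map \<open>x \<mapsto> w x\<close> sends the points \<open>x\<close> of \<open>X\<close> with \<open>w x \<notin> X\<close> injectively into the outer boundary
  of radius \<open>word_length w\<close>.\<close>

lemma near_boundary_negligible:
  assumes Q: "group Q" and S: "finite_generating_set Q S" and X: "foelner_exhaustion Q S X"
    and F: "finite F" "F \<subseteq> carrier Q"
  shows "(\<lambda>m. real (card (near_boundary Q F (X m))) / real (card (X m))) \<longlonglongrightarrow> 0"
proof -
  interpret group Q by fact
  have Xm: "finite (X m)" "X m \<subseteq> carrier Q" for m
    using X by (auto simp: foelner_exhaustion_def)
  define \<delta> where "\<delta> = real (Max (insert 0 (word_length Q S ` F))) + 1"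
  have \<delta>: "\<delta> > 0" by (simp add: \<delta>_def)
  have le_\<delta>: "real (word_length Q S w) \<le> \<delta>" if "w \<in> F" for w
  proof -
    have "word_length Q S w \<le> Max (insert 0 (word_length Q S ` F))"
      using F that by (intro Max_ge) auto
    then show ?thesis by (simp add: \<delta>_def)
  qed
  have "card (near_boundary Q F (X m)) \<le> card F * card (outer_boundary Q S \<delta> (X m))" for m
  proof -
    have union: "near_boundary Q F (X m) = (\<Union>w\<in>F. {x \<in> X m. w \<otimes>\<^bsub>Q\<^esub> x \<notin> X m})"
      by (auto simp: near_boundary_def)
    have "card (near_boundary Q F (X m)) \<le> (\<Sum>w\<in>F. card {x \<in> X m. w \<otimes>\<^bsub>Q\<^esub> x \<notin> X m})"
      unfolding union by (rule card_UN_le[OF F(1)])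
    also have "\<dots> \<le> (\<Sum>w\<in>F. card (outer_boundary Q S \<delta> (X m)))"
    proof (rule sum_mono)
      fix w assume w: "w \<in> F"
      then have wQ: "w \<in> carrier Q" using F by auto
      show "card {x \<in> X m. w \<otimes>\<^bsub>Q\<^esub> x \<notin> X m} \<le> card (outer_boundary Q S \<delta> (X m))"
      proof (rule card_inj_on_le[where f="\<lambda>x. w \<otimes>\<^bsub>Q\<^esub> x"])
        show "inj_on (\<lambda>x. w \<otimes>\<^bsub>Q\<^esub> x) {x \<in> X m. w \<otimes>\<^bsub>Q\<^esub> x \<notin> X m}"
        proof (rule inj_onI)
          fix x y assume xy: "x \<in> {x \<in> X m. w \<otimes>\<^bsub>Q\<^esub> x \<notin> X m}" "y \<in> {x \<in> X m. w \<otimes>\<^bsub>Q\<^esub> x \<notin> X m}"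
            and eq: "w \<otimes>\<^bsub>Q\<^esub> x = w \<otimes>\<^bsub>Q\<^esub> y"
          have "x \<in> carrier Q" "y \<in> carrier Q" using xy Xm(2)[of m] by auto
          then show "x = y" using eq wQ by simp
        qed
        show "(\<lambda>x. w \<otimes>\<^bsub>Q\<^esub> x) ` {x \<in> X m. w \<otimes>\<^bsub>Q\<^esub> x \<notin> X m} \<subseteq> outer_boundary Q S \<delta> (X m)"
        proof
          fix y assume "y \<in> (\<lambda>x. w \<otimes>\<^bsub>Q\<^esub> x) ` {x \<in> X m. w \<otimes>\<^bsub>Q\<^esub> x \<notin> X m}"
          then obtain x where x: "x \<in> X m" "y = w \<otimes>\<^bsub>Q\<^esub> x" "y \<notin> X m" by blast
          have xQ: "x \<in> carrier Q" using x Xm(2) by auto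
          then have "word_dist Q S y x = word_length Q S w"
            using wQ by (simp add: word_dist_def x(2) m_assoc)
          then show "y \<in> outer_boundary Q S \<delta> (X m)"
            using x wQ xQ le_\<delta>[OF w] by (auto simp: outer_boundary_def intro!: bexI[of _ x])
        qed
        show "finite (outer_boundary Q S \<delta> (X m))"
          by (rule finite_outer_boundary[OF Q S Xm])
      qed
    qed
    finally show ?thesis by simp
  qed
  then have bound: "real (card (near_boundary Q F (X m))) / real (card (X m))
      \<le> real (card F) * (real (card (outer_boundary Q S \<delta> (X m))) / real (card (X m)))" for m
    unfolding times_divide_eq_right by (intro divide_right_mono) (simp_all flip: of_nat_mult)
  have "(\<lambda>m. real (card F) * (real (card (outer_boundary Q S \<delta> (X m))) / real (card (X m)))) \<longlonglongrightarrow> real (card F) * 0"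
    using X \<delta> by (intro tendsto_mult tendsto_const) (simp add: foelner_exhaustion_def)
  then have lim: "(\<lambda>m. real (card F) * (real (card (outer_boundary Q S \<delta> (X m))) / real (card (X m)))) \<longlonglongrightarrow> 0"
    by simp
  show ?thesis
  proof (rule Lim_null_comparison[OF _ lim], rule always_eventually, rule allI)
    fix m
    have "norm (real (card (near_boundary Q F (X m))) / real (card (X m))) = real (card (near_boundary Q F (X m))) / real (card (X m))"
      by simp
    then show "norm (real (card (near_boundary Q F (X m))) / real (card (X m)))
        \<le> real (card F) * (real (card (outer_boundary Q S \<delta> (X m))) / real (card (X m)))"
      using bound[of m] by (rule ord_eq_le_trans)
  qed
qed

section \<open>Spectral densities of the compressions\<close>

lemma axis_Basis_sum:
  fixes \<phi> :: "complex ^ 'd \<Rightarrow> 'a::comm_monoid_add"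
  shows "(\<Sum>v\<in>Basis. \<phi> v) = (\<Sum>a\<in>UNIV. \<phi> (axis a 1) + \<phi> (axis a \<i>))"
proof -
  have B: "(Basis :: (complex ^ 'd) set) = (\<lambda>(a, u). axis a u) ` (UNIV \<times> {1, \<i>})"
    by (auto simp: Basis_vec_def Basis_complex_def)
  have inj: "inj_on (\<lambda>(a, u). axis a u) (UNIV \<times> {1, \<i>} :: ('d \<times> complex) set)"
    by (auto simp: inj_on_def axis_eq_axis)
  have "(\<Sum>v\<in>Basis. \<phi> v) = (\<Sum>(a, u)\<in>UNIV \<times> {1, \<i>}. \<phi> (axis a u))"
    unfolding B sum.reindex[OF inj] by (simp add: case_prod_beta o_def)
  also have "\<dots> = (\<Sum>a\<in>UNIV. \<Sum>u\<in>{1, \<i>}. \<phi> (axis a u))"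
    by (rule sum.cartesian_product[symmetric])
  finally show ?thesis by simp
qed

lemma coeff_single_basis: "coeff (single g (axis a 1)) = basis_vec g a"
  by (auto simp: basis_vec_def coeff_single)

lemma single_axis_i: "single g (axis a \<i>) = cscale \<i> (single g (axis a 1))"
  by (rule l2_eqI) (simp add: coeff_cscale coeff_single vec_eq_iff axis_def)

text \<open>The measure \<open>w \<Sum>\<^sub>i \<mu>\<^sub>i\<close> in the list encoding of signed measures.\<close>

definition weighted :: "('i \<Rightarrow> real measure) \<Rightarrow> real \<Rightarrow> 'i set \<Rightarrow> (real measure \<times> (real \<Rightarrow> real)) list" where
  "weighted \<mu> w I = map (\<lambda>i. (\<mu> i, \<lambda>t. w)) (SOME l. set l = I \<and> distinct l)"

lemma weighted:
  assumes "finite I"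
  shows signed_integral_weighted: "signed_integral (weighted \<mu> w I) f = w * (\<Sum>i\<in>I. \<integral>t. f t \<partial>\<mu> i)"
    and positive_weighted: "0 \<le> w \<Longrightarrow> (\<And>i. i \<in> I \<Longrightarrow> bounded_measure b (\<mu> i)) \<Longrightarrow> positive_weights b (weighted \<mu> w I)"
proof -
  define l where "l = (SOME l. set l = I \<and> distinct l)"
  have l: "set l = I" "distinct l"
    using someI_ex[OF finite_distinct_list[OF assms]] by (auto simp: l_def)
  have "signed_integral (weighted \<mu> w I) f = (\<Sum>i\<leftarrow>l. \<integral>t. f t * w \<partial>\<mu> i)"
    by (simp add: signed_integral_def weighted_def l_def o_def)
  also have "\<dots> = (\<Sum>i\<in>I. \<integral>t. f t * w \<partial>\<mu> i)"
    using sum.distinct_set_conv_list[OF l(2)] l(1) by metis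
  finally show "signed_integral (weighted \<mu> w I) f = w * (\<Sum>i\<in>I. \<integral>t. f t \<partial>\<mu> i)"
    by (simp add: sum_distrib_left mult.commute)
  show "positive_weights b (weighted \<mu> w I)" if "0 \<le> w" "\<And>i. i \<in> I \<Longrightarrow> bounded_measure b (\<mu> i)"
    using that l(1) by (auto simp: positive_weights_def weighted_def l_def[symmetric] bounded_fun_intros)
qed

lemma (in complex_operator) measure_smeas_i:
  assumes "S \<in> sets borel"
  shows "measure (smeas (cscale \<i> u)) S = measure (smeas u) S"
proof -
  have "(Z ^^ j) (cscale \<i> u) \<bullet> cscale \<i> u = (Z ^^ j) u \<bullet> u" for j
    using funpow_commute_apply[of "cscale \<i>" Z j u] by (simp add: Z_i inner_cscale_i flip: funpow_commute_apply)
  then have "is_spectral_measure Z b u (smeas (cscale \<i> u))"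
    using smeas[of "cscale \<i> u"] by (simp add: is_spectral_measure_def)
  then have "(\<integral>t. indicat_real S t \<partial>smeas (cscale \<i> u)) = (\<integral>t. indicat_real S t \<partial>smeas u)"
    using smeas bounded_fun_intros(3)[OF assms] by (rule spectral_measure_unique)
  then show ?thesis by (simp add: space_\<mu>)
qed

lemma norm_funpow_le:
  fixes Z :: "'a::real_normed_vector \<Rightarrow> 'a"
  assumes "\<And>u. norm (Z u) \<le> b * norm u" "0 \<le> b"
  shows "norm ((Z ^^ j) u) \<le> b ^ j * norm u"
proof (induction j)
  case (Suc j)
  have "norm (Z ((Z ^^ j) u)) \<le> b * norm ((Z ^^ j) u)" by (rule assms)
  also have "\<dots> \<le> b * (b ^ j * norm u)" using Suc assms by (intro mult_left_mono)
  finally show ?case by (simp add: mult.assoc)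
qed simp

context twisted_convolution
begin

text \<open>The compression to the preimage of \<open>X\<close>, extended by zero.\<close>

definition cop :: "'q set \<Rightarrow> ('g, complex ^ 'd) l2 \<Rightarrow> ('g, complex ^ 'd) l2" where
  "cop X f = restr (preimage G p X) (op (restr (preimage G p X) f))"

lemma cop_le: "norm (cop X f) \<le> bound * norm f"
proof -
  have "norm (cop X f) \<le> norm (op (restr (preimage G p X) f))"
    unfolding cop_def by (rule norm_restr_le)
  also have "\<dots> \<le> bound * norm (restr (preimage G p X) f)" by (rule norm_op_le)
  also have "\<dots> \<le> bound * norm f"
    using bound_pos norm_restr_le by (intro mult_left_mono) auto
  finally show ?thesis .
qed

lemma complex_operator_op: "complex_operator (carrier G) op bound"
  by standard (simp_all add: op_symmetric bound_pos norm_op_le restr_op op_restr op_cscale)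

lemma complex_operator_cop: "complex_operator (preimage G p X) (cop X) bound"
proof
  show "symmetric_op (cop X)"
    unfolding cop_def by (rule symmetric_op_conjugate[OF symmetric_op_restr op_symmetric])
qed (simp_all add: bound_pos cop_le, simp_all add: cop_def restr_restr op_cscale restr_cscale)

abbreviation "full_measure \<equiv> complex_operator.smeas op bound"
abbreviation "cut_measure X \<equiv> complex_operator.smeas (cop X) bound"

lemma full_measure: "is_spectral_measure op bound u (full_measure u)"
  by (rule complex_operator.smeas[OF complex_operator_op])

lemma cut_measure: "is_spectral_measure (cop X) bound u (cut_measure X u)"
  by (rule complex_operator.smeas[OF complex_operator_cop])

text \<open>The factor \<open>1 / 2\<close> compensates for summing over a real basis: the measures at \<open>v\<close> and \<open>\<i> v\<close> agree.\<close>

lemma spectral_density_eq: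
  "spectral_density G \<sigma> A t = complex_of_real (1 / 2 * (\<Sum>v\<in>Basis. measure (full_measure (single \<one> v)) {..t}))"
proof -
  interpret complex_operator "carrier G" op bound by (rule complex_operator_op)
  have "ip (borel_calculus (carrier G) T (indicator {..t}) (coeff (single \<one> v))) (coeff (single \<one> v))
      = complex_of_real (measure (full_measure (single \<one> v)) {..t})" for v
    by (rule borel_calculus_indicator) (simp_all add: coeff_op restr_single)
  then have "spectral_density G \<sigma> A t = (\<Sum>a\<in>UNIV. complex_of_real (measure (full_measure (single \<one> (axis a 1))) {..t}))"
    by (simp add: spectral_density_def tau_def entry_def coeff_single_basis[symmetric])
  then show ?thesis
    by (simp add: axis_Basis_sum single_axis_i measure_smeas_i sum_distrib_left)
qed

lemma spectral_density_on_eq: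
  assumes X: "X \<subseteq> carrier Q"
  shows "spectral_density_on G p s \<sigma> A X t
    = complex_of_real (1 / (2 * real (card X)) * (\<Sum>x\<in>X. \<Sum>v\<in>Basis. measure (cut_measure X (single (s x) v)) {..t}))"
proof -
  let ?Y = "preimage G p X"
  interpret complex_operator ?Y "cop X" bound by (rule complex_operator_cop)
  have "compression ?Y T (coeff u) = coeff (cop X u)" if "restr ?Y u = u" for u
    using that by (auto simp: compression_def cut_def cop_def coeff_restr coeff_op)
  moreover have "restr ?Y (single (s x) v) = single (s x) v" if "x \<in> X" for x and v :: "complex ^ 'd"
    using sect[of x] that X by (auto simp: restr_single preimage_def)
  ultimately have "ip (borel_calculus ?Y (compression ?Y T) (indicator {..t}) (coeff (single (s x) v))) (coeff (single (s x) v))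
      = complex_of_real (measure (cut_measure X (single (s x) v)) {..t})" if "x \<in> X" for x v
    using that by (intro borel_calculus_indicator) auto
  then have "spectral_density_on G p s \<sigma> A X t
      = 1 / of_nat (card X) * (\<Sum>a\<in>UNIV. \<Sum>x\<in>X. complex_of_real (measure (cut_measure X (single (s x) (axis a 1))) {..t}))"
    by (simp add: spectral_density_on_def tau_on_def entry_def coeff_single_basis[symmetric])
  also have "(\<Sum>a\<in>UNIV. \<Sum>x\<in>X. complex_of_real (measure (cut_measure X (single (s x) (axis a 1))) {..t}))
      = complex_of_real (\<Sum>x\<in>X. \<Sum>a\<in>UNIV. measure (cut_measure X (single (s x) (axis a 1))) {..t})"
    by (subst sum.swap) simp
  also have "(\<Sum>x\<in>X. \<Sum>a\<in>UNIV. measure (cut_measure X (single (s x) (axis a 1))) {..t})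
      = 1 / 2 * (\<Sum>x\<in>X. \<Sum>v\<in>Basis. measure (cut_measure X (single (s x) v)) {..t})"
    by (simp add: axis_Basis_sum single_axis_i measure_smeas_i sum_distrib_left)
  finally show ?thesis by simp
qed

subsection \<open>Moments\<close>

text \<open>Powers of the operator up to \<open>j\<close> spread a function at \<open>x\<close> over the fibres of \<open>reach j\<close> times \<open>x\<close> only.\<close>

primrec reach :: "nat \<Rightarrow> 'q set" where
  "reach 0 = {\<one>\<^bsub>Q\<^esub>}"
| "reach (Suc j) = reach j \<union> (\<lambda>(g, w). p g \<otimes>\<^bsub>Q\<^esub> w) ` (supp \<times> reach j)"

lemma reach: "finite (reach j)" "reach j \<subseteq> carrier Q"
  using finite_supp supp_carrier p_closed by (induction j) auto

lemma op_pow_support: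
  assumes x: "x \<in> carrier Q"
  shows "restr (preimage G p ((\<lambda>w. w \<otimes>\<^bsub>Q\<^esub> x) ` reach j)) ((op ^^ j) (single (s x) v)) = (op ^^ j) (single (s x) v)"
proof (induction j)
  case 0
  show ?case using sect[OF x] x by (simp add: restr_single preimage_def)
next
  case (Suc j)
  define f where "f = (op ^^ j) (single (s x) v)"
  let ?R = "\<lambda>j. (\<lambda>w. w \<otimes>\<^bsub>Q\<^esub> x) ` reach j"
  have f0: "coeff f y = 0" if "y \<notin> preimage G p (?R j)" for y
    using arg_cong[OF Suc, of "\<lambda>f. coeff f y"] that by (simp add: coeff_restr f_def)
  have "coeff (op f) y = 0" if y: "y \<notin> preimage G p (?R (Suc j))" for y
  proof (cases "y \<in> carrier G")
    case True
    have "coeff f (inv g \<otimes> y) = 0" if g: "g \<in> supp" for g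
    proof (rule f0, rule notI)
      have gG: "g \<in> carrier G" using g by (rule supp_carrier)
      assume "inv g \<otimes> y \<in> preimage G p (?R j)"
      then obtain w where w: "w \<in> reach j" "p (inv g \<otimes> y) = w \<otimes>\<^bsub>Q\<^esub> x" by (auto simp: preimage_def)
      have "p y = p (g \<otimes> (inv g \<otimes> y))"
        using gG True by (simp add: G.m_assoc[symmetric])
      also have "\<dots> = p g \<otimes>\<^bsub>Q\<^esub> p (inv g \<otimes> y)"
        using gG True by (intro p_mult) auto
      also have "\<dots> = (p g \<otimes>\<^bsub>Q\<^esub> w) \<otimes>\<^bsub>Q\<^esub> x"
        using w x reach(2)[of j] p_closed[OF gG] by (auto simp: Q.m_assoc)
      finally have "p y \<in> ?R (Suc j)" using g w(1) by auto
      then show False using y True by (simp add: preimage_def)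
    qed
    then show ?thesis by (simp add: coeff_op_sum)
  qed (simp add: coeff_op_sum)
  then show ?case
    by (intro l2_eqI) (simp add: coeff_restr f_def)
qed

lemma cop_pow_eq:
  assumes x: "x \<in> carrier Q" and X: "(\<lambda>w. w \<otimes>\<^bsub>Q\<^esub> x) ` reach j \<subseteq> X"
  shows "(cop X ^^ j) (single (s x) v) = (op ^^ j) (single (s x) v)"
  using X
proof (induction j)
  case (Suc j)
  have sub: "restr (preimage G p X) ((op ^^ i) (single (s x) v)) = (op ^^ i) (single (s x) v)"
    if "(\<lambda>w. w \<otimes>\<^bsub>Q\<^esub> x) ` reach i \<subseteq> X" for i
  proof -
    have "preimage G p X \<inter> preimage G p ((\<lambda>w. w \<otimes>\<^bsub>Q\<^esub> x) ` reach i) = preimage G p ((\<lambda>w. w \<otimes>\<^bsub>Q\<^esub> x) ` reach i)"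
      using that by (auto simp: preimage_def)
    then show ?thesis
      using op_pow_support[OF x, of i v] restr_restr by metis
  qed
  have "(\<lambda>w. w \<otimes>\<^bsub>Q\<^esub> x) ` reach j \<subseteq> X" using Suc.prems by auto
  then show ?case
    using Suc.IH sub[of j] sub[OF Suc.prems] by (simp add: cop_def)
qed simp

lemma moment_bound:
  assumes "\<And>u. norm (Z u) \<le> bound * norm u" "norm u = 1"
  shows "\<bar>(Z ^^ j) u \<bullet> u\<bar> \<le> bound ^ j"
  using Cauchy_Schwarz_ineq2[of "(Z ^^ j) u" u] norm_funpow_le[of Z bound j u] assms bound_pos by simp

text \<open>Only the points \<open>x\<close> for which \<open>reach j\<close> times \<open>x\<close> leaves \<open>X\<close> contribute to the difference, each with at most
  \<open>2 bound\<^sup>j\<close> per basis vector.\<close>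

lemma averaged_moment_bound:
  assumes X: "finite X" "X \<noteq> {}" "X \<subseteq> carrier Q"
  shows "\<bar>1 / (2 * real (card X)) * (\<Sum>x\<in>X. \<Sum>v\<in>Basis. (cop X ^^ j) (single (s x) v) \<bullet> single (s x) v)
      - 1 / 2 * (\<Sum>v\<in>Basis. (op ^^ j) (single \<one> v) \<bullet> single \<one> v)\<bar>
    \<le> real DIM(complex ^ 'd) * bound ^ j * (real (card (near_boundary Q (reach j) X)) / real (card X))"
proof -
  let ?n = "real (card X)"
  let ?B = "near_boundary Q (reach j) X"
  have n: "?n > 0" using X by (simp add: card_gt_0_iff)
  define d where "d x v = (cop X ^^ j) (single (s x) v) \<bullet> single (s x) v - (op ^^ j) (single \<one> v) \<bullet> single \<one> v"
    for x and v :: "complex ^ 'd"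
  have d_le: "\<bar>d x v\<bar> \<le> 2 * bound ^ j" if "v \<in> Basis" for x v
  proof -
    have "norm (single (s x) v) = 1" "norm (single \<one> v) = 1" using that by (simp_all add: norm_single)
    then have "\<bar>(cop X ^^ j) (single (s x) v) \<bullet> single (s x) v\<bar> \<le> bound ^ j"
        "\<bar>(op ^^ j) (single \<one> v) \<bullet> single \<one> v\<bar> \<le> bound ^ j"
      by (auto intro!: moment_bound cop_le norm_op_le)
    then show ?thesis unfolding d_def by linarith
  qed
  have d_zero: "d x v = 0" if x: "x \<in> X - ?B" for x v
  proof -
    have "x \<in> carrier Q" "(\<lambda>w. w \<otimes>\<^bsub>Q\<^esub> x) ` reach j \<subseteq> X"
      using x X by (auto simp: near_boundary_def)
    then show ?thesis
      using moments_homogeneous[of "s x" j v] sect[of x] cop_pow_eq[of x j X v] by (simp add: d_def)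
  qed
  have "1 / (2 * ?n) * (\<Sum>x\<in>X. \<Sum>v\<in>Basis. (cop X ^^ j) (single (s x) v) \<bullet> single (s x) v)
      - 1 / 2 * (\<Sum>v\<in>Basis. (op ^^ j) (single \<one> v) \<bullet> single \<one> v)
      = 1 / (2 * ?n) * (\<Sum>x\<in>X. \<Sum>v\<in>Basis. d x v)"
    using n by (simp add: d_def sum_subtractf field_simps)
  also have "\<bar>\<dots>\<bar> = 1 / (2 * ?n) * \<bar>\<Sum>x\<in>?B. \<Sum>v\<in>Basis. d x v\<bar>"
  proof -
    have "(\<Sum>x\<in>X. \<Sum>v\<in>Basis. d x v) = (\<Sum>x\<in>?B. \<Sum>v\<in>Basis. d x v)"
      using X d_zero by (intro sum.mono_neutral_right) (auto simp: near_boundary_def)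
    then show ?thesis using n by (simp add: abs_mult)
  qed
  also have "\<dots> \<le> 1 / (2 * ?n) * (\<Sum>x\<in>?B. \<Sum>v\<in>(Basis :: (complex ^ 'd) set). 2 * bound ^ j)"
    using n d_le by (intro mult_left_mono order_trans[OF sum_abs] sum_mono) auto
  also have "\<dots> = real DIM(complex ^ 'd) * bound ^ j * (real (card ?B) / ?n)"
    by simp
  finally show ?thesis .
qed

subsection \<open>Atoms\<close>

lemma funpow_eq_on_range:
  fixes Z W :: "('k, 'e::real_inner) l2 \<Rightarrow> ('k, 'e) l2"
  assumes "\<And>f. restr Y f = f \<Longrightarrow> Z f = W f \<and> restr Y (Z f) = Z f" "restr Y u = u"
  shows "(Z ^^ n) u = (W ^^ n) u \<and> restr Y ((Z ^^ n) u) = (Z ^^ n) u"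
proof (induction n)
  case (Suc n)
  then show ?case using assms(1)[of "(Z ^^ n) u"] by auto
qed (use assms(2) in simp)

text \<open>The mass of \<open>{t}\<close> under a spectral measure is the squared norm of the eigenprojection, so this is
  \<open>kernel_trace_inequality\<close> for \<open>A - t\<close>, scaled to a contraction.  The values \<open>(A f)(x)\<close> involve \<open>f\<close> over
  \<open>p(g)\<inverse> p(x)\<close> for \<open>g\<close> in the support of \<open>A\<close>, which determines \<open>D\<close>.\<close>

lemma atom_le:
  assumes X: "finite X" "X \<noteq> {}" "X \<subseteq> carrier Q"
  defines "D \<equiv> near_boundary Q ((\<lambda>g. inv\<^bsub>Q\<^esub> p g) ` supp) X"
  shows "1 / 2 * (\<Sum>v\<in>Basis. measure (full_measure (single \<one> v)) {t})
    \<le> 1 / (2 * real (card X)) * (\<Sum>x\<in>X. \<Sum>v\<in>Basis. measure (cut_measure X (single (s x) v)) {t})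
      + real DIM(complex ^ 'd) / 2 * (real (card D) / real (card X))"
proof -
  let ?Y = "preimage G p X"
  let ?n = "real (card X)"
  have n: "?n > 0" using X by (simp add: card_gt_0_iff)
  define c where "c = 1 / (bound + \<bar>t\<bar>)"
  have c: "c > 0" "c * (bound + \<bar>t\<bar>) = 1" using bound_pos by (simp_all add: c_def)
  have small: "(c * (r - t))\<^sup>2 \<le> 1" if "r \<in> {-bound..bound}" for r
  proof -
    have "\<bar>r - t\<bar> \<le> bound + \<bar>t\<bar>" using that by auto
    then have "\<bar>c * (r - t)\<bar> \<le> c * (bound + \<bar>t\<bar>)"
      using c(1) by (simp add: abs_mult)
    then show ?thesis using c(2) by (simp add: abs_square_le_1)
  qed
  define shifted where "shifted Z f = c *\<^sub>R (Z f - t *\<^sub>R f)" for Z and f :: "('g, complex ^ 'd) l2"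
  have shifted: "symmetric_op (shifted Z)" "norm (shifted Z f) \<le> norm f"
    if "symmetric_op Z" "\<And>f. norm (Z f) \<le> bound * norm f" for Z f
  proof -
    show "symmetric_op (shifted Z)"
      unfolding shifted_def by (intro symmetric_op_scale symmetric_op_diff that symmetric_op_id)
    have "norm (Z f - t *\<^sub>R f) \<le> bound * norm f + \<bar>t\<bar> * norm f"
      using norm_triangle_ineq4[of "Z f" "t *\<^sub>R f"] that(2)[of f] by simp
    also have "\<dots> = (bound + \<bar>t\<bar>) * norm f" by (simp add: distrib_right)
    finally have "c * norm (Z f - t *\<^sub>R f) \<le> c * ((bound + \<bar>t\<bar>) * norm f)"
      using c(1) by (intro mult_left_mono) auto
    then show "norm (shifted Z f) \<le> norm f"
      using c by (simp add: shifted_def mult.assoc[symmetric])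
  qed
  have cop_sym: "symmetric_op (cop X)"
    using complex_operator_cop by (rule complex_operator.sym_Z)
  note A1 = shifted[OF op_symmetric norm_op_le] and A2 = shifted[OF cop_sym cop_le]
  have equi: "equivariant (shifted op)"
    using equivariant_op unfolding equivariant_def shifted_def
    by (simp add: linear_scale[OF right_trans_linear[OF group_G]] linear_diff[OF right_trans_linear[OF group_G]] H_carrier)
  have local: "coeff (shifted op f) x = coeff (shifted op (restr ?Y f)) x" if x: "x \<in> preimage G p (X - D)" for f x
  proof -
    have xY: "x \<in> carrier G" "p x \<in> X" "p x \<notin> D" using x by (auto simp: preimage_def)
    have "inv g \<otimes> x \<in> ?Y" if g: "g \<in> supp" for g
    proof -
      have gG: "g \<in> carrier G" using g by (rule supp_carrier)
      have "inv\<^bsub>Q\<^esub> p g \<otimes>\<^bsub>Q\<^esub> p x \<in> X"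
        using xY g by (auto simp: D_def near_boundary_def)
      then show ?thesis
        using gG xY by (simp add: preimage_def p_mult p_inv)
    qed
    then have "coeff (op f) x = coeff (op (restr ?Y f)) x"
      by (simp add: coeff_op_sum coeff_restr cong: sum.cong)
    then show ?thesis
      using xY by (simp add: shifted_def coeff_scaleR coeff_diff coeff_restr preimage_def)
  qed
  define C where "C = (\<lambda>f. restr ?Y (shifted op (restr ?Y f)))"
  have D: "D \<subseteq> X" by (auto simp: D_def near_boundary_def)
  have ineq: "(\<Sum>x\<in>X. \<Sum>v\<in>Basis. (norm (kernel_projection (\<lambda>f. shifted op (shifted op f)) (single (s x) (v :: complex ^ 'd))))\<^sup>2)
      \<le> (\<Sum>x\<in>X. \<Sum>v\<in>Basis. (norm (kernel_projection (\<lambda>f. C (C f)) (single (s x) v)))\<^sup>2) + real (card D) * real DIM(complex ^ 'd)"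
    unfolding C_def by (rule kernel_trace_inequality[where A="shifted op", OF X(1,3) D A1 equi local])
  have full: "(norm (kernel_projection (\<lambda>f. shifted op (shifted op f)) (single (s x) v)))\<^sup>2 = measure (full_measure (single \<one> v)) {t}"
    if x: "x \<in> X" for x and v :: "complex ^ 'd"
  proof -
    have sG: "s x \<in> carrier G" using x X sect[of x] by auto
    have "is_spectral_measure op bound (single (s x) v) (full_measure (single \<one> v))"
      using full_measure[of "single \<one> v"]
      unfolding is_spectral_measure_def moments_homogeneous[OF sG] .
    from spectral_measure_atom[OF op_symmetric this c(1) small] between_0_1_square[OF A1]
    show ?thesis unfolding shifted_def by simp
  qed
  have cut: "(norm (kernel_projection (\<lambda>f. C (C f)) (single (s x) v)))\<^sup>2 = measure (cut_measure X (single (s x) v)) {t}"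
    if x: "x \<in> X" for x and v :: "complex ^ 'd"
  proof -
    let ?u = "single (s x) v"
    have u: "restr ?Y ?u = ?u"
      using x X sect[of x] by (auto simp: restr_single preimage_def)
    have CC: "C f = shifted (cop X) f \<and> restr ?Y (C f) = C f" if "restr ?Y f = f" for f
      using that by (auto simp: C_def shifted_def cop_def restr_restr
          linear_scale[OF symmetric_op_linear[OF symmetric_op_restr]] linear_diff[OF symmetric_op_linear[OF symmetric_op_restr]])
    have step: "f - C (C f) = f - shifted (cop X) (shifted (cop X) f) \<and> restr ?Y (f - C (C f)) = f - C (C f)" if "restr ?Y f = f" for f
      using CC[OF that] CC[OF conjunct2[OF CC[OF that]]] that
      by (auto simp: linear_diff[OF symmetric_op_linear[OF symmetric_op_restr]])
    \<comment> \<open>The two operators differ off the functions over \<open>X\<close>, but the powers applied to \<open>?u\<close> stay inside.\<close>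
    have "kernel_projection (\<lambda>f. C (C f)) ?u = kernel_projection (\<lambda>f. shifted (cop X) (shifted (cop X) f)) ?u"
      unfolding kernel_projection_def
      using funpow_eq_on_range[of ?Y "\<lambda>f. f - C (C f)" "\<lambda>f. f - shifted (cop X) (shifted (cop X) f)", OF step u] by simp
    then show ?thesis
      using spectral_measure_atom[OF cop_sym cut_measure[of X ?u] c(1) small] between_0_1_square[OF A2]
      unfolding shifted_def by simp
  qed
  have "?n * (\<Sum>v\<in>Basis. measure (full_measure (single \<one> v)) {t})
      \<le> (\<Sum>x\<in>X. \<Sum>v\<in>Basis. measure (cut_measure X (single (s x) v)) {t}) + real (card D) * real DIM(complex ^ 'd)"
    using ineq by (simp add: full cut)
  then show ?thesis
    using n by (simp add: field_simps)
qed

theorem spectral_densities_converge: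
  assumes S: "finite_generating_set Q S" and X: "foelner_exhaustion Q S X"
  shows "(\<lambda>m. spectral_density_on G p s \<sigma> A (X m) t) \<longlonglongrightarrow> spectral_density G \<sigma> A t"
proof -
  have Xm: "finite (X m)" "X m \<noteq> {}" "X m \<subseteq> carrier Q" for m
    using X by (auto simp: foelner_exhaustion_def)
  let ?B = "Basis :: (complex ^ 'd) set"
  define xs where "xs m = weighted (\<lambda>(x, v). cut_measure (X m) (single (s x) v)) (1 / (2 * real (card (X m)))) (X m \<times> ?B)" for m
  define ys where "ys = weighted (\<lambda>v. full_measure (single \<one> v)) (1 / 2) ?B"
  have xs: "signed_integral (xs m) f
      = 1 / (2 * real (card (X m))) * (\<Sum>x\<in>X m. \<Sum>v\<in>?B. \<integral>r. f r \<partial>cut_measure (X m) (single (s x) v))" for m f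
    unfolding xs_def using Xm[of m]
    by (subst signed_integral_weighted) (simp_all add: sum.cartesian_product case_prod_beta)
  have ys: "signed_integral ys f = 1 / 2 * (\<Sum>v\<in>?B. \<integral>r. f r \<partial>full_measure (single \<one> v))" for f
    unfolding ys_def by (rule signed_integral_weighted) simp
  have pos: "positive_weights bound (xs m)" "positive_weights bound ys" for m
    unfolding xs_def ys_def using Xm[of m] cut_measure full_measure
    by (auto intro!: positive_weighted simp: is_spectral_measure_def)
  have space: "space (cut_measure Z u) = UNIV" "space (full_measure u) = UNIV" for Z u
    using cut_measure[of Z u] full_measure[of u] sets_eq_imp_space_eq[of _ borel]
    by (auto simp: is_spectral_measure_def bounded_measure_def)
  define F where "F = (\<lambda>g. inv\<^bsub>Q\<^esub> p g) ` supp"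
  define \<epsilon> where "\<epsilon> m = real DIM(complex ^ 'd) / 2 * (real (card (near_boundary Q F (X m))) / real (card (X m)))" for m
  have "(\<lambda>m. signed_integral (xs m) (indicator {..t})) \<longlonglongrightarrow> signed_integral ys (indicator {..t})"
  proof (rule distribution_functions_converge[OF pos])
    fix j
    have mom: "(\<integral>r. r ^ j \<partial>cut_measure Z u) = (cop Z ^^ j) u \<bullet> u" "(\<integral>r. r ^ j \<partial>full_measure u) = (op ^^ j) u \<bullet> u" for Z u
      using cut_measure[of Z u] full_measure[of u] by (simp_all add: is_spectral_measure_def)
    have "(\<lambda>m. signed_integral (xs m) (\<lambda>r. r ^ j) - signed_integral ys (\<lambda>r. r ^ j)) \<longlonglongrightarrow> 0"
    proof (rule Lim_null_comparison)
      show "\<forall>\<^sub>F m in sequentially. norm (signed_integral (xs m) (\<lambda>r. r ^ j) - signed_integral ys (\<lambda>r. r ^ j))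
          \<le> real DIM(complex ^ 'd) * bound ^ j * (real (card (near_boundary Q (reach j) (X m))) / real (card (X m)))"
        unfolding xs ys mom real_norm_def using averaged_moment_bound[OF Xm] by (intro always_eventually allI)
      show "(\<lambda>m. real DIM(complex ^ 'd) * bound ^ j * (real (card (near_boundary Q (reach j) (X m))) / real (card (X m)))) \<longlonglongrightarrow> 0"
        using tendsto_mult[OF tendsto_const near_boundary_negligible[OF group_Q S X reach]] by simp
    qed
    then show "(\<lambda>m. signed_integral (xs m) (\<lambda>r. r ^ j)) \<longlonglongrightarrow> signed_integral ys (\<lambda>r. r ^ j)"
      by (simp add: LIM_zero_iff)
  next
    show "signed_integral ys (indicator {t}) \<le> signed_integral (xs m) (indicator {t}) + \<epsilon> m" for m
      using atom_le[OF Xm, of t m] by (simp add: xs ys space \<epsilon>_def F_def)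
    show "\<epsilon> \<longlonglongrightarrow> 0"
    proof -
      have "finite F" "F \<subseteq> carrier Q"
        using finite_supp supp_carrier p_closed by (auto simp: F_def)
      from tendsto_mult[OF tendsto_const near_boundary_negligible[OF group_Q S X this]]
      show ?thesis unfolding \<epsilon>_def by simp
    qed
  qed
  then have "(\<lambda>m. complex_of_real (signed_integral (xs m) (indicator {..t}))) \<longlonglongrightarrow> complex_of_real (signed_integral ys (indicator {..t}))"
    by (rule tendsto_of_real)
  then show ?thesis
    unfolding spectral_density_eq spectral_density_on_eq[OF Xm(3)] xs ys by (simp add: space)
qed

end

theorem theorem7p1:
  fixes G :: "('g, 'x) monoid_scheme" and Q :: "('q, 'y) monoid_scheme"
    and H :: "'g set" and p :: "'g \<Rightarrow> 'q" and s :: "'q \<Rightarrow> 'g"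
    and S :: "'q set" and X :: "nat \<Rightarrow> 'q set"
    and \<sigma>' :: "'q \<Rightarrow> 'q \<Rightarrow> complex"
    and A :: "'g \<Rightarrow> complex ^ 'd ^ 'd"
  assumes "group G" and "group Q"
    and "p \<in> epi G Q" and "kernel G Q p = H"
    and "finite_generating_set Q S"
    and "amenable Q"
    and "multiplier Q \<sigma>'"
    and "\<And>x. x \<in> carrier Q \<Longrightarrow> s x \<in> carrier G \<and> p (s x) = x"
    and "A \<in> twisted_matrices G"
    and "self_adjoint_op (carrier G) (twisted_op G (pullback p \<sigma>') A)"
    and "foelner_exhaustion Q S X"
  shows "\<forall>t::real. (\<lambda>m. spectral_density_on G p s (pullback p \<sigma>') A (X m) t)
           \<longlonglongrightarrow> spectral_density G (pullback p \<sigma>') A t"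
proof
  fix t :: real
  interpret twisted_convolution G Q p s \<sigma>' A
  proof (intro twisted_convolution.intro fibred_group.intro twisted_convolution_axioms.intro)
    show "p \<in> hom G Q" using assms(3) by (simp add: epi_def)
  qed (use assms in auto)
  show "(\<lambda>m. spectral_density_on G p s (pullback p \<sigma>') A (X m) t) \<longlonglongrightarrow> spectral_density G (pullback p \<sigma>') A t"
    by (rule spectral_densities_converge) fact+
qed

end
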